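(* There exist absolute constants $c_1,c_2>0$ and $n_0\in\mathbb{N}$ such that the following holds. Let $n\geq n_0$, let $\mu,\nu$ be isotropic log-concave probability measures on $\mathbb{R}^n$, let $X_1,X_2,\ldots$ be independent random points distributed according to $\mu$, and for $N>n$ let $K_N=\mathrm{conv}\{X_1,\ldots,X_N\}$. Then for every $N>n$ with $N\leq \exp(c_1n/L_\nu^2)$, $$\mathbb{E}_{\mu^N}(\nu(K_N))\leq 2\exp\left(-c_2n/L_\nu^2\right).$$
   Context: A log-concave probability measure on $\mathbb{R}^n$ is a Borel probability measure $\mu$ such that $\mu(\lambda A+(1-\lambda)B)\geq \mu(A)^{\lambda}\mu(B)^{1-\lambda}$ for all compact $A,B$ and $\lambda\in(0,1)$, and $\mu(H)<1$ for every hyperplane $H$; it has a density $f_\mu$. It is isotropic if its barycenter is $0$ and its covariance matrix is the identity. For isotropic $\nu$ the isotropic constant is $L_\nu=\|f_\nu\|_\infty^{1/n}$. *)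

theory Defs
  imports "HOL-Analysis.Analysis" "HOL-Probability.Probability"
begin

text \<open>R^n is modelled as the extensional functions {..<n} -> real, i.e. the space of
  the product measure PiM {..<n} (\<lambda>_. lborel); topology = product topology.\<close>

abbreviation Rn :: "nat \<Rightarrow> (nat \<Rightarrow> real) set" where
  "Rn n \<equiv> PiE {..<n} (\<lambda>_. UNIV)"

abbreviation leb :: "nat \<Rightarrow> (nat \<Rightarrow> real) measure" where
  "leb n \<equiv> PiM {..<n} (\<lambda>_. lborel)"

definition minkowski_comb :: "real \<Rightarrow> (nat \<Rightarrow> real) set \<Rightarrow> (nat \<Rightarrow> real) set \<Rightarrow> (nat \<Rightarrow> real) set" where
  "minkowski_comb t A B = {(\<lambda>i. t * a i + (1 - t) * b i) | a b. a \<in> A \<and> b \<in> B}"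

definition hyperplane_Rn :: "nat \<Rightarrow> (nat \<Rightarrow> real) set \<Rightarrow> bool" where
  "hyperplane_Rn n H \<longleftrightarrow> (\<exists>a b. (\<exists>i<n. a i \<noteq> 0) \<and>
      H = {x \<in> Rn n. (\<Sum>i<n. a i * x i) = b})"

definition log_concave :: "nat \<Rightarrow> (nat \<Rightarrow> real) measure \<Rightarrow> bool" where
  "log_concave n \<mu> \<longleftrightarrow> prob_space \<mu> \<and> sets \<mu> = sets (leb n) \<and>
     (\<forall>A B t. compact A \<and> compact B \<and> A \<subseteq> Rn n \<and> B \<subseteq> Rn n \<and> 0 < t \<and> t < 1 \<longrightarrow>
        measure \<mu> (minkowski_comb t A B) \<ge> measure \<mu> A powr t * measure \<mu> B powr (1 - t)) \<and>
     (\<forall>H. hyperplane_Rn n H \<longrightarrow> measure \<mu> H < 1)"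

definition isotropic :: "nat \<Rightarrow> (nat \<Rightarrow> real) measure \<Rightarrow> bool" where
  "isotropic n \<mu> \<longleftrightarrow>
     (\<forall>i<n. integrable \<mu> (\<lambda>x. x i) \<and> (\<integral>x. x i \<partial>\<mu>) = 0) \<and>
     (\<forall>i<n. \<forall>j<n. integrable \<mu> (\<lambda>x. x i * x j) \<and>
        (\<integral>x. x i * x j \<partial>\<mu>) = (if i = j then 1 else 0))"

definition is_density :: "nat \<Rightarrow> (nat \<Rightarrow> real) measure \<Rightarrow> ((nat \<Rightarrow> real) \<Rightarrow> real) \<Rightarrow> bool" where
  "is_density n \<mu> f \<longleftrightarrow> f \<in> borel_measurable (leb n) \<and> (\<forall>x. 0 \<le> f x) \<and>
     \<mu> = density (leb n) (\<lambda>x. ennreal (f x))"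

text \<open>Isotropic constant L = \<parallel>f\<parallel>_\<infinity>^(1/n), the sup norm taken as the essential supremum
  (independent of the chosen version of the density).\<close>
definition isotropic_constant :: "nat \<Rightarrow> (nat \<Rightarrow> real) measure \<Rightarrow> real" where
  "isotropic_constant n \<mu> =
     real_of_ereal (esssup (leb n) (\<lambda>x. ereal ((SOME f. is_density n \<mu> f) x))) powr (1 / real n)"

definition conv_pts :: "nat \<Rightarrow> (nat \<Rightarrow> (nat \<Rightarrow> real)) \<Rightarrow> (nat \<Rightarrow> real) set" where
  "conv_pts N X = {(\<lambda>k. \<Sum>i<N. w i * X i k) | w. (\<forall>i<N. 0 \<le> w i) \<and> (\<Sum>i<N. w i) = 1}"

end

theory Submission
  imports Defs
begin

text \<open>
  A point of conv {X_1, ..., X_N} lies, for every direction, in some halfspace determined by one of the X_i,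
  so it is enough to bound the \<nu>-measure of the set D of points x for which every halfspace containing x
  has \<mu>-measure at least exp (- n / m), where m is of order L^2.

  The key is that halfspace depth behaves well under sums of independent copies: if x has depth at
  least exp (- n / m) for \<mu>, then m x has depth at least exp (- n) for the m-fold convolution of \<mu>.
  In place of the latter we use F, the convolution of the Gaussian exp (- |x|^2 / m) with m copies of \<mu>,
  which is log-concave, has integral (\<pi> m)^(n/2) and satisfies F 0 \<ge> exp (- n) by Jensen's inequality.
  The superlevel set R = {F \<ge> exp (- 9 n)} is convex of volume at most exp (9 n) (\<pi> m)^(n/2). A point outside R
  is separated from R by a halfspace on which F is small; comparing F x with F (x / 2) shows that the integral of F
  over this halfspace is too small for a point of depth exp (- n). Hence D is contained in R / m, whose volume is
  (C / sqrt m)^n, and \<nu> (R / m) \<le> L^n (C / sqrt m)^n \<le> exp (- n) for the chosen m.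

  Log-concavity is only assumed as an inequality for compact sets, so the Prekopa-Leindler inequality for \<mu> and
  the existence of a density of \<nu>, without which the isotropic constant is a junk value, have to be deduced from it.
\<close>

section \<open>Extensional functions as Euclidean space\<close>

text \<open>Smoothing by the Gaussian turns the convolution power of \<mu> into a continuous
  function vanishing at infinity, whose superlevel sets are compact, as the inequality assumed for
  \<mu> demands. The width m matches the m summands: by isotropy each convolution lowers the Jensen
  bound by a factor exp (- n / m), m of them by exp (- n), while the integral remains that of the
  Gaussian. For F only midpoint log-concavity is carried along; this suffices because F is compared
  only at x, 0 and x / 2 and because separation works for midpoint-closed compact sets.

  The exponent 9 pays for this comparison: a halfspace of \<mu>-mass P that cuts off a point outside
  R satisfies P^m \<le> 2 * 2^n * sqrt (exp (- 9 n)) / sqrt (F 0) \<le> 2^(n+1) * exp (- 4 n) \<le>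
  exp (- n).

  For \<nu> the obstacle is to bound masses of small cubes by a multiple of volume. The mass of a
  cube is log-concave in its centre, and \<nu> charges n + 1 affinely independent places. A too
  heavy small cube would force many disjoint cubes between it and these places to be heavy as well,
  exceeding total mass 1.\<close>

text \<open>Only coordinates below n enter, here and in \<open>nsq\<close>. Pointwise differences
  and multiples of points, whose values beyond n need not be \<open>undefined\<close>, can therefore
  be used without restricting them.\<close>

definition ip :: "nat \<Rightarrow> (nat \<Rightarrow> real) \<Rightarrow> (nat \<Rightarrow> real) \<Rightarrow> real" where
  "ip n x y = (\<Sum>i<n. x i * y i)"

definition nsq :: "nat \<Rightarrow> (nat \<Rightarrow> real) \<Rightarrow> real" where
  "nsq n x = (\<Sum>i<n. (x i)\<^sup>2)"

definition cube :: "nat \<Rightarrow> (nat \<Rightarrow> real) \<Rightarrow> real \<Rightarrow> (nat \<Rightarrow> real) set" where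
  "cube n x r = {y \<in> Rn n. \<forall>i<n. \<bar>y i - x i\<bar> \<le> r}"

lemma nsq_nonneg: "0 \<le> nsq n x"
  by (simp add: nsq_def sum_nonneg)

lemma nsq_add_le: "nsq n x \<le> 2 * nsq n (\<lambda>i. x i - y i) + 2 * nsq n y"
proof -
  have "(x i)\<^sup>2 \<le> 2 * (x i - y i)\<^sup>2 + 2 * (y i)\<^sup>2" for i
  proof -
    have "0 \<le> (x i - 2 * y i)\<^sup>2" by simp
    then show ?thesis by (simp add: power2_eq_square algebra_simps)
  qed
  then show ?thesis
    unfolding nsq_def sum_distrib_left sum.distrib[symmetric] by (intro sum_mono)
qed

lemma sq_le_nsq: "i < n \<Longrightarrow> (x i)\<^sup>2 \<le> nsq n x"
  unfolding nsq_def by (rule member_le_sum) auto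

lemma continuous_on_nsq [continuous_intros]:
  "continuous_on S f \<Longrightarrow> continuous_on S (\<lambda>x. nsq n (f x))"
  using continuous_on_product_then_coordinatewise[of S f] unfolding nsq_def
  by (auto intro!: continuous_on_sum continuous_on_power)

lemma continuous_on_ip [continuous_intros]:
  "continuous_on S f \<Longrightarrow> continuous_on S g \<Longrightarrow> continuous_on S (\<lambda>x. ip n (f x) (g x))"
  using continuous_on_product_then_coordinatewise[of S f] continuous_on_product_then_coordinatewise[of S g]
  unfolding ip_def by (auto intro!: continuous_on_sum continuous_on_mult)

lemma space_leb [simp]: "space (leb n) = Rn n"
  by (simp add: space_PiM)

lemma measurable_component_leb [measurable]:
  "(\<lambda>x. x i) \<in> borel_measurable (leb n)"
proof (cases "i < n")
  case True
  then have "(\<lambda>x. x i) \<in> measurable (leb n) lborel"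
    by (intro measurable_component_singleton) auto
  then show ?thesis by simp
next
  case False
  have "(\<lambda>x. x i) \<in> borel_measurable (leb n) \<longleftrightarrow> (\<lambda>x. undefined :: real) \<in> borel_measurable (leb n)"
    using False by (intro measurable_cong) (auto simp: space_PiM PiE_def extensional_def)
  then show ?thesis by simp
qed

lemma measurable_id_leb [measurable]: "(\<lambda>x. x) \<in> borel_measurable (leb n)"
  by (intro measurable_coordinatewise_then_product) measurable

lemma borel_measurable_leb_continuous:
  fixes F :: "(nat \<Rightarrow> real) \<Rightarrow> real"
  assumes "continuous_on UNIV F"
  shows "F \<in> borel_measurable (leb n)"
proof -
  have "F \<in> borel_measurable borel" using assms by (rule borel_measurable_continuous_onI)
  then show ?thesis by (rule measurable_compose[OF measurable_id_leb])
qed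

lemma closed_Rn: "closed (Rn n)"
proof -
  have "Rn n = (\<Inter>i\<in>{n..}. {x. x i = undefined})"
    by (auto simp: PiE_def extensional_def)
  moreover have "closed {x :: nat \<Rightarrow> real. x i = undefined}" for i
    by (intro closed_Collect_eq continuous_intros continuous_on_product_coordinates)
  ultimately show ?thesis by (auto intro!: closed_INT)
qed

text \<open>On \<open>Rn n\<close> the identity into the Borel space and the restriction map back
  are both measurable, so the product sigma-algebra is the trace of the Borel one. This makes
  topological arguments available for sets of \<open>leb n\<close>.\<close>

lemma sets_leb_iff: "A \<in> sets (leb n) \<longleftrightarrow> A \<subseteq> Rn n \<and> A \<in> sets borel"
proof
  assume A: "A \<in> sets (leb n)"
  have m: "(\<lambda>x. restrict x {..<n}) \<in> measurable (borel :: (nat \<Rightarrow> real) measure) (leb n)"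
    by (intro measurable_restrict) (auto intro!: borel_measurable_continuous_onI continuous_on_product_coordinates)
  from sets.sets_into_space[OF A] have sub: "A \<subseteq> Rn n" by simp
  have "A = ((\<lambda>x. restrict x {..<n}) -` A \<inter> space borel) \<inter> Rn n"
    using sub by auto
  moreover have "\<dots> \<in> sets borel"
    using measurable_sets[OF m A] closed_Rn by auto
  ultimately show "A \<subseteq> Rn n \<and> A \<in> sets borel" using sub by simp
next
  assume A: "A \<subseteq> Rn n \<and> A \<in> sets borel"
  then have "(\<lambda>x. x) -` A \<inter> space (leb n) \<in> sets (leb n)"
    using measurable_sets[OF measurable_id_leb, of A n] by simp
  moreover have "(\<lambda>x. x) -` A \<inter> space (leb n) = A" using A by auto
  ultimately show "A \<in> sets (leb n)" by simp
qed

lemma compact_in_sets_leb: "compact A \<Longrightarrow> A \<subseteq> Rn n \<Longrightarrow> A \<in> sets (leb n)"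
  by (simp add: sets_leb_iff compact_imp_closed)

lemma closed_in_sets_leb: "closed A \<Longrightarrow> A \<subseteq> Rn n \<Longrightarrow> A \<in> sets (leb n)"
  by (simp add: sets_leb_iff)

lemma compact_PiE_UNIV:
  fixes K :: "nat \<Rightarrow> real set"
  assumes "\<And>i. compact (K i)"
  shows "compact (PiE UNIV K)"
proof -
  have "compactin (product_topology (\<lambda>_. euclidean) UNIV) (PiE UNIV K)"
    using assms by (subst compactin_PiE) auto
  then show ?thesis by (simp add: euclidean_product_topology)
qed

text \<open>Writing the cube as a product over all indices, with the singleton
  \<open>{undefined}\<close> beyond n, makes Tychonoff's theorem applicable.\<close>

lemma cube_eq_PiE:
  "cube n x r = PiE UNIV (\<lambda>i. if i < n then {x i - r .. x i + r} else {undefined})"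
proof (intro set_eqI iffI)
  fix y assume "y \<in> cube n x r"
  then show "y \<in> PiE UNIV (\<lambda>i. if i < n then {x i - r .. x i + r} else {undefined})"
    by (auto simp: cube_def PiE_iff extensional_def abs_le_iff algebra_simps)
next
  fix y assume "y \<in> PiE UNIV (\<lambda>i. if i < n then {x i - r .. x i + r} else {undefined})"
  then have y: "y i \<in> (if i < n then {x i - r .. x i + r} else {undefined})" for i
    by (simp add: PiE_iff)
  have "\<bar>y i - x i\<bar> \<le> r" if "i < n" for i using y[of i] that by auto
  moreover have "y i = undefined" if "\<not> i < n" for i using y[of i] that by auto
  ultimately show "y \<in> cube n x r" by (simp add: cube_def PiE_iff extensional_def)
qed

lemma compact_cube: "compact (cube n x r)"
  unfolding cube_eq_PiE by (rule compact_PiE_UNIV) auto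

lemma cube_subset: "cube n x r \<subseteq> Rn n" by (auto simp: cube_def)

lemma cube_sets [measurable]: "cube n x r \<in> sets (leb n)"
  using compact_cube cube_subset by (rule compact_in_sets_leb)

lemma compact_bounded_Rn:
  assumes "closed A" "A \<subseteq> Rn n" "\<And>x. x \<in> A \<Longrightarrow> nsq n x \<le> B"
  shows "compact A"
proof -
  have "A \<subseteq> cube n (\<lambda>_. 0) (sqrt B)"
  proof
    fix x assume x: "x \<in> A"
    have "\<bar>x i\<bar> \<le> sqrt B" if "i < n" for i
      using sq_le_nsq[OF that, of x] assms(3)[OF x]
      by (metis order.trans real_sqrt_abs real_sqrt_le_iff)
    then show "x \<in> cube n (\<lambda>_. 0) (sqrt B)" using assms(2) x by (auto simp: cube_def)
  qed
  then have "A = cube n (\<lambda>_. 0) (sqrt B) \<inter> A" by auto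
  then show ?thesis using compact_Int_closed[OF compact_cube assms(1)] by metis
qed

section \<open>Lebesgue measure: affine maps, cubes and Gaussians\<close>

lemma product_sigma_finite_lborel: "product_sigma_finite (\<lambda>_::nat. lborel :: real measure)"
  by (simp add: product_sigma_finite_def sigma_finite_lborel)

lemma sigma_finite_leb: "sigma_finite_measure (leb n)"
  by (intro product_sigma_finite.sigma_finite product_sigma_finite_lborel) auto

text \<open>Both measures are compared on boxes, where the map splits into one-dimensional affine
  ones. It serves translations, the reflection in 0, halving, and dilation by m.\<close>

lemma leb_affine:
  assumes c: "c \<noteq> 0"
  shows "leb n = density (distr (leb n) (leb n) (\<lambda>x. \<lambda>i\<in>{..<n}. d i + c * x i)) (\<lambda>_. ennreal (\<bar>c\<bar> ^ n))"
    (is "_ = ?P")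
proof -
  interpret product_sigma_finite "\<lambda>_::nat. lborel :: real measure" by (rule product_sigma_finite_lborel)
  have T: "(\<lambda>x. \<lambda>i\<in>{..<n}. d i + c * x i) \<in> measurable (leb n) (leb n)"
    by (intro measurable_restrict) measurable
  have "?P = leb n"
  proof (rule PiM_eqI)
    fix A :: "nat \<Rightarrow> real set" assume A: "\<And>i. i \<in> {..<n} \<Longrightarrow> A i \<in> sets lborel"
    define B where "B i = (\<lambda>x. d i + c * x) -` A i" for i
    have B: "B i \<in> sets lborel" if "i < n" for i
    proof -
      have "(\<lambda>x. d i + c * x) -` A i \<inter> space borel \<in> sets borel"
        using A[of i] that by (intro measurable_sets[of _ borel borel]) auto
      then show ?thesis by (simp add: B_def)
    qed
    have eq: "emeasure lborel (A i) = ennreal \<bar>c\<bar> * emeasure lborel (B i)" if "i < n" for i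
      using A[of i] that c
      by (subst lborel_real_affine[OF c, of "d i"])
         (simp add: emeasure_density nn_integral_cmult_indicator nn_integral_cmult emeasure_distr B_def)
    have PA: "PiE {..<n} A \<in> sets (leb n)" using A by (intro sets_PiM_I_finite) auto
    have "(\<lambda>x. \<lambda>i\<in>{..<n}. d i + c * x i) -` PiE {..<n} A \<inter> space (leb n) = PiE {..<n} B"
      unfolding B_def by (intro set_eqI) (simp add: PiE_iff)
    then have "emeasure (distr (leb n) (leb n) (\<lambda>x. \<lambda>i\<in>{..<n}. d i + c * x i)) (PiE {..<n} A)
        = (\<Prod>i<n. emeasure lborel (B i))"
      using PA emeasure_PiM[of "{..<n}" B] B by (simp add: emeasure_distr[OF T])
    then have "emeasure ?P (PiE {..<n} A) = ennreal (\<bar>c\<bar> ^ n) * (\<Prod>i<n. emeasure lborel (B i))"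
      using PA by (simp add: emeasure_density nn_integral_cmult_indicator)
    also have "\<dots> = (\<Prod>i<n. ennreal \<bar>c\<bar> * emeasure lborel (B i))"
      by (simp add: prod.distrib ennreal_power)
    also have "\<dots> = (\<Prod>i<n. emeasure lborel (A i))"
      using eq by (intro prod.cong) auto
    finally show "emeasure ?P (PiE {..<n} A) = (\<Prod>i<n. emeasure lborel (A i))" .
  qed auto
  then show ?thesis by simp
qed

lemma nn_integral_leb_affine:
  assumes F: "F \<in> borel_measurable (leb n)" and c: "c \<noteq> 0"
  shows "(\<integral>\<^sup>+x. F x \<partial>leb n) = ennreal (\<bar>c\<bar> ^ n) * (\<integral>\<^sup>+x. F (\<lambda>i\<in>{..<n}. d i + c * x i) \<partial>leb n)"
proof -
  have T: "(\<lambda>x. \<lambda>i\<in>{..<n}. d i + c * x i) \<in> measurable (leb n) (leb n)"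
    by (intro measurable_restrict) measurable
  show ?thesis
    using F measurable_compose[OF T F]
    by (subst leb_affine[OF c, of n d])
       (simp add: nn_integral_density nn_integral_distr[OF T] nn_integral_cmult)
qed

lemma emeasure_cube:
  assumes "0 \<le> r"
  shows "emeasure (leb n) (cube n x r) = ennreal ((2 * r) ^ n)"
proof -
  interpret product_sigma_finite "\<lambda>_::nat. lborel :: real measure" by (rule product_sigma_finite_lborel)
  have "cube n x r = PiE {..<n} (\<lambda>i. {x i - r .. x i + r})"
    unfolding cube_def by (intro set_eqI) (simp add: PiE_iff abs_diff_le_iff conj_commute Ball_def)
  then have "emeasure (leb n) (cube n x r) = (\<Prod>i<n. emeasure lborel {x i - r .. x i + r})"
    by (simp add: emeasure_PiM)
  also have "\<dots> = ennreal ((2 * r) ^ n)"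
    using assms by (simp add: ennreal_power)
  finally show ?thesis .
qed

lemma nn_integral_gaussian_leb:
  assumes m: "(0::real) < m"
  shows "(\<integral>\<^sup>+x. ennreal (exp (- nsq n x / m)) \<partial>leb n) = ennreal (sqrt (pi * m) ^ n)"
proof -
  interpret product_sigma_finite "\<lambda>_::nat. lborel :: real measure" by (rule product_sigma_finite_lborel)
  have "(\<integral>\<^sup>+x. ennreal (normal_density 0 (sqrt (m/2)) x) \<partial>lborel) = 1"
    using m by (subst nn_integral_eq_integral) auto
  moreover have "ennreal (exp (- x\<^sup>2 / m)) = ennreal (sqrt (pi * m)) * ennreal (normal_density 0 (sqrt (m/2)) x)" for x
    using m by (simp add: normal_density_def ennreal_mult[symmetric])
  ultimately have one: "(\<integral>\<^sup>+x. ennreal (exp (- x\<^sup>2 / m)) \<partial>lborel) = ennreal (sqrt (pi * m))"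
    by (simp add: nn_integral_cmult)
  have "(\<integral>\<^sup>+x. ennreal (exp (- nsq n x / m)) \<partial>leb n) = (\<integral>\<^sup>+x. (\<Prod>i<n. ennreal (exp (- (x i)\<^sup>2 / m))) \<partial>leb n)"
    by (simp add: prod_ennreal exp_sum[symmetric] nsq_def sum_negf sum_divide_distrib)
  also have "\<dots> = (\<Prod>i<n. \<integral>\<^sup>+x. ennreal (exp (- x\<^sup>2 / m)) \<partial>lborel)"
    by (rule product_nn_integral_prod) auto
  also have "\<dots> = ennreal (sqrt (pi * m) ^ n)"
    using m by (simp only: one prod_constant card_lessThan) (simp add: ennreal_power)
  finally show ?thesis .
qed

section \<open>Functional form of log-concavity\<close>

lemma log_concave_minkowski:
  assumes "log_concave n \<mu>" "compact A" "compact B" "A \<subseteq> Rn n" "B \<subseteq> Rn n" "0 < t" "t < 1"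
  shows "measure \<mu> A powr t * measure \<mu> B powr (1 - t) \<le> measure \<mu> (minkowski_comb t A B)"
  using assms unfolding log_concave_def by blast

section \<open>Prekopa-Leindler inequality on the line\<close>

text \<open>With a the maximum of X and b the minimum of Y, the sets (X + b) / 2 and (a + Y) / 2
  both lie in Z, have half the measures of X and Y, and meet at most in the point (a + b) / 2,
  because the first lies to its left and the second to its right.\<close>

lemma brunn_minkowski_half_real:
  fixes X Y Z :: "real set"
  assumes X: "compact X" "X \<noteq> {}" and Y: "compact Y" "Y \<noteq> {}" and Z: "Z \<in> sets borel"
    and sub: "\<And>x y. x \<in> X \<Longrightarrow> y \<in> Y \<Longrightarrow> (x + y) / 2 \<in> Z"
  shows "emeasure lborel X + emeasure lborel Y \<le> 2 * emeasure lborel Z"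
proof -
  obtain a where a: "a \<in> X" "\<And>x. x \<in> X \<Longrightarrow> x \<le> a" using compact_attains_sup[OF X] by auto
  obtain b where b: "b \<in> Y" "\<And>y. y \<in> Y \<Longrightarrow> b \<le> y" using compact_attains_inf[OF Y] by auto
  have half: "emeasure lborel V = 2 * emeasure lborel {z. - d + 2 * z \<in> V}"
    and half_meas: "{z. - d + 2 * z \<in> V} \<in> sets borel" if V: "compact V" for V :: "real set" and d
  proof -
    have V': "V \<in> sets borel" using compact_imp_closed[OF V] by (rule borel_closed)
    have "(\<lambda>z. - d + 2 * z) -` V \<inter> space borel \<in> sets borel"
      using V' by (intro measurable_sets[of _ borel borel]) auto
    then show m: "{z. - d + 2 * z \<in> V} \<in> sets borel" by (simp add: vimage_def)
    have "emeasure lborel V = (\<integral>\<^sup>+x. indicator V x \<partial>lborel)" using V' by simp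
    also have "\<dots> = 2 * (\<integral>\<^sup>+x. indicator V (- d + 2 * x) \<partial>lborel)"
      using V' by (subst nn_integral_real_affine[where c=2 and t="-d"]) auto
    also have "(\<integral>\<^sup>+x. indicator V (- d + 2 * x) \<partial>lborel) = (\<integral>\<^sup>+x. indicator {z. - d + 2 * z \<in> V} x \<partial>lborel)"
      by (intro nn_integral_cong) (auto simp: indicator_def)
    also have "\<dots> = emeasure lborel {z. - d + 2 * z \<in> V}" using m by simp
    finally show "emeasure lborel V = 2 * emeasure lborel {z. - d + 2 * z \<in> V}" .
  qed
  define X' where "X' = {z. - b + 2 * z \<in> X}"
  define Y' where "Y' = {z. - a + 2 * z \<in> Y}"
  have mX: "X' \<in> sets borel" and mY: "Y' \<in> sets borel"
    using half_meas[OF X(1)] half_meas[OF Y(1)] by (auto simp: X'_def Y'_def)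
  have "X' \<inter> Y' \<subseteq> {(a + b) / 2}"
  proof
    fix z assume "z \<in> X' \<inter> Y'"
    then have "- b + 2 * z \<le> a" "b \<le> - a + 2 * z" using a b by (auto simp: X'_def Y'_def)
    then show "z \<in> {(a + b) / 2}" by simp
  qed
  then have null: "emeasure lborel (X' \<inter> Y') = 0"
    using emeasure_mono[of "X' \<inter> Y'" "{(a + b) / 2}" lborel] by simp
  have "X' \<union> Y' \<subseteq> Z"
  proof
    fix z assume "z \<in> X' \<union> Y'"
    then show "z \<in> Z"
      using sub[of "- b + 2 * z" b] sub[of a "- a + 2 * z"] a b by (auto simp: X'_def Y'_def)
  qed
  then have "emeasure lborel (X' \<union> Y') \<le> emeasure lborel Z"
    using Z by (intro emeasure_mono) auto
  moreover have "emeasure lborel (X' \<union> Y') + emeasure lborel (X' \<inter> Y') = emeasure lborel X' + emeasure lborel Y'"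
    using mX mY by (intro emeasure_Un_Int[symmetric]) auto
  ultimately have "emeasure lborel X' + emeasure lborel Y' \<le> emeasure lborel Z" by (simp add: null)
  then have "2 * (emeasure lborel X' + emeasure lborel Y') \<le> 2 * emeasure lborel Z"
    by (intro mult_left_mono) auto
  then show ?thesis
    using half[OF X(1), of b] half[OF Y(1), of a] by (simp add: X'_def Y'_def distrib_left)
qed

text \<open>Fubini for the region below the graph. The scale c allows functions with different
  suprema to be sliced at the same relative height.\<close>

lemma nn_integral_layer_cake:
  fixes A :: "real \<Rightarrow> real"
  assumes [measurable]: "A \<in> borel_measurable borel" and nn: "\<And>x. 0 \<le> A x" and c: "0 < c"
  shows "(\<integral>\<^sup>+x. ennreal (A x) \<partial>lborel) = ennreal c * (\<integral>\<^sup>+\<tau>. emeasure lborel {x. c * \<tau> \<le> A x} * indicator {0<..} \<tau> \<partial>lborel)"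
proof -
  have "(\<integral>\<^sup>+\<tau>. emeasure lborel {x. c * \<tau> \<le> A x} * indicator {0<..} \<tau> \<partial>lborel)
     = (\<integral>\<^sup>+\<tau>. (\<integral>\<^sup>+x. indicator {x. c * \<tau> \<le> A x} x * indicator {0<..} \<tau> \<partial>lborel) \<partial>lborel)"
    by (intro nn_integral_cong) (simp add: nn_integral_multc)
  also have "\<dots> = (\<integral>\<^sup>+x. (\<integral>\<^sup>+\<tau>. indicator {x. c * \<tau> \<le> A x} x * indicator {0<..} \<tau> \<partial>lborel) \<partial>lborel)"
    by (rule lborel_pair.Fubini') measurable
  also have "\<dots> = (\<integral>\<^sup>+x. ennreal (A x / c) \<partial>lborel)"
  proof (intro nn_integral_cong)
    fix x
    have "(\<integral>\<^sup>+\<tau>. indicator {x. c * \<tau> \<le> A x} x * indicator {0<..} \<tau> \<partial>lborel) = (\<integral>\<^sup>+\<tau>. indicator {0<..A x / c} \<tau> \<partial>lborel)"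
      using c by (intro nn_integral_cong) (auto simp: indicator_def field_simps)
    also have "\<dots> = ennreal (A x / c)" using nn[of x] c by simp
    finally show "(\<integral>\<^sup>+\<tau>. indicator {x. c * \<tau> \<le> A x} x * indicator {0<..} \<tau> \<partial>lborel) = ennreal (A x / c)" .
  qed
  finally have "ennreal c * (\<integral>\<^sup>+\<tau>. emeasure lborel {x. c * \<tau> \<le> A x} * indicator {0<..} \<tau> \<partial>lborel) = (\<integral>\<^sup>+x. ennreal c * ennreal (A x / c) \<partial>lborel)"
    by (simp add: nn_integral_cmult)
  also have "\<dots> = (\<integral>\<^sup>+x. ennreal (A x) \<partial>lborel)"
    using c nn by (intro nn_integral_cong) (simp add: ennreal_mult[symmetric])
  finally show ?thesis by simp
qed

text \<open>After division by the suprema a and b, the slices of A and B at a common relative height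
  below 1 are both nonempty, so Brunn-Minkowski bounds the sum of their lengths by twice that of a
  slice of C. Integrating over heights bounds the sum of the normalised integrals, and the
  inequality of arithmetic and geometric means turns the sum into a product.\<close>

lemma prekopa_leindler_half_real:
  fixes A B C :: "real \<Rightarrow> real"
  assumes A [measurable]: "A \<in> borel_measurable borel" and A0: "\<And>x. 0 \<le> A x" and A1: "\<And>x. A x \<le> K"
    and Ac: "\<And>\<tau>. 0 < \<tau> \<Longrightarrow> compact {x. \<tau> \<le> A x}"
    and B [measurable]: "B \<in> borel_measurable borel" and B0: "\<And>x. 0 \<le> B x" and B1: "\<And>x. B x \<le> K"
    and Bc: "\<And>\<tau>. 0 < \<tau> \<Longrightarrow> compact {x. \<tau> \<le> B x}"
    and C [measurable]: "C \<in> borel_measurable borel" and C0: "\<And>x. 0 \<le> C x"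
    and ABC: "\<And>x y. sqrt (A x * B y) \<le> C ((x + y) / 2)"
  shows "(\<integral>\<^sup>+x. ennreal (A x) \<partial>lborel) * (\<integral>\<^sup>+x. ennreal (B x) \<partial>lborel) \<le> (\<integral>\<^sup>+x. ennreal (C x) \<partial>lborel)\<^sup>2"
proof (cases "(\<forall>x. A x = 0) \<or> (\<forall>x. B x = 0)")
  case True
  then show ?thesis by auto
next
  case False
  define a where "a = Sup (range A)"
  define b where "b = Sup (range B)"
  have bdd: "bdd_above (range A)" "bdd_above (range B)"
    using A1 B1 by (auto intro!: bdd_aboveI[of _ K])
  obtain x0 y0 where "A x0 \<noteq> 0" "B y0 \<noteq> 0" using False by auto
  then have "0 < A x0" "0 < B y0" using A0[of x0] B0[of y0] by auto
  moreover have Aa: "A x \<le> a" and Bb: "B x \<le> b" for x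
    unfolding a_def b_def using bdd by (auto intro: cSup_upper)
  ultimately have a: "0 < a" and b: "0 < b" by (meson less_le_trans)+
  define s where "s = sqrt (a * b)"
  have s: "0 < s" using a b by (simp add: s_def)
  \<comment> \<open>Below height 1 both slices are nonempty by the definition of the supremum, above
    it both are empty. The single height 1, where neither argument applies, is a null set.\<close>
  have key: "emeasure lborel {x. a * \<tau> \<le> A x} + emeasure lborel {x. b * \<tau> \<le> B x} \<le> 2 * emeasure lborel {x. s * \<tau> \<le> C x}"
    if \<tau>: "0 < \<tau>" "\<tau> \<noteq> 1" for \<tau>
  proof (cases "\<tau> < 1")
    case True
    have "a * \<tau> < Sup (range A)" "b * \<tau> < Sup (range B)" using a b True by (auto simp: a_def[symmetric] b_def[symmetric])
    then obtain x1 y1 where xy: "a * \<tau> < A x1" "b * \<tau> < B y1"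
      using bdd by (auto simp: less_cSup_iff)
    show ?thesis
    proof (rule brunn_minkowski_half_real)
      show "compact {x. a * \<tau> \<le> A x}" "compact {x. b * \<tau> \<le> B x}"
        using Ac[of "a * \<tau>"] Bc[of "b * \<tau>"] a b \<tau> by auto
      show "{x. a * \<tau> \<le> A x} \<noteq> {}" "{x. b * \<tau> \<le> B x} \<noteq> {}"
        using xy by (auto intro: less_imp_le)
      show "{x. s * \<tau> \<le> C x} \<in> sets borel" by measurable
      fix x y assume "x \<in> {x. a * \<tau> \<le> A x}" "y \<in> {x. b * \<tau> \<le> B x}"
      then have "(a * \<tau>) * (b * \<tau>) \<le> A x * B y" using a b \<tau> A0 by (intro mult_mono) auto
      then have "sqrt ((a * b) * \<tau>\<^sup>2) \<le> sqrt (A x * B y)" by (simp add: power2_eq_square mult_ac)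
      then have "s * \<tau> \<le> sqrt (A x * B y)" using \<tau> by (simp add: real_sqrt_mult s_def)
      then show "(x + y) / 2 \<in> {x. s * \<tau> \<le> C x}" using ABC[of x y] by simp
    qed
  next
    case False
    then have "1 < \<tau>" using \<tau> by simp
    then have "a < a * \<tau>" "b < b * \<tau>" using a b by auto
    then have "{x. a * \<tau> \<le> A x} = {}" "{x. b * \<tau> \<le> B x} = {}"
      using Aa Bb by (auto simp: not_le intro: le_less_trans)
    then show ?thesis by simp
  qed
  let ?IA = "\<integral>\<^sup>+\<tau>. emeasure lborel {x. a * \<tau> \<le> A x} * indicator {0<..} \<tau> \<partial>lborel"
  let ?IB = "\<integral>\<^sup>+\<tau>. emeasure lborel {x. b * \<tau> \<le> B x} * indicator {0<..} \<tau> \<partial>lborel"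
  let ?IC = "\<integral>\<^sup>+\<tau>. emeasure lborel {x. s * \<tau> \<le> C x} * indicator {0<..} \<tau> \<partial>lborel"
  have IA: "(\<integral>\<^sup>+x. ennreal (A x) \<partial>lborel) = ennreal a * ?IA"
    and IB: "(\<integral>\<^sup>+x. ennreal (B x) \<partial>lborel) = ennreal b * ?IB"
    and IC: "(\<integral>\<^sup>+x. ennreal (C x) \<partial>lborel) = ennreal s * ?IC"
    by (rule nn_integral_layer_cake; fact)+
  have "?IA + ?IB = (\<integral>\<^sup>+\<tau>. (emeasure lborel {x. a * \<tau> \<le> A x} + emeasure lborel {x. b * \<tau> \<le> B x}) * indicator {0<..} \<tau> \<partial>lborel)"
    by (subst nn_integral_add[symmetric]) (auto simp: distrib_right)
  also have "\<dots> \<le> (\<integral>\<^sup>+\<tau>. 2 * (emeasure lborel {x. s * \<tau> \<le> C x} * indicator {0<..} \<tau>) \<partial>lborel)"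
  proof (intro nn_integral_mono_AE)
    have "AE \<tau> in lborel. \<tau> \<noteq> (1::real)" by (rule AE_lborel_singleton)
    then show "AE \<tau> in lborel. (emeasure lborel {x. a * \<tau> \<le> A x} + emeasure lborel {x. b * \<tau> \<le> B x}) * indicator {0<..} \<tau>
        \<le> 2 * (emeasure lborel {x. s * \<tau> \<le> C x} * indicator {0<..} \<tau>)"
      by eventually_elim (use key in \<open>auto simp: indicator_def\<close>)
  qed
  also have "\<dots> = 2 * ?IC" by (rule nn_integral_cmult) measurable
  finally have sum: "?IA + ?IB \<le> 2 * ?IC" .
  show ?thesis
  proof (cases "?IC = \<infinity>")
    case True
    then show ?thesis unfolding IC using s by (simp add: ennreal_mult_top)
  next
    case fin: False
    then have "2 * ?IC < \<infinity>" by (simp add: ennreal_mult_less_top less_top)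
    then have "?IA + ?IB < \<infinity>" using sum by (rule order.strict_trans1[rotated])
    then have "?IA < \<infinity>" "?IB < \<infinity>" by auto
    moreover define x where "x = enn2real ?IA"
    moreover define y where "y = enn2real ?IB"
    moreover define z where "z = enn2real ?IC"
    ultimately have xyz: "?IA = ennreal x" "0 \<le> x" "?IB = ennreal y" "0 \<le> y" "?IC = ennreal z" "0 \<le> z"
      using fin by (simp_all add: less_top)
    have two: "2 * ennreal z = ennreal (2 * z)" by (subst ennreal_mult') auto
    from sum have "ennreal (x + y) \<le> ennreal (2 * z)"
      unfolding xyz two using xyz by simp
    then have "x + y \<le> 2 * z" using ennreal_le_iff[of "2 * z" "x + y"] xyz(6) by simp
    then have "(x + y)\<^sup>2 \<le> (2 * z)\<^sup>2" using xyz by (intro power_mono) auto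
    moreover have "0 \<le> (x - y)\<^sup>2" by simp
    ultimately have "x * y \<le> z\<^sup>2" by (simp add: power2_eq_square algebra_simps)
    then have "(a * x) * (b * y) \<le> (s * z)\<^sup>2"
      using a b by (simp add: s_def power_mult_distrib mult_ac)
    then show ?thesis unfolding IA IB IC unfolding xyz
      using a b s xyz by (simp add: ennreal_mult'[symmetric] ennreal_power)
  qed
qed

section \<open>Transfer to log-concave measures through superlevel sets\<close>

text \<open>The layer cake formula with heights written as exp \<alpha>. Geometric means of heights
  become arithmetic means of \<alpha>, which is the form in which the one-dimensional inequality can
  be applied to the integrand.\<close>

lemma nn_integral_level_sets_exp:
  fixes f :: "'a \<Rightarrow> real"
  assumes "prob_space M" and f [measurable]: "f \<in> borel_measurable M" and f0: "\<And>y. 0 \<le> f y"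
  shows "(\<integral>\<^sup>+y. ennreal (f y) \<partial>M) = (\<integral>\<^sup>+\<alpha>. ennreal (measure M {y \<in> space M. exp \<alpha> \<le> f y} * exp \<alpha>) \<partial>lborel)"
proof -
  interpret prob_space M by fact
  interpret P: pair_sigma_finite M "lborel :: real measure" ..
  have tail: "(\<integral>\<^sup>+\<alpha>. ennreal (exp \<alpha>) * indicator {\<alpha>. exp \<alpha> \<le> z} \<alpha> \<partial>lborel) = ennreal z" if z: "0 \<le> z" for z :: real
  proof (cases "z = 0")
    case True
    then have "{\<alpha>. exp \<alpha> \<le> z} = {}" by auto
    then show ?thesis using True by simp
  next
    case False
    then have z: "0 < z" using z by simp
    have "(\<integral>\<^sup>+\<alpha>. ennreal (exp \<alpha>) * indicator {\<alpha>. exp \<alpha> \<le> z} \<alpha> \<partial>lborel)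
       = (\<integral>\<^sup>+\<alpha>. ennreal (exp (- \<alpha>)) * indicator {- ln z..} \<alpha> \<partial>lborel)"
      using z by (subst nn_integral_real_affine[where c="-1" and t=0])
        (auto simp: indicator_def ln_ge_iff minus_le_iff intro!: nn_integral_cong)
    also have "\<dots> = ennreal (0 - (- exp (- (- ln z))))"
    proof (rule nn_integral_FTC_atLeast)
      show "DERIV (\<lambda>x. - exp (- x)) x :> exp (- x)" for x :: real
        by (auto intro!: derivative_eq_intros)
      show "((\<lambda>x. - exp (- x)) \<longlongrightarrow> 0) (at_top :: real filter)"
        using tendsto_minus[OF filterlim_compose[OF exp_at_bot filterlim_uminus_at_bot_at_top]] by simp
    qed auto
    finally show ?thesis using z by simp
  qed
  have "(\<integral>\<^sup>+\<alpha>. ennreal (measure M {y \<in> space M. exp \<alpha> \<le> f y} * exp \<alpha>) \<partial>lborel)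
    = (\<integral>\<^sup>+\<alpha>. (\<integral>\<^sup>+y. ennreal (exp \<alpha>) * indicator {\<alpha>. exp \<alpha> \<le> f y} \<alpha> \<partial>M) \<partial>lborel)"
  proof (intro nn_integral_cong)
    fix \<alpha> :: real
    have "(\<integral>\<^sup>+y. ennreal (exp \<alpha>) * indicator {\<alpha>. exp \<alpha> \<le> f y} \<alpha> \<partial>M) = (\<integral>\<^sup>+y. ennreal (exp \<alpha>) * indicator {y \<in> space M. exp \<alpha> \<le> f y} y \<partial>M)"
      by (intro nn_integral_cong) (auto simp: indicator_def)
    also have "\<dots> = ennreal (exp \<alpha>) * emeasure M {y \<in> space M. exp \<alpha> \<le> f y}"
      by (rule nn_integral_cmult_indicator) measurable
    finally show "ennreal (measure M {y \<in> space M. exp \<alpha> \<le> f y} * exp \<alpha>) = (\<integral>\<^sup>+y. ennreal (exp \<alpha>) * indicator {\<alpha>. exp \<alpha> \<le> f y} \<alpha> \<partial>M)"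
      by (simp add: emeasure_eq_measure ennreal_mult'[symmetric] mult.commute)
  qed
  also have "\<dots> = (\<integral>\<^sup>+y. (\<integral>\<^sup>+\<alpha>. ennreal (exp \<alpha>) * indicator {\<alpha>. exp \<alpha> \<le> f y} \<alpha> \<partial>lborel) \<partial>M)"
    by (rule P.Fubini') measurable
  also have "\<dots> = (\<integral>\<^sup>+y. ennreal (f y) \<partial>M)" using tail f0 by (intro nn_integral_cong) simp
  finally show ?thesis by simp
qed

lemma level_function_measurable:
  fixes f :: "'a \<Rightarrow> real"
  assumes "prob_space M" and f [measurable]: "f \<in> borel_measurable M"
  shows "(\<lambda>\<alpha>. measure M {y \<in> space M. exp \<alpha> \<le> f y} * exp \<alpha>) \<in> borel_measurable borel"
proof -
  interpret prob_space M by fact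
  have "mono (\<lambda>\<alpha>. - measure M {y \<in> space M. exp \<alpha> \<le> f y})"
    by (intro monoI le_imp_neg_le finite_measure_mono) (auto intro: order.trans)
  then have "(\<lambda>\<alpha>. - measure M {y \<in> space M. exp \<alpha> \<le> f y}) \<in> borel_measurable borel"
    by (rule borel_measurable_mono)
  then have "(\<lambda>\<alpha>. - (- measure M {y \<in> space M. exp \<alpha> \<le> f y}) * exp \<alpha>) \<in> borel_measurable borel"
    by (intro borel_measurable_times borel_measurable_uminus) auto
  then show ?thesis by simp
qed

text \<open>The level set is bounded: \<alpha> \<ge> ln \<tau> since probabilities are at most 1,
  and \<alpha> \<le> 0 since f \<le> 1. It is closed because the mass of the superlevel set is
  decreasing and left-continuous in \<alpha>, hence upper semicontinuous. The one-dimensional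
  inequality requires such compact slices.\<close>

lemma compact_level_function:
  fixes f :: "'a \<Rightarrow> real"
  assumes "prob_space M" and f [measurable]: "f \<in> borel_measurable M" and f1: "\<And>y. f y \<le> 1" and \<tau>: "0 < \<tau>"
  shows "compact {\<alpha>. \<tau> \<le> measure M {y \<in> space M. exp \<alpha> \<le> f y} * exp \<alpha>}" (is "compact ?S")
proof -
  interpret prob_space M by fact
  let ?m = "\<lambda>\<alpha>. measure M {y \<in> space M. exp \<alpha> \<le> f y}"
  have "?S \<subseteq> {ln \<tau> .. 0}"
  proof
    fix \<alpha> assume a: "\<alpha> \<in> ?S"
    have "?m \<alpha> * exp \<alpha> \<le> 1 * exp \<alpha>" by (intro mult_right_mono) auto
    then have "\<tau> \<le> exp \<alpha>" using a by (metis (mono_tags, lifting) mem_Collect_eq mult_1 order.trans)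
    then have "ln \<tau> \<le> \<alpha>" using \<tau> by (metis ln_exp ln_le_cancel_iff exp_gt_zero)
    moreover have "\<alpha> \<le> 0"
    proof (rule ccontr)
      assume "\<not> \<alpha> \<le> 0"
      then have "1 < exp \<alpha>" by simp
      then have "{y \<in> space M. exp \<alpha> \<le> f y} = {}" using f1 by (smt (verit) Collect_empty_eq)
      then have "?m \<alpha> = 0" by (metis measure_empty)
      then show False using a \<tau> by simp
    qed
    ultimately show "\<alpha> \<in> {ln \<tau> .. 0}" by simp
  qed
  moreover have "closed ?S"
    unfolding closed_sequential_limits
  proof (intro allI impI)
    fix X l assume "(\<forall>k. X k \<in> ?S) \<and> X \<longlonglongrightarrow> l"
    then have X: "\<tau> \<le> ?m (X k) * exp (X k)" and lim: "X \<longlonglongrightarrow> l" for k by auto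
    \<comment> \<open>A sequence tending to l may approach it from either side, so the mass is first
      compared at a fixed \<beta> below l; afterwards \<beta> increases to l and continuity from
      above applies.\<close>
    have step: "\<tau> \<le> ?m \<beta> * exp l" if "\<beta> < l" for \<beta>
    proof (rule LIMSEQ_le_const)
      show "(\<lambda>k. ?m \<beta> * exp (X k)) \<longlonglongrightarrow> ?m \<beta> * exp l"
        by (intro tendsto_intros lim)
      have "\<forall>\<^sub>F k in sequentially. \<beta> < X k" using order_tendstoD(1)[OF lim that] .
      then obtain k0 where k0: "\<And>k. k0 \<le> k \<Longrightarrow> \<beta> < X k" by (auto simp: eventually_sequentially)
      have "\<tau> \<le> ?m \<beta> * exp (X k)" if "k0 \<le> k" for k
      proof -
        have "exp \<beta> \<le> exp (X k)" using k0[OF that] by simp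
        then have "?m (X k) \<le> ?m \<beta>"
          by (intro finite_measure_mono) (auto intro: order.trans)
        then have "?m (X k) * exp (X k) \<le> ?m \<beta> * exp (X k)" by (intro mult_right_mono) auto
        then show ?thesis using X[of k] by linarith
      qed
      then show "\<exists>k0. \<forall>k\<ge>k0. \<tau> \<le> ?m \<beta> * exp (X k)" by blast
    qed
    define S where "S k = {y \<in> space M. exp (l - inverse (real (Suc k))) \<le> f y}" for k
    have "(\<lambda>k. measure M (S k)) \<longlonglongrightarrow> measure M (\<Inter>k. S k)"
    proof (rule finite_Lim_measure_decseq)
      show "range S \<subseteq> sets M" by (auto simp: S_def)
      show "decseq S" unfolding decseq_def S_def
      proof (intro allI impI subsetI)
        fix i j x assume ij: "i \<le> j" and x: "x \<in> {y \<in> space M. exp (l - inverse (real (Suc j))) \<le> f y}"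
        have "inverse (real (Suc j)) \<le> inverse (real (Suc i))" using ij by (intro le_imp_inverse_le) auto
        then have "exp (l - inverse (real (Suc i))) \<le> exp (l - inverse (real (Suc j)))" by simp
        also have "\<dots> \<le> f x" using x by blast
        finally show "x \<in> {y \<in> space M. exp (l - inverse (real (Suc i))) \<le> f y}" using x by blast
      qed
    qed
    moreover have "(\<Inter>k. S k) = {y \<in> space M. exp l \<le> f y}"
    proof (intro set_eqI iffI)
      fix y assume y: "y \<in> (\<Inter>k. S k)"
      have "(\<lambda>k. exp (l - inverse (real (Suc k)))) \<longlonglongrightarrow> exp (l - 0)"
        by (intro tendsto_intros LIMSEQ_inverse_real_of_nat)
      then have "exp (l - 0) \<le> f y"
        using y by (intro LIMSEQ_le_const2[of _ "exp (l - 0)" "f y"]) (auto simp: S_def)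
      then show "y \<in> {y \<in> space M. exp l \<le> f y}" using y by (auto simp: S_def)
    next
      fix y assume y: "y \<in> {y \<in> space M. exp l \<le> f y}"
      have "exp (l - inverse (real (Suc k))) \<le> f y" for k
      proof -
        have "exp (l - inverse (real (Suc k))) \<le> exp l" by simp
        also have "\<dots> \<le> f y" using y by blast
        finally show ?thesis .
      qed
      then have "y \<in> S k" for k using y unfolding S_def by blast
      then show "y \<in> (\<Inter>k. S k)" by blast
    qed
    ultimately have "(\<lambda>k. measure M (S k) * exp l) \<longlonglongrightarrow> ?m l * exp l"
      by (intro tendsto_intros) simp
    moreover have "\<tau> \<le> measure M (S k) * exp l" for k unfolding S_def by (rule step) simp
    ultimately have "\<tau> \<le> ?m l * exp l" by (rule LIMSEQ_le_const[OF _ exI, OF _ allI, OF _ impI])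
    then show "l \<in> ?S" by simp
  qed
  ultimately show ?thesis
    using compact_Int_closed[of "{ln \<tau> .. 0}" ?S] by (simp only: Int_absorb1 compact_Icc)
qed

text \<open>The three functions \<alpha> \<mapsto> \<mu> {exp \<alpha> \<le> f} * exp \<alpha>, and
  likewise for g and h, satisfy the hypothesis of the one-dimensional inequality: the midpoints of
  the superlevel sets of f and g lie in one of h, and the assumed inequality with t = 1/2 applies
  since these sets are compact.\<close>

lemma log_concave_prekopa_leindler:
  assumes lc: "log_concave n \<mu>"
    and f: "continuous_on UNIV f" and f0: "\<And>y. 0 \<le> f y" and f1: "\<And>y. f y \<le> 1"
    and fc: "\<And>s. 0 < s \<Longrightarrow> compact {y \<in> Rn n. s \<le> f y}"
    and g: "continuous_on UNIV g" and g0: "\<And>y. 0 \<le> g y" and g1: "\<And>y. g y \<le> 1"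
    and gc: "\<And>s. 0 < s \<Longrightarrow> compact {y \<in> Rn n. s \<le> g y}"
    and h: "continuous_on UNIV h" and h0: "\<And>y. 0 \<le> h y"
    and fgh: "\<And>y z. sqrt (f y * g z) \<le> h (\<lambda>i. (y i + z i) / 2)"
  shows "(\<integral>\<^sup>+y. ennreal (f y) \<partial>\<mu>) * (\<integral>\<^sup>+y. ennreal (g y) \<partial>\<mu>) \<le> (\<integral>\<^sup>+y. ennreal (h y) \<partial>\<mu>)\<^sup>2"
proof -
  have ps: "prob_space \<mu>" and sets: "sets \<mu> = sets (leb n)" using lc by (auto simp: log_concave_def)
  interpret prob_space \<mu> by fact
  have space: "space \<mu> = Rn n" using sets_eq_imp_space_eq[OF sets] by simp
  have meas: "F \<in> borel_measurable \<mu>" if "continuous_on UNIV F" for F :: "(nat \<Rightarrow> real) \<Rightarrow> real"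
    using borel_measurable_leb_continuous[OF that, of n] sets by (simp cong: measurable_cong_sets)
  note m = meas[OF f] meas[OF g] meas[OF h]
  have key: "sqrt (measure \<mu> {y \<in> space \<mu>. exp \<alpha> \<le> f y} * exp \<alpha> * (measure \<mu> {y \<in> space \<mu>. exp \<beta> \<le> g y} * exp \<beta>))
     \<le> measure \<mu> {y \<in> space \<mu>. exp ((\<alpha> + \<beta>) / 2) \<le> h y} * exp ((\<alpha> + \<beta>) / 2)" for \<alpha> \<beta>
  proof -
    let ?X = "{y \<in> Rn n. exp \<alpha> \<le> f y}" and ?Y = "{y \<in> Rn n. exp \<beta> \<le> g y}"
    let ?Z = "{y \<in> Rn n. exp ((\<alpha> + \<beta>) / 2) \<le> h y}"
    have e: "sqrt (exp \<alpha> * exp \<beta>) = exp ((\<alpha> + \<beta>) / 2)"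
      by (simp add: exp_add[symmetric] real_sqrt_unique power2_eq_square)
    have "minkowski_comb (1/2) ?X ?Y \<subseteq> ?Z"
    proof
      fix z assume "z \<in> minkowski_comb (1/2) ?X ?Y"
      then obtain x y where xy: "x \<in> ?X" "y \<in> ?Y" and z: "z = (\<lambda>i. (x i + y i) / 2)"
        by (auto simp: minkowski_comb_def add_divide_distrib)
      have "z \<in> Rn n" using xy by (auto simp: z PiE_iff extensional_def)
      moreover have "exp \<alpha> * exp \<beta> \<le> f x * g y" using xy by (intro mult_mono) (auto simp: f0)
      then have "sqrt (exp \<alpha> * exp \<beta>) \<le> sqrt (f x * g y)" by simp
      then have "exp ((\<alpha> + \<beta>) / 2) \<le> h z" unfolding z e using fgh[of x y] by linarith
      ultimately show "z \<in> ?Z" by simp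
    qed
    moreover have "?Z \<in> sets \<mu>" using m(3) unfolding space[symmetric] by measurable
    ultimately have "measure \<mu> (minkowski_comb (1/2) ?X ?Y) \<le> measure \<mu> ?Z"
      by (intro finite_measure_mono)
    moreover have "compact ?X" "compact ?Y" using fc[of "exp \<alpha>"] gc[of "exp \<beta>"] by auto
    then have "measure \<mu> ?X powr (1/2) * measure \<mu> ?Y powr (1 - 1/2) \<le> measure \<mu> (minkowski_comb (1/2) ?X ?Y)"
      by (intro log_concave_minkowski[OF lc]) auto
    ultimately have "sqrt (measure \<mu> ?X) * sqrt (measure \<mu> ?Y) \<le> measure \<mu> ?Z"
      by (simp add: powr_half_sqrt)
    then have "sqrt (measure \<mu> ?X) * sqrt (measure \<mu> ?Y) * sqrt (exp \<alpha> * exp \<beta>) \<le> measure \<mu> ?Z * exp ((\<alpha> + \<beta>) / 2)"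
      unfolding e by (intro mult_right_mono) auto
    then show ?thesis unfolding space by (simp add: real_sqrt_mult mult_ac)
  qed
  have b: "measure \<mu> {y \<in> space \<mu>. exp \<alpha> \<le> F y} * exp \<alpha> \<le> 1" if F1: "\<And>y. F y \<le> 1" for F \<alpha>
  proof (cases "\<alpha> \<le> 0")
    case True
    have "measure \<mu> {y \<in> space \<mu>. exp \<alpha> \<le> F y} * exp \<alpha> \<le> 1 * 1" using True by (intro mult_mono) auto
    then show ?thesis by simp
  next
    case False
    then have "1 < exp \<alpha>" by simp
    then have "{y \<in> space \<mu>. exp \<alpha> \<le> F y} = {}" using F1 by (smt (verit) Collect_empty_eq)
    then show ?thesis by (metis measure_empty mult_zero_left zero_le_one)
  qed
  show ?thesis
    unfolding nn_integral_level_sets_exp[OF ps m(1) f0] nn_integral_level_sets_exp[OF ps m(2) g0]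
      nn_integral_level_sets_exp[OF ps m(3) h0]
    by (rule prekopa_leindler_half_real[where K=1])
       (use key b f1 g1 in \<open>auto intro!: level_function_measurable ps m compact_level_function\<close>)
qed

section \<open>Convolution with a log-concave measure\<close>

lemma closed_Rn_Collect:
  assumes "closed {y. P y}"
  shows "closed {y \<in> Rn n. P y}"
proof -
  have "{y \<in> Rn n. P y} = Rn n \<inter> {y. P y}" by blast
  then show ?thesis using closed_Int[OF closed_Rn assms] by metis
qed

definition convol :: "(nat \<Rightarrow> real) measure \<Rightarrow> ((nat \<Rightarrow> real) \<Rightarrow> real) \<Rightarrow> (nat \<Rightarrow> real) \<Rightarrow> real" where
  "convol \<mu> F x = (\<integral>y. F (\<lambda>i. x i - y i) \<partial>\<mu>)"

text \<open>A class that is stable under \<open>convol \<mu>\<close>. Continuity and the bound 1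
  give dominated convergence, dependence on the first n coordinates allows translations, decay makes
  superlevel sets compact, and the last clause is midpoint log-concavity.\<close>

definition profile :: "nat \<Rightarrow> ((nat \<Rightarrow> real) \<Rightarrow> real) \<Rightarrow> bool" where
  "profile n F \<longleftrightarrow> continuous_on UNIV F \<and> (\<forall>x. 0 \<le> F x \<and> F x \<le> 1) \<and>
     (\<forall>x y. (\<forall>i<n. x i = y i) \<longrightarrow> F x = F y) \<and>
     (\<forall>s>0. \<exists>R. \<forall>x. R < nsq n x \<longrightarrow> F x < s) \<and>
     (\<forall>x y. sqrt (F x * F y) \<le> F (\<lambda>i. (x i + y i) / 2))"

lemma
  assumes "profile n F"
  shows profile_continuous: "continuous_on UNIV F"
    and profile_nonneg: "0 \<le> F x"
    and profile_le_1: "F x \<le> 1"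
    and profile_cong: "(\<And>i. i < n \<Longrightarrow> x i = y i) \<Longrightarrow> F x = F y"
    and profile_midpoint: "sqrt (F x * F y) \<le> F (\<lambda>i. (x i + y i) / 2)"
  using assms unfolding profile_def by blast+

lemma profile_vanishes:
  assumes "profile n F" "0 < s"
  obtains R where "\<And>x. R < nsq n x \<Longrightarrow> F x < s"
  using assms unfolding profile_def by blast

lemma isotropic_integral_nsq:
  assumes ps: "prob_space \<mu>" and iso: "isotropic n \<mu>"
  shows "integrable \<mu> (\<lambda>y. nsq n (\<lambda>i. x i - y i))"
    and "(\<integral>y. nsq n (\<lambda>i. x i - y i) \<partial>\<mu>) = nsq n x + n"
proof -
  interpret prob_space \<mu> by fact
  have 1: "integrable \<mu> (\<lambda>y. y i)" "(\<integral>y. y i \<partial>\<mu>) = 0" if "i < n" for i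
    using iso that by (auto simp: isotropic_def)
  have 2: "integrable \<mu> (\<lambda>y. (y i)\<^sup>2)" "(\<integral>y. (y i)\<^sup>2 \<partial>\<mu>) = 1" if "i < n" for i
    using iso that by (auto simp: isotropic_def power2_eq_square)
  have eq: "(x i - y i)\<^sup>2 = (x i)\<^sup>2 - 2 * x i * y i + (y i)\<^sup>2" for i and y :: "nat \<Rightarrow> real"
    by (simp add: power2_eq_square algebra_simps)
  have 3: "integrable \<mu> (\<lambda>y. (x i - y i)\<^sup>2)" if "i < n" for i
    unfolding eq using 1[OF that] 2[OF that] by auto
  have 4: "(\<integral>y. (x i - y i)\<^sup>2 \<partial>\<mu>) = (x i)\<^sup>2 + 1" if "i < n" for i
    unfolding eq using 1[OF that] 2[OF that] by (simp add: prob_space)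
  show "integrable \<mu> (\<lambda>y. nsq n (\<lambda>i. x i - y i))"
    unfolding nsq_def using 3 by (intro Bochner_Integration.integrable_sum) auto
  show "(\<integral>y. nsq n (\<lambda>i. x i - y i) \<partial>\<mu>) = nsq n x + n"
    unfolding nsq_def using 3 4 by (subst Bochner_Integration.integral_sum) (auto simp: sum.distrib)
qed

text \<open>Jensen's inequality, obtained by integrating the tangent line of exp at minus the
  mean.\<close>

lemma (in prob_space) exp_neg_expectation_le:
  fixes Z :: "'a \<Rightarrow> real"
  assumes Z: "integrable M Z" and E: "integrable M (\<lambda>x. exp (- Z x))"
  shows "exp (- expectation Z) \<le> expectation (\<lambda>x. exp (- Z x))"
proof -
  let ?c = "expectation Z"
  have "exp (- ?c) * (1 + (?c - Z x)) \<le> exp (- Z x)" for x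
  proof -
    have "exp (- ?c) * (1 + (?c - Z x)) \<le> exp (- ?c) * exp (?c - Z x)"
      by (intro mult_left_mono exp_ge_add_one_self) auto
    also have "\<dots> = exp (- Z x)" by (simp add: exp_add[symmetric])
    finally show ?thesis .
  qed
  then have "expectation (\<lambda>x. exp (- ?c) * (1 + (?c - Z x))) \<le> expectation (\<lambda>x. exp (- Z x))"
    using Z E by (intro integral_mono) auto
  moreover have "expectation (\<lambda>x. exp (- ?c) * (1 + (?c - Z x))) = exp (- ?c)"
    using Z by (simp add: prob_space)
  ultimately show ?thesis by simp
qed

lemma continuous_on_diff_left:
  fixes F :: "(nat \<Rightarrow> real) \<Rightarrow> real"
  assumes "continuous_on UNIV F"
  shows "continuous_on UNIV (\<lambda>x. F (\<lambda>i. x i - y i))"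
  by (rule continuous_on_compose2[OF assms])
     (auto intro!: continuous_on_coordinatewise_then_product continuous_on_diff continuous_on_product_coordinates)

lemma continuous_on_diff_right:
  fixes F :: "(nat \<Rightarrow> real) \<Rightarrow> real"
  assumes "continuous_on UNIV F"
  shows "continuous_on UNIV (\<lambda>y. F (\<lambda>i. x i - y i))"
  by (rule continuous_on_compose2[OF assms])
     (auto intro!: continuous_on_coordinatewise_then_product continuous_on_diff continuous_on_product_coordinates)

lemma compact_profile_level:
  assumes F: "profile n F" and s: "0 < s"
  shows "compact {y \<in> Rn n. s \<le> F (\<lambda>i. x i - y i)}"
proof -
  obtain R where R: "\<And>x. R < nsq n x \<Longrightarrow> F x < s" using profile_vanishes[OF F s] by blast
  show ?thesis
  proof (rule compact_bounded_Rn)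
    have "closed {y. s \<le> F (\<lambda>i. x i - y i)}"
      by (rule closed_Collect_le[OF continuous_on_const continuous_on_diff_right[OF profile_continuous[OF F]]])
    then show "closed {y \<in> Rn n. s \<le> F (\<lambda>i. x i - y i)}"
      by (rule closed_Rn_Collect)
    fix y assume "y \<in> {y \<in> Rn n. s \<le> F (\<lambda>i. x i - y i)}"
    then have "\<not> F (\<lambda>i. x i - y i) < s" by simp
    then have "nsq n (\<lambda>i. x i - y i) \<le> R" using R[of "\<lambda>i. x i - y i"] by (cases "R < nsq n (\<lambda>i. x i - y i)") simp_all
    moreover have "nsq n y \<le> 2 * nsq n (\<lambda>i. y i - x i) + 2 * nsq n x" by (rule nsq_add_le)
    moreover have "nsq n (\<lambda>i. y i - x i) = nsq n (\<lambda>i. x i - y i)"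
      by (simp add: nsq_def power2_commute)
    ultimately show "nsq n y \<le> 2 * R + 2 * nsq n x" by simp
  qed auto
qed

text \<open>Midpoint log-concavity is Prekopa-Leindler applied to y \<mapsto> F (x - y) and y
  \<mapsto> F (z - y). For the decay, a far point x is still far from y unless y itself is far from
  0, and the second moment of \<mu> makes such y improbable.\<close>

lemma profile_convol:
  assumes lc: "log_concave n \<mu>" and iso: "isotropic n \<mu>" and F: "profile n F"
  shows "profile n (convol \<mu> F)"
proof -
  have ps: "prob_space \<mu>" and sets: "sets \<mu> = sets (leb n)" using lc by (auto simp: log_concave_def)
  interpret prob_space \<mu> by fact
  have meas: "G \<in> borel_measurable \<mu>" if "continuous_on UNIV G" for G :: "(nat \<Rightarrow> real) \<Rightarrow> real"
    using borel_measurable_leb_continuous[OF that, of n] sets by (simp cong: measurable_cong_sets)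
  note Fc = profile_continuous[OF F] and F0 = profile_nonneg[OF F] and F1 = profile_le_1[OF F]
  note Fcong = profile_cong[OF F] and Flc = profile_midpoint[OF F]
  note mR = meas[OF continuous_on_diff_right[OF Fc]]
  have int: "integrable \<mu> (\<lambda>y. F (\<lambda>i. x i - y i))" for x
    by (rule integrable_const_bound[where B=1]) (use mR F0 F1 in auto)
  have convol0: "0 \<le> convol \<mu> F x" for x unfolding convol_def by (rule Bochner_Integration.integral_nonneg) (rule F0)
  have convol1: "convol \<mu> F x \<le> 1" for x
    using integral_mono[OF int, of "\<lambda>_. 1" x] F1 by (simp add: convol_def prob_space)
  have "continuous_on UNIV (convol \<mu> F)"
    unfolding continuous_on_sequentially
  proof (intro allI ballI impI)
    fix X and x :: "nat \<Rightarrow> real" assume "x \<in> UNIV" and X: "(\<forall>k. X k \<in> UNIV) \<and> X \<longlonglongrightarrow> x"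
    have "(\<lambda>k. \<integral>y. F (\<lambda>i. X k i - y i) \<partial>\<mu>) \<longlonglongrightarrow> (\<integral>y. F (\<lambda>i. x i - y i) \<partial>\<mu>)"
    proof (rule integral_dominated_convergence[where w="\<lambda>_. 1"])
      show "AE y in \<mu>. (\<lambda>k. F (\<lambda>i. X k i - y i)) \<longlonglongrightarrow> F (\<lambda>i. x i - y i)"
        using X by (intro AE_I2 continuous_on_tendsto_compose[OF continuous_on_diff_left[OF Fc]]) auto
    qed (use mR F0 F1 in auto)
    then show "(convol \<mu> F \<circ> X) \<longlonglongrightarrow> convol \<mu> F x" by (simp add: convol_def comp_def)
  qed
  moreover have "convol \<mu> F x = convol \<mu> F y" if "\<forall>i<n. x i = y i" for x y
    unfolding convol_def using that by (intro Bochner_Integration.integral_cong Fcong) auto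
  moreover have "\<exists>R. \<forall>x. R < nsq n x \<longrightarrow> convol \<mu> F x < s" if s: "0 < s" for s
  proof -
    obtain R where R: "\<And>x. R < nsq n x \<Longrightarrow> F x < s / 2" using profile_vanishes[OF F, of "s / 2"] s by auto
    \<comment> \<open>Chosen so that Markov's inequality with second moment n bounds the mass of
      {nsq y > R1} by n / R1 < s / 2; n + 1 in place of n keeps R1 positive when n = 0.\<close>
    define R1 where "R1 = 4 * (real n + 1) / s"
    have R1: "0 < R1" using s by (simp add: R1_def)
    have "convol \<mu> F x < s" if x: "2 * R + 2 * R1 < nsq n x" for x
    proof -
      have bound: "F (\<lambda>i. x i - y i) \<le> s / 2 + nsq n (\<lambda>i. 0 - y i) / R1" for y
      proof (cases "nsq n y \<le> R1")
        case True
        then have "R < nsq n (\<lambda>i. x i - y i)" using nsq_add_le[of n x y] x by linarith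
        then have "F (\<lambda>i. x i - y i) < s / 2" by (rule R)
        moreover have "0 \<le> nsq n (\<lambda>i. 0 - y i) / R1" using R1 nsq_nonneg by auto
        ultimately show ?thesis by linarith
      next
        case False
        then have "1 \<le> nsq n (\<lambda>i. 0 - y i) / R1" using R1 by (simp add: nsq_def field_simps)
        then show ?thesis using F1[of "\<lambda>i. x i - y i"] s by linarith
      qed
      have "convol \<mu> F x \<le> (\<integral>y. s / 2 + nsq n (\<lambda>i. 0 - y i) / R1 \<partial>\<mu>)"
        unfolding convol_def using isotropic_integral_nsq(1)[OF ps iso, of "\<lambda>_. 0"]
        by (intro integral_mono int bound) auto
      also have "\<dots> = s / 2 + n / R1"
        using isotropic_integral_nsq[OF ps iso, of "\<lambda>_. 0"] by (simp add: prob_space nsq_def)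
      also have "n / R1 < s / 2" using s by (simp add: R1_def field_simps) (simp add: add_pos_nonneg)
      finally show ?thesis by simp
    qed
    then show ?thesis by blast
  qed
  moreover have "sqrt (convol \<mu> F x * convol \<mu> F z) \<le> convol \<mu> F (\<lambda>i. (x i + z i) / 2)" for x z
  proof -
    have nn: "(\<integral>\<^sup>+y. ennreal (F (\<lambda>i. x i - y i)) \<partial>\<mu>) = ennreal (convol \<mu> F x)" for x
      unfolding convol_def using int F0 by (intro nn_integral_eq_integral) auto
    have "(\<integral>\<^sup>+y. ennreal (F (\<lambda>i. x i - y i)) \<partial>\<mu>) * (\<integral>\<^sup>+y. ennreal (F (\<lambda>i. z i - y i)) \<partial>\<mu>)
      \<le> (\<integral>\<^sup>+y. ennreal (F (\<lambda>i. (x i + z i) / 2 - y i)) \<partial>\<mu>)\<^sup>2"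
    proof (rule log_concave_prekopa_leindler[OF lc])
      fix y w :: "nat \<Rightarrow> real"
      have "(\<lambda>i. ((x i - y i) + (z i - w i)) / 2) = (\<lambda>i. (x i + z i) / 2 - (y i + w i) / 2)"
        by (auto simp: field_simps)
      then show "sqrt (F (\<lambda>i. x i - y i) * F (\<lambda>i. z i - w i)) \<le> F (\<lambda>i. (x i + z i) / 2 - (y i + w i) / 2)"
        using Flc[of "\<lambda>i. x i - y i" "\<lambda>i. z i - w i"] by simp
    qed (rule continuous_on_diff_right[OF Fc] F0 F1 compact_profile_level[OF F] | assumption)+
    then have "ennreal (convol \<mu> F x * convol \<mu> F z) \<le> ennreal ((convol \<mu> F (\<lambda>i. (x i + z i) / 2))\<^sup>2)"
      unfolding nn using convol0 by (simp add: ennreal_mult ennreal_power)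
    then have "convol \<mu> F x * convol \<mu> F z \<le> (convol \<mu> F (\<lambda>i. (x i + z i) / 2))\<^sup>2"
      by (simp add: ennreal_le_iff)
    then show ?thesis using convol0 by (intro real_le_lsqrt) auto
  qed
  ultimately show ?thesis unfolding profile_def using convol0 convol1 by blast
qed

lemma profile_gaussian:
  assumes m: "0 < m"
  shows "profile n (\<lambda>x. exp (- nsq n x / m))"
proof -
  have "continuous_on UNIV (\<lambda>x. exp (- nsq n x / m))"
    using m by (intro continuous_intros) auto
  moreover have "exp (- nsq n x / m) \<le> 1" for x
    using m nsq_nonneg[of n x] by simp
  moreover have "exp (- nsq n x / m) = exp (- nsq n y / m)" if "\<forall>i<n. x i = y i" for x y
    using that by (simp add: nsq_def)
  moreover have "\<exists>R. \<forall>x. R < nsq n x \<longrightarrow> exp (- nsq n x / m) < s" if s: "0 < s" for s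
  proof (intro exI allI impI)
    fix x assume "- m * ln s < nsq n x"
    then have "- nsq n x / m < ln s" using m by (simp add: field_simps)
    then have "exp (- nsq n x / m) < exp (ln s)" by simp
    then show "exp (- nsq n x / m) < s" using s by simp
  qed
  moreover have "sqrt (exp (- nsq n x / m) * exp (- nsq n y / m)) \<le> exp (- nsq n (\<lambda>i. (x i + y i) / 2) / m)" for x y
  proof -
    have "((x i + y i) / 2)\<^sup>2 \<le> (x i)\<^sup>2 / 2 + (y i)\<^sup>2 / 2" for i
    proof -
      have "0 \<le> (x i - y i)\<^sup>2" by simp
      then show ?thesis by (simp add: power2_eq_square field_simps)
    qed
    then have "nsq n (\<lambda>i. (x i + y i) / 2) \<le> nsq n x / 2 + nsq n y / 2"
      unfolding nsq_def sum_divide_distrib sum.distrib[symmetric] by (intro sum_mono)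
    then have "(nsq n (\<lambda>i. (x i + y i) / 2)) / m \<le> (nsq n x / 2 + nsq n y / 2) / m"
      using m by (intro divide_right_mono) auto
    then have "exp (- nsq n x / m / 2 + - nsq n y / m / 2) \<le> exp (- nsq n (\<lambda>i. (x i + y i) / 2) / m)"
      by (simp add: add_divide_distrib)
    moreover have "sqrt (exp (- nsq n x / m) * exp (- nsq n y / m)) = exp (- nsq n x / m / 2 + - nsq n y / m / 2)"
      by (rule real_sqrt_unique) (simp_all add: power2_eq_square exp_add[symmetric])
    ultimately show ?thesis by simp
  qed
  ultimately show ?thesis unfolding profile_def by auto
qed

text \<open>The congruence assumption identifies the values of G at the pointwise difference, which
  may leave \<open>Rn n\<close>, and at its restriction.\<close>

lemma nn_integral_leb_translate:
  assumes G: "G \<in> borel_measurable (leb n)" and cong: "\<And>x z. (\<And>i. i < n \<Longrightarrow> x i = z i) \<Longrightarrow> G x = G z"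
  shows "(\<integral>\<^sup>+x. G (\<lambda>i. x i - y i) \<partial>leb n) = (\<integral>\<^sup>+x. G x \<partial>leb n)"
proof -
  have "(\<integral>\<^sup>+x. G x \<partial>leb n) = (\<integral>\<^sup>+x. G (\<lambda>i\<in>{..<n}. - y i + 1 * x i) \<partial>leb n)"
    by (subst nn_integral_leb_affine[OF G, of 1 "\<lambda>i. - y i"]) auto
  also have "\<dots> = (\<integral>\<^sup>+x. G (\<lambda>i. x i - y i) \<partial>leb n)"
    by (intro nn_integral_cong cong) auto
  finally show ?thesis by simp
qed

lemma measurable_diff_pair:
  assumes sets: "sets \<mu> = sets (leb n)"
  shows "(\<lambda>(x, y). (\<lambda>i. x i - y i) :: nat \<Rightarrow> real) \<in> borel_measurable (leb n \<Otimes>\<^sub>M \<mu>)"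
proof -
  have c: "(\<lambda>y. y i) \<in> borel_measurable \<mu>" for i :: nat
    using measurable_component_leb[of i n] sets by (simp cong: measurable_cong_sets)
  have "(\<lambda>p. fst p i - snd p i) \<in> borel_measurable (leb n \<Otimes>\<^sub>M \<mu>)" for i :: nat
    using measurable_compose[OF measurable_fst measurable_component_leb, of i n \<mu>]
      measurable_compose[OF measurable_snd c, of i "leb n"] by (intro borel_measurable_diff)
  then have "(\<lambda>p. (\<lambda>i. fst p i - snd p i)) \<in> borel_measurable (leb n \<Otimes>\<^sub>M \<mu>)"
    by (rule measurable_coordinatewise_then_product)
  then show ?thesis by (simp add: case_prod_beta')
qed

lemma nn_integral_convol:
  assumes lc: "log_concave n \<mu>" and F: "profile n F"
  shows "ennreal (convol \<mu> F x) = (\<integral>\<^sup>+y. ennreal (F (\<lambda>i. x i - y i)) \<partial>\<mu>)"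
proof -
  have ps: "prob_space \<mu>" and sets: "sets \<mu> = sets (leb n)" using lc by (auto simp: log_concave_def)
  interpret prob_space \<mu> by fact
  note Fc = profile_continuous[OF F] and F0 = profile_nonneg[OF F] and F1 = profile_le_1[OF F]
  have m: "(\<lambda>y. F (\<lambda>i. x i - y i)) \<in> borel_measurable \<mu>"
    using borel_measurable_leb_continuous[OF continuous_on_diff_right[OF Fc], where n=n] sets
    by (simp cong: measurable_cong_sets)
  have "integrable \<mu> (\<lambda>y. F (\<lambda>i. x i - y i))"
    by (rule integrable_const_bound[where B=1]) (use m F0 F1 in auto)
  then show ?thesis
    unfolding convol_def using F0 by (intro nn_integral_eq_integral[symmetric]) auto
qed

lemma convol_Fubini:
  assumes lc: "log_concave n \<mu>" and F: "profile n F" and J: "J \<in> borel_measurable (leb n)"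
  shows "(\<integral>\<^sup>+x. ennreal (convol \<mu> F x) * J x \<partial>leb n) = (\<integral>\<^sup>+y. (\<integral>\<^sup>+x. ennreal (F (\<lambda>i. x i - y i)) * J x \<partial>leb n) \<partial>\<mu>)"
proof -
  have ps: "prob_space \<mu>" and sets: "sets \<mu> = sets (leb n)" using lc by (auto simp: log_concave_def)
  interpret prob_space \<mu> by fact
  interpret L: sigma_finite_measure "leb n" by (rule sigma_finite_leb)
  interpret P: pair_sigma_finite "leb n" \<mu> ..
  have "F \<in> borel_measurable borel" by (intro borel_measurable_continuous_onI profile_continuous[OF F])
  then have "(\<lambda>p. F ((\<lambda>(x, y). (\<lambda>i. x i - y i)) p)) \<in> borel_measurable (leb n \<Otimes>\<^sub>M \<mu>)"
    by (rule measurable_compose[OF measurable_diff_pair[OF sets]])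
  then have m: "(\<lambda>(x, y). ennreal (F (\<lambda>i. x i - y i)) * J x) \<in> borel_measurable (leb n \<Otimes>\<^sub>M \<mu>)"
    using J by (simp add: case_prod_beta') measurable
  have "(\<integral>\<^sup>+x. ennreal (convol \<mu> F x) * J x \<partial>leb n) = (\<integral>\<^sup>+x. (\<integral>\<^sup>+y. ennreal (F (\<lambda>i. x i - y i)) * J x \<partial>\<mu>) \<partial>leb n)"
  proof (intro nn_integral_cong)
    fix x
    have "(\<lambda>y. F (\<lambda>i. x i - y i)) \<in> borel_measurable \<mu>"
      using borel_measurable_leb_continuous[OF continuous_on_diff_right[OF profile_continuous[OF F]], where n=n] sets
      by (simp cong: measurable_cong_sets)
    then show "ennreal (convol \<mu> F x) * J x = (\<integral>\<^sup>+y. ennreal (F (\<lambda>i. x i - y i)) * J x \<partial>\<mu>)"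
      by (simp add: nn_integral_convol[OF lc F] nn_integral_multc)
  qed
  also have "\<dots> = (\<integral>\<^sup>+y. (\<integral>\<^sup>+x. ennreal (F (\<lambda>i. x i - y i)) * J x \<partial>leb n) \<partial>\<mu>)"
    using P.Fubini'[OF m] by simp
  finally show ?thesis .
qed

lemma profile_measurable: "profile n F \<Longrightarrow> (\<lambda>x. ennreal (F x)) \<in> borel_measurable (leb n)"
  using borel_measurable_leb_continuous[OF profile_continuous] by auto

lemma nn_integral_leb_convol:
  assumes lc: "log_concave n \<mu>" and F: "profile n F"
  shows "(\<integral>\<^sup>+x. ennreal (convol \<mu> F x) \<partial>leb n) = (\<integral>\<^sup>+x. ennreal (F x) \<partial>leb n)"
proof -
  have ps: "prob_space \<mu>" using lc by (auto simp: log_concave_def)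
  interpret prob_space \<mu> by fact
  have "(\<integral>\<^sup>+x. ennreal (F (\<lambda>i. x i - y i)) \<partial>leb n) = (\<integral>\<^sup>+x. ennreal (F x) \<partial>leb n)" for y
    by (rule nn_integral_leb_translate[OF profile_measurable[OF F]])
       (auto intro!: arg_cong[where f=ennreal] profile_cong[OF F])
  then show ?thesis using convol_Fubini[OF lc F, of "\<lambda>_. 1"] by (simp add: emeasure_space_1)
qed

lemma halfspace_sets: "{x \<in> Rn n. b \<le> ip n \<xi> x} \<in> sets (leb n)"
proof (rule closed_in_sets_leb)
  have "closed {x. b \<le> ip n \<xi> x}" by (intro closed_Collect_le continuous_intros)
  then show "closed {x \<in> Rn n. b \<le> ip n \<xi> x}" by (rule closed_Rn_Collect)
qed auto

text \<open>This is the behaviour of halfspace depth under sums: a point of the halfspace at height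
  a plus one of the halfspace at height b lies in the halfspace at height a + b. Fubini and
  translation invariance turn this into the product of the two masses.\<close>

lemma nn_integral_halfspace_convol:
  assumes lc: "log_concave n \<mu>" and F: "profile n F"
  shows "emeasure \<mu> {y \<in> Rn n. a \<le> ip n \<xi> y} * (\<integral>\<^sup>+x. ennreal (F x) * indicator {x. b \<le> ip n \<xi> x} x \<partial>leb n)
    \<le> (\<integral>\<^sup>+x. ennreal (convol \<mu> F x) * indicator {x. a + b \<le> ip n \<xi> x} x \<partial>leb n)"
proof -
  have ps: "prob_space \<mu>" and sets: "sets \<mu> = sets (leb n)" using lc by (auto simp: log_concave_def)
  interpret prob_space \<mu> by fact
  let ?I = "\<integral>\<^sup>+x. ennreal (F x) * indicator {x. b \<le> ip n \<xi> x} x \<partial>leb n"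
  let ?H = "{y \<in> Rn n. a \<le> ip n \<xi> y}"
  have ind: "(indicator {x. b \<le> ip n \<xi> x} :: _ \<Rightarrow> ennreal) \<in> borel_measurable (leb n)" for b
  proof (rule measurable_compose[OF measurable_id_leb])
    have "closed {x. b \<le> ip n \<xi> x}" by (intro closed_Collect_le continuous_intros)
    then show "(indicator {x. b \<le> ip n \<xi> x} :: _ \<Rightarrow> ennreal) \<in> borel_measurable borel" by auto
  qed
  have ipd: "ip n \<xi> (\<lambda>i. x i - y i) = ip n \<xi> x - ip n \<xi> y" for x y
    by (simp add: ip_def right_diff_distrib sum_subtractf)
  have "emeasure \<mu> ?H * ?I = (\<integral>\<^sup>+y. ?I * indicator ?H y \<partial>\<mu>)"
    using halfspace_sets[of n a \<xi>] sets by (subst nn_integral_cmult_indicator) (auto simp: mult.commute)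
  also have "\<dots> \<le> (\<integral>\<^sup>+y. (\<integral>\<^sup>+x. ennreal (F (\<lambda>i. x i - y i)) * indicator {x. a + b \<le> ip n \<xi> x} x \<partial>leb n) \<partial>\<mu>)"
  proof (intro nn_integral_mono)
    fix y
    show "?I * indicator ?H y \<le> (\<integral>\<^sup>+x. ennreal (F (\<lambda>i. x i - y i)) * indicator {x. a + b \<le> ip n \<xi> x} x \<partial>leb n)"
    proof (cases "y \<in> ?H")
      case True
      have "?I = (\<integral>\<^sup>+x. ennreal (F (\<lambda>i. x i - y i)) * indicator {x. b \<le> ip n \<xi> x} (\<lambda>i. x i - y i) \<partial>leb n)"
      proof (rule nn_integral_leb_translate[symmetric])
        show "(\<lambda>x. ennreal (F x) * indicator {x. b \<le> ip n \<xi> x} x) \<in> borel_measurable (leb n)"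
          using profile_measurable[OF F] ind by (intro borel_measurable_times_ennreal) auto
        fix x z :: "nat \<Rightarrow> real" assume xz: "\<And>i. i < n \<Longrightarrow> x i = z i"
        have "F x = F z" using xz by (rule profile_cong[OF F])
        moreover have "ip n \<xi> x = ip n \<xi> z" using xz by (simp add: ip_def)
        ultimately show "ennreal (F x) * indicator {x. b \<le> ip n \<xi> x} x = ennreal (F z) * indicator {x. b \<le> ip n \<xi> x} z"
          by (simp add: indicator_def)
      qed
      also have "\<dots> \<le> (\<integral>\<^sup>+x. ennreal (F (\<lambda>i. x i - y i)) * indicator {x. a + b \<le> ip n \<xi> x} x \<partial>leb n)"
        using True by (intro nn_integral_mono mult_left_mono) (auto simp: indicator_def ipd)
      finally show ?thesis using True by simp
    qed simp
  qed
  also have "\<dots> = (\<integral>\<^sup>+x. ennreal (convol \<mu> F x) * indicator {x. a + b \<le> ip n \<xi> x} x \<partial>leb n)"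
    by (rule convol_Fubini[OF lc F ind, symmetric])
  finally show ?thesis .
qed

section \<open>Points cut off by halfspaces of small measure\<close>

lemma ip_diff: "ip n \<xi> (\<lambda>i. x i - y i) = ip n \<xi> x - ip n \<xi> y"
  by (simp add: ip_def right_diff_distrib sum_subtractf)

lemma nsq_diff_scale: "nsq n (\<lambda>i. a i - c * u i) = nsq n a - 2 * c * ip n a u + c\<^sup>2 * nsq n u"
  unfolding nsq_def ip_def sum_distrib_left sum_subtractf[symmetric] sum.distrib[symmetric]
  by (intro sum.cong) (simp_all add: power2_eq_square algebra_simps)

text \<open>Only closedness under midpoints is required: the usual variational inequality at the
  nearest point is tested at dyadic points of the segment.\<close>

lemma separate_point_compact:
  assumes C: "compact C" "C \<subseteq> Rn n"
    and mid: "\<And>x y. x \<in> C \<Longrightarrow> y \<in> C \<Longrightarrow> (\<lambda>i. (x i + y i) / 2) \<in> C"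
    and p: "p \<in> Rn n" "p \<notin> C"
  obtains \<xi> where "\<And>z. z \<in> C \<Longrightarrow> ip n \<xi> z < ip n \<xi> p"
proof (cases "C = {}")
  case True
  then show ?thesis using that by blast
next
  case False
  have "continuous_on C (\<lambda>z. nsq n (\<lambda>i. p i - z i))"
    by (intro continuous_on_nsq continuous_on_coordinatewise_then_product continuous_on_diff
        continuous_on_const continuous_on_subset[OF continuous_on_product_coordinates subset_UNIV])
  then obtain z0 where z0: "z0 \<in> C" and min: "\<And>z. z \<in> C \<Longrightarrow> nsq n (\<lambda>i. p i - z0 i) \<le> nsq n (\<lambda>i. p i - z i)"
    using continuous_attains_inf[OF C(1) False] by blast
  define \<xi> where "\<xi> = (\<lambda>i. p i - z0 i)"
  have pos: "0 < nsq n \<xi>"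
  proof (rule ccontr)
    assume "\<not> 0 < nsq n \<xi>"
    then have "nsq n \<xi> = 0" using nsq_nonneg[of n \<xi>] by simp
    then have "\<forall>i<n. p i = z0 i" by (simp add: nsq_def \<xi>_def sum_nonneg_eq_0_iff)
    then have "p = z0" using p z0 C(2) by (intro PiE_ext[of p "{..<n}" _ z0]) auto
    then show False using p z0 by simp
  qed
  have "ip n \<xi> z \<le> ip n \<xi> z0" if z: "z \<in> C" for z
  proof -
    let ?u = "\<lambda>i. z i - z0 i"
    have dyadic: "(\<lambda>i. z0 i + ?u i / 2 ^ k) \<in> C" for k
    proof (induction k)
      case 0
      then show ?case using z by simp
    next
      case (Suc k)
      have "(\<lambda>i. (z0 i + (z0 i + ?u i / 2 ^ k)) / 2) = (\<lambda>i. z0 i + ?u i / 2 ^ Suc k)"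
        by (auto simp: field_simps)
      then show ?case using mid[OF z0 Suc] by simp
    qed
    have ineq: "2 * ip n \<xi> ?u \<le> nsq n ?u / 2 ^ k" for k :: nat
    proof -
      have "nsq n \<xi> \<le> nsq n (\<lambda>i. p i - (z0 i + ?u i / 2 ^ k))"
        using min[OF dyadic[of k]] by (simp add: \<xi>_def)
      also have "\<dots> = nsq n (\<lambda>i. \<xi> i - (1 / 2 ^ k) * ?u i)"
        unfolding \<xi>_def by (intro arg_cong[where f="nsq n"]) auto
      also have "\<dots> = nsq n \<xi> - 2 * (1 / 2 ^ k) * ip n \<xi> ?u + (1 / 2 ^ k)\<^sup>2 * nsq n ?u"
        by (rule nsq_diff_scale)
      finally have "(1 / 2 ^ k) * (2 * ip n \<xi> ?u) \<le> (1 / 2 ^ k) * (nsq n ?u / 2 ^ k)"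
        by (simp add: power2_eq_square)
      then show ?thesis by (subst (asm) mult_le_cancel_left_pos) auto
    qed
    have "(\<lambda>k. nsq n ?u * (1 / 2) ^ k) \<longlonglongrightarrow> nsq n ?u * 0"
      by (intro tendsto_intros LIMSEQ_realpow_zero) auto
    then have "2 * ip n \<xi> ?u \<le> nsq n ?u * 0"
      by (rule LIMSEQ_le_const) (use ineq in \<open>auto simp: power_one_over field_simps\<close>)
    then show ?thesis by (simp add: ip_diff)
  qed
  moreover have "ip n \<xi> p - ip n \<xi> z0 = nsq n \<xi>"
    unfolding ip_diff[symmetric] by (simp add: ip_def nsq_def \<xi>_def power2_eq_square)
  ultimately have "ip n \<xi> z < ip n \<xi> p" if "z \<in> C" for z using that pos by (smt (verit))
  then show ?thesis by (rule that)
qed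

section \<open>Gaussian smoothings of convolution powers\<close>

text \<open>The width m is kept apart from the number j of convolutions so that induction on j runs
  at fixed width; the function F of the introduction is the case j = m.\<close>

definition gauss_conv :: "nat \<Rightarrow> (nat \<Rightarrow> real) measure \<Rightarrow> real \<Rightarrow> nat \<Rightarrow> (nat \<Rightarrow> real) \<Rightarrow> real" where
  "gauss_conv n \<mu> m j = (convol \<mu> ^^ j) (\<lambda>x. exp (- nsq n x / m))"

lemma gauss_conv_Suc: "gauss_conv n \<mu> m (Suc j) = convol \<mu> (gauss_conv n \<mu> m j)"
  by (simp add: gauss_conv_def)

lemma profile_gauss_conv:
  assumes "log_concave n \<mu>" "isotropic n \<mu>" "0 < m"
  shows "profile n (gauss_conv n \<mu> m j)"
proof (induction j)
  case 0
  then show ?case using profile_gaussian[OF assms(3)] by (simp add: gauss_conv_def)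
next
  case (Suc j)
  then show ?case unfolding gauss_conv_Suc by (rule profile_convol[OF assms(1,2)])
qed

lemma nn_integral_gauss_conv:
  assumes "log_concave n \<mu>" "isotropic n \<mu>" "0 < m"
  shows "(\<integral>\<^sup>+x. ennreal (gauss_conv n \<mu> m j x) \<partial>leb n) = ennreal (sqrt (pi * m) ^ n)"
proof (induction j)
  case 0
  then show ?case using nn_integral_gaussian_leb[OF assms(3)] by (simp add: gauss_conv_def)
next
  case (Suc j)
  then show ?case using nn_integral_leb_convol[OF assms(1) profile_gauss_conv[OF assms]] by (simp add: gauss_conv_Suc)
qed

text \<open>By isotropy the mean of nsq (x - y) over y is nsq x + n, so Jensen's inequality loses
  one factor exp (- n / m) per convolution. At x = 0 and j = m the bound is exp (- n).\<close>

lemma gauss_conv_ge: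
  assumes lc: "log_concave n \<mu>" and iso: "isotropic n \<mu>" and m: "0 < m"
  shows "exp (- (nsq n x + real j * real n) / m) \<le> gauss_conv n \<mu> m j x"
proof (induction j arbitrary: x)
  case 0
  then show ?case by (simp add: gauss_conv_def)
next
  case (Suc j)
  have ps: "prob_space \<mu>" and sets: "sets \<mu> = sets (leb n)" using lc by (auto simp: log_concave_def)
  interpret prob_space \<mu> by fact
  have meas: "G \<in> borel_measurable \<mu>" if "continuous_on UNIV G" for G :: "(nat \<Rightarrow> real) \<Rightarrow> real"
    using borel_measurable_leb_continuous[OF that, of n] sets by (simp cong: measurable_cong_sets)
  note F = profile_gauss_conv[OF assms, of j]
  let ?Z = "\<lambda>y. (nsq n (\<lambda>i. x i - y i) + real j * real n) / m"
  have iZ: "integrable \<mu> ?Z"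
    using isotropic_integral_nsq(1)[OF ps iso, of x] by auto
  have eZ: "expectation ?Z = (nsq n x + real (Suc j) * real n) / m"
    using isotropic_integral_nsq[OF ps iso, of x] by (simp add: prob_space algebra_simps)
  have iE: "integrable \<mu> (\<lambda>y. exp (- ?Z y))"
    using iZ m nsq_nonneg by (intro integrable_const_bound[where B=1]) auto
  have "exp (- expectation ?Z) \<le> expectation (\<lambda>y. exp (- ?Z y))"
    by (rule exp_neg_expectation_le[OF iZ iE])
  also have "\<dots> \<le> expectation (\<lambda>y. gauss_conv n \<mu> m j (\<lambda>i. x i - y i))"
  proof (rule integral_mono[OF iE])
    show "integrable \<mu> (\<lambda>y. gauss_conv n \<mu> m j (\<lambda>i. x i - y i))"
      using meas[OF continuous_on_diff_right[OF profile_continuous[OF F]], of x] profile_nonneg[OF F] profile_le_1[OF F]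
      by (intro integrable_const_bound[where B=1]) auto
    show "exp (- ?Z y) \<le> gauss_conv n \<mu> m j (\<lambda>i. x i - y i)" for y
      using Suc[of "\<lambda>i. x i - y i"] by (simp add: minus_divide_left)
  qed
  finally show ?case unfolding eZ gauss_conv_Suc convol_def by (simp add: minus_divide_left)
qed

text \<open>The reflection x \<mapsto> - x exchanges the two closed halfspaces bounded by a
  hyperplane through 0, and together they cover the space.\<close>

lemma nn_integral_gaussian_halfspace:
  assumes m: "0 < m"
  shows "ennreal (sqrt (pi * m) ^ n) \<le> 2 * (\<integral>\<^sup>+x. ennreal (exp (- nsq n x / m)) * indicator {x. 0 \<le> ip n \<xi> x} x \<partial>leb n)"
proof -
  let ?g = "\<lambda>x. ennreal (exp (- nsq n x / m)) * indicator {x. 0 \<le> ip n \<xi> x} x"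
  let ?h = "\<lambda>x. ennreal (exp (- nsq n x / m)) * indicator {x. ip n \<xi> x \<le> 0} x"
  have c: "closed {x. 0 \<le> ip n \<xi> x}" "closed {x. ip n \<xi> x \<le> 0}"
    by (intro closed_Collect_le continuous_intros)+
  have mg: "?g \<in> borel_measurable (leb n)" "?h \<in> borel_measurable (leb n)"
  proof -
    have "(indicator S :: _ \<Rightarrow> ennreal) \<in> borel_measurable (leb n)" if "closed S" for S :: "(nat \<Rightarrow> real) set"
      by (rule measurable_compose[OF measurable_id_leb]) (use that in auto)
    then show "?g \<in> borel_measurable (leb n)" "?h \<in> borel_measurable (leb n)"
      using c profile_measurable[OF profile_gaussian[OF m]] by (auto intro!: borel_measurable_times_ennreal)
  qed
  have "(\<integral>\<^sup>+x. ?h x \<partial>leb n) = (\<integral>\<^sup>+x. ?h (\<lambda>i\<in>{..<n}. 0 + (-1) * x i) \<partial>leb n)"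
    by (subst nn_integral_leb_affine[OF mg(2), of "-1" "\<lambda>_. 0"]) auto
  also have "\<dots> = (\<integral>\<^sup>+x. ?g x \<partial>leb n)"
    by (intro nn_integral_cong) (auto simp: nsq_def ip_def indicator_def sum_negf)
  finally have eq: "(\<integral>\<^sup>+x. ?h x \<partial>leb n) = (\<integral>\<^sup>+x. ?g x \<partial>leb n)" .
  have "ennreal (sqrt (pi * m) ^ n) = (\<integral>\<^sup>+x. ennreal (exp (- nsq n x / m)) \<partial>leb n)"
    by (rule nn_integral_gaussian_leb[OF m, symmetric])
  also have "\<dots> \<le> (\<integral>\<^sup>+x. ?g x + ?h x \<partial>leb n)"
    by (intro nn_integral_mono) (auto simp: indicator_def)
  also have "\<dots> = (\<integral>\<^sup>+x. ?g x \<partial>leb n) + (\<integral>\<^sup>+x. ?h x \<partial>leb n)"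
    by (rule nn_integral_add[OF mg])
  finally show ?thesis unfolding eq by (simp add: mult_2)
qed

text \<open>Each convolution raises the threshold by a and contributes one factor of \<mu>-mass; the
  factor 2 stems from the Gaussian at the start, half of which lies beyond threshold 0.\<close>

lemma nn_integral_halfspace_gauss_conv:
  assumes lc: "log_concave n \<mu>" and iso: "isotropic n \<mu>" and m: "0 < m"
  shows "emeasure \<mu> {y \<in> Rn n. a \<le> ip n \<xi> y} ^ j * ennreal (sqrt (pi * m) ^ n)
    \<le> 2 * (\<integral>\<^sup>+x. ennreal (gauss_conv n \<mu> m j x) * indicator {x. real j * a \<le> ip n \<xi> x} x \<partial>leb n)"
proof (induction j)
  case 0
  then show ?case using nn_integral_gaussian_halfspace[OF m] by (simp add: gauss_conv_def)
next
  case (Suc j)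
  let ?p = "emeasure \<mu> {y \<in> Rn n. a \<le> ip n \<xi> y}"
  let ?I = "\<lambda>j. \<integral>\<^sup>+x. ennreal (gauss_conv n \<mu> m j x) * indicator {x. real j * a \<le> ip n \<xi> x} x \<partial>leb n"
  have "?p ^ Suc j * ennreal (sqrt (pi * m) ^ n) \<le> ?p * (2 * ?I j)"
    using mult_left_mono[OF Suc, of ?p] by (simp add: mult_ac)
  also have "\<dots> = 2 * (?p * ?I j)" by (simp add: mult_ac)
  also have "\<dots> \<le> 2 * ?I (Suc j)"
    using nn_integral_halfspace_convol[OF lc profile_gauss_conv[OF assms, of j], where a=a and b="real j * a"]
    by (intro mult_left_mono) (auto simp: gauss_conv_Suc algebra_simps)
  finally show ?case .
qed

text \<open>Log-concavity between x and 0 gives F x * F 0 \<le> F (x / 2)^2. Where F x \<le> q this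
  yields sqrt (F 0) * F x \<le> sqrt q * F (x / 2), and the integral of F (x / 2) is 2^n times that
  of F.\<close>

lemma nn_integral_low_level:
  assumes F: "profile n F" and q: "0 \<le> q" and A: "A \<in> sets (leb n)" and Fq: "\<And>x. x \<in> A \<Longrightarrow> F x \<le> q"
  shows "ennreal (sqrt (F (\<lambda>_. 0))) * (\<integral>\<^sup>+x. ennreal (F x) * indicator A x \<partial>leb n)
    \<le> ennreal (sqrt q * 2 ^ n) * (\<integral>\<^sup>+x. ennreal (F x) \<partial>leb n)"
proof -
  note F0 = profile_nonneg[OF F]
  note mF = profile_measurable[OF F]
  have mA: "(\<lambda>x. ennreal (F x) * indicator A x) \<in> borel_measurable (leb n)"
    using mF A by measurable
  have half: "(\<lambda>x. ennreal (F (\<lambda>i\<in>{..<n}. 0 + (1/2) * x i))) \<in> borel_measurable (leb n)"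
    by (rule measurable_compose[OF _ mF]) (intro measurable_restrict, measurable)
  have "ennreal (sqrt (F (\<lambda>_. 0))) * (\<integral>\<^sup>+x. ennreal (F x) * indicator A x \<partial>leb n)
     = (\<integral>\<^sup>+x. ennreal (sqrt (F (\<lambda>_. 0))) * (ennreal (F x) * indicator A x) \<partial>leb n)"
    by (rule nn_integral_cmult[OF mA, symmetric])
  also have "\<dots> \<le> (\<integral>\<^sup>+x. ennreal (sqrt q) * ennreal (F (\<lambda>i\<in>{..<n}. 0 + (1/2) * x i)) \<partial>leb n)"
  proof (intro nn_integral_mono)
    fix x
    show "ennreal (sqrt (F (\<lambda>_. 0))) * (ennreal (F x) * indicator A x) \<le> ennreal (sqrt q) * ennreal (F (\<lambda>i\<in>{..<n}. 0 + (1/2) * x i))"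
    proof (cases "x \<in> A")
      case True
      have "sqrt (F (\<lambda>_. 0)) * F x = sqrt (F x) * sqrt (F x * F (\<lambda>_. 0))"
        using F0 by (simp add: real_sqrt_mult)
      also have "\<dots> \<le> sqrt q * F (\<lambda>i. (x i + 0) / 2)"
        using Fq[OF True] profile_midpoint[OF F, of x "\<lambda>_. 0"] F0 q by (intro mult_mono) auto
      also have "F (\<lambda>i. (x i + 0) / 2) = F (\<lambda>i\<in>{..<n}. 0 + (1/2) * x i)"
        by (rule profile_cong[OF F]) auto
      finally show ?thesis using True F0 q by (simp add: ennreal_mult'[symmetric] ennreal_leI)
    qed simp
  qed
  also have "\<dots> = ennreal (sqrt q) * (\<integral>\<^sup>+x. ennreal (F (\<lambda>i\<in>{..<n}. 0 + (1/2) * x i)) \<partial>leb n)"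
    by (rule nn_integral_cmult[OF half])
  also have "(\<integral>\<^sup>+x. ennreal (F (\<lambda>i\<in>{..<n}. 0 + (1/2) * x i)) \<partial>leb n) = ennreal (2 ^ n) * (\<integral>\<^sup>+x. ennreal (F x) \<partial>leb n)"
  proof -
    have "ennreal (2 ^ n) * ennreal (\<bar>1/2\<bar> ^ n) = 1"
      by (simp add: ennreal_mult'[symmetric] power_mult_distrib[symmetric])
    then show ?thesis
      by (subst nn_integral_leb_affine[OF mF, of "1/2" "\<lambda>_. 0"]) (simp_all only: mult.assoc[symmetric], simp_all)
  qed
  finally show ?thesis using q by (simp add: ennreal_mult' mult.assoc)
qed

text \<open>The set R / m of the introduction.\<close>

definition core :: "nat \<Rightarrow> (nat \<Rightarrow> real) measure \<Rightarrow> nat \<Rightarrow> (nat \<Rightarrow> real) set" where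
  "core n \<mu> m = {x \<in> Rn n. exp (- 9 * real n) \<le> gauss_conv n \<mu> (real m) m (\<lambda>i. real m * x i)}"

lemma core_sets:
  assumes "log_concave n \<mu>" "isotropic n \<mu>" "0 < m"
  shows "core n \<mu> m \<in> sets (leb n)"
proof -
  have F: "profile n (gauss_conv n \<mu> (real m) m)" using assms by (intro profile_gauss_conv) auto
  have "continuous_on UNIV (\<lambda>x. gauss_conv n \<mu> (real m) m (\<lambda>i. real m * x i))"
    by (rule continuous_on_compose2[OF profile_continuous[OF F]])
       (auto intro!: continuous_on_coordinatewise_then_product continuous_on_mult continuous_on_const continuous_on_product_coordinates)
  then have "closed {x. exp (- 9 * real n) \<le> gauss_conv n \<mu> (real m) m (\<lambda>i. real m * x i)}"
    by (rule closed_Collect_le[OF continuous_on_const])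
  then have "closed (core n \<mu> m)" unfolding core_def by (rule closed_Rn_Collect)
  then show ?thesis by (rule closed_in_sets_leb) (auto simp: core_def)
qed

text \<open>Markov's inequality at level exp (- 9 n). The dilation by m divides the integral (\<pi>
  m)^(n/2) by m^n, which leaves (\<pi> / m)^(n/2).\<close>

lemma emeasure_core:
  assumes lc: "log_concave n \<mu>" and iso: "isotropic n \<mu>" and m: "0 < m"
  shows "emeasure (leb n) (core n \<mu> m) \<le> ennreal ((exp 9 * sqrt (pi / real m)) ^ n)"
proof -
  have m': "0 < real m" using m by simp
  let ?F = "gauss_conv n \<mu> (real m) m"
  have F: "profile n ?F" using profile_gauss_conv[OF lc iso m'] .
  have e1: "ennreal (real m ^ n) * (\<integral>\<^sup>+x. ennreal (?F (\<lambda>i\<in>{..<n}. 0 + real m * x i)) \<partial>leb n) = ennreal (sqrt (pi * real m) ^ n)"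
    using nn_integral_leb_affine[OF profile_measurable[OF F], of "real m" "\<lambda>_. 0"] m' nn_integral_gauss_conv[OF lc iso m', of m] by simp
  have i1: "ennreal (exp (- 9 * real n)) * emeasure (leb n) (core n \<mu> m) \<le> (\<integral>\<^sup>+x. ennreal (?F (\<lambda>i\<in>{..<n}. 0 + real m * x i)) \<partial>leb n)"
  proof -
    have "ennreal (exp (- 9 * real n)) * emeasure (leb n) (core n \<mu> m) = (\<integral>\<^sup>+x. ennreal (exp (- 9 * real n)) * indicator (core n \<mu> m) x \<partial>leb n)"
      using core_sets[OF assms] by (simp add: nn_integral_cmult_indicator)
    also have "\<dots> \<le> (\<integral>\<^sup>+x. ennreal (?F (\<lambda>i\<in>{..<n}. 0 + real m * x i)) \<partial>leb n)"
    proof (intro nn_integral_mono)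
      fix x
      have "?F (\<lambda>i\<in>{..<n}. 0 + real m * x i) = ?F (\<lambda>i. real m * x i)"
        by (rule profile_cong[OF F]) auto
      then show "ennreal (exp (- 9 * real n)) * indicator (core n \<mu> m) x \<le> ennreal (?F (\<lambda>i\<in>{..<n}. 0 + real m * x i))"
        by (auto simp: core_def indicator_def ennreal_leI)
    qed
    finally show ?thesis .
  qed
  have le: "ennreal (real m ^ n) * (ennreal (exp (- 9 * real n)) * emeasure (leb n) (core n \<mu> m)) \<le> ennreal (sqrt (pi * real m) ^ n)"
    using mult_left_mono[OF i1, of "ennreal (real m ^ n)"] unfolding e1 by simp
  have e: "exp (9 * real n) = exp 9 ^ n" by (simp add: exp_of_nat_mult mult.commute)
  define c where "c = exp (9 * real n) / real m ^ n"
  have c0: "0 \<le> c" by (simp add: c_def)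
  have "ennreal c * (ennreal (real m ^ n) * (ennreal (exp (- 9 * real n)) * emeasure (leb n) (core n \<mu> m)))
     = ennreal (c * real m ^ n * exp (- 9 * real n)) * emeasure (leb n) (core n \<mu> m)"
    using c0 by (simp add: ennreal_mult' mult.assoc)
  also have "c * real m ^ n * exp (- 9 * real n) = 1"
    using m by (simp add: c_def exp_minus field_simps)
  finally have "emeasure (leb n) (core n \<mu> m) \<le> ennreal c * ennreal (sqrt (pi * real m) ^ n)"
    using mult_left_mono[OF le, of "ennreal c"] by simp
  also have "\<dots> = ennreal (c * sqrt (pi * real m) ^ n)" using c0 by (simp add: ennreal_mult')
  also have "c * sqrt (pi * real m) ^ n = (exp 9 * sqrt (pi / real m)) ^ n"
  proof -
    have "sqrt (pi * real m) / real m = sqrt (pi / real m)"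
      using m by (simp add: real_sqrt_mult real_sqrt_divide real_div_sqrt field_simps)
    moreover have "c * sqrt (pi * real m) ^ n = (exp 9 * (sqrt (pi * real m) / real m)) ^ n"
      unfolding c_def e by (simp only: power_mult_distrib power_divide times_divide_eq_left times_divide_eq_right)
    ultimately show ?thesis by (simp only:)
  qed
  finally show ?thesis .
qed

text \<open>The direction \<xi> separates m x from the convex superlevel set R, so F is at most q on
  the halfspace through m x. The integral of F over it is bounded below by the m-th power of the
  \<mu>-mass P in question and above by the low-level estimate.\<close>

lemma halfspace_outside_core:
  assumes lc: "log_concave n \<mu>" and iso: "isotropic n \<mu>" and m: "0 < m" and n: "0 < n"
    and x: "x \<in> Rn n" "x \<notin> core n \<mu> m"
  obtains \<xi> where "measure \<mu> {y \<in> Rn n. ip n \<xi> x \<le> ip n \<xi> y} \<le> exp (- real n / real m)"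
proof -
  have m': "0 < real m" using m by simp
  have ps: "prob_space \<mu>" using lc by (auto simp: log_concave_def)
  interpret prob_space \<mu> by fact
  let ?F = "gauss_conv n \<mu> (real m) m"
  have F: "profile n ?F" using profile_gauss_conv[OF lc iso m'] .
  \<comment> \<open>Since sqrt (F 0) \<ge> exp (- n / 2), the two bounds combine to P^m \<le>
    2^(n+1) * sqrt q * exp (n / 2) = 2^(n+1) * exp (- 4 n), and the exponent 9 leaves exp (- 3 n) to
    absorb the power of 2.\<close>
  define q where "q = exp (- 9 * real n)"
  define R where "R = {z \<in> Rn n. q \<le> ?F z}"
  obtain B where B: "\<And>x. B < nsq n x \<Longrightarrow> ?F x < q"
    by (rule profile_vanishes[OF F, of q]) (auto simp: q_def)
  have cR: "compact R"
  proof (rule compact_bounded_Rn)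
    have "closed {y. q \<le> ?F y}"
      by (rule closed_Collect_le[OF continuous_on_const profile_continuous[OF F]])
    then show "closed R" unfolding R_def by (rule closed_Rn_Collect)
    show "nsq n z \<le> B" if "z \<in> R" for z
    proof -
      have "\<not> ?F z < q" using that by (simp add: R_def)
      then show ?thesis using B[of z] by (cases "B < nsq n z") simp_all
    qed
  qed (auto simp: R_def)
  define p where "p = (\<lambda>i\<in>{..<n}. real m * x i)"
  have "?F p = ?F (\<lambda>i. real m * x i)" by (rule profile_cong[OF F]) (auto simp: p_def)
  then have pR: "p \<notin> R" using x by (auto simp: core_def R_def q_def)
  obtain \<xi> where \<xi>: "\<And>z. z \<in> R \<Longrightarrow> ip n \<xi> z < ip n \<xi> p"
  proof (rule separate_point_compact[OF cR])
    show "R \<subseteq> Rn n" by (auto simp: R_def)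
    show "p \<in> Rn n" by (auto simp: p_def)
    show "p \<notin> R" by fact
    fix y z assume yz: "y \<in> R" "z \<in> R"
    then have "q * q \<le> ?F y * ?F z" by (intro mult_mono) (auto simp: R_def q_def profile_nonneg[OF F])
    then have "sqrt (q * q) \<le> sqrt (?F y * ?F z)" by (rule real_sqrt_le_mono)
    also have "\<dots> \<le> ?F (\<lambda>i. (y i + z i) / 2)" by (rule profile_midpoint[OF F])
    finally show "(\<lambda>i. (y i + z i) / 2) \<in> R" using yz by (auto simp: R_def q_def PiE_iff extensional_def)
  qed blast
  have ipp: "ip n \<xi> p = real m * ip n \<xi> x"
    by (simp add: ip_def p_def sum_distrib_left mult_ac)
  define P where "P = measure \<mu> {y \<in> Rn n. ip n \<xi> x \<le> ip n \<xi> y}"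
  define W where "W = sqrt (pi * real m) ^ n"
  have W: "0 < W" using m' by (simp add: W_def)
  have P0: "0 \<le> P" by (simp add: P_def)
  let ?H = "{z \<in> Rn n. real m * ip n \<xi> x \<le> ip n \<xi> z}"
  let ?I = "\<integral>\<^sup>+z. ennreal (?F z) * indicator ?H z \<partial>leb n"
  have "ennreal (P ^ m * W) = emeasure \<mu> {y \<in> Rn n. ip n \<xi> x \<le> ip n \<xi> y} ^ m * ennreal W"
    using P0 W by (simp add: emeasure_eq_measure P_def ennreal_mult' ennreal_power)
  also have "\<dots> \<le> 2 * (\<integral>\<^sup>+z. ennreal (?F z) * indicator {z. real m * ip n \<xi> x \<le> ip n \<xi> z} z \<partial>leb n)"
    unfolding W_def by (rule nn_integral_halfspace_gauss_conv[OF lc iso m'])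
  also have "(\<integral>\<^sup>+z. ennreal (?F z) * indicator {z. real m * ip n \<xi> x \<le> ip n \<xi> z} z \<partial>leb n) = ?I"
    by (intro nn_integral_cong) (auto simp: indicator_def)
  finally have 1: "ennreal (P ^ m * W) \<le> 2 * ?I" .
  have "ennreal (sqrt (?F (\<lambda>_. 0))) * ?I \<le> ennreal (sqrt q * 2 ^ n) * (\<integral>\<^sup>+z. ennreal (?F z) \<partial>leb n)"
  proof (rule nn_integral_low_level[OF F _ halfspace_sets])
    fix z assume z: "z \<in> ?H"
    then have "z \<notin> R" using \<xi>[of z] ipp by auto
    then show "?F z \<le> q" using z by (auto simp: R_def)
  qed (simp add: q_def)
  also have "(\<integral>\<^sup>+z. ennreal (?F z) \<partial>leb n) = ennreal W" unfolding W_def by (rule nn_integral_gauss_conv[OF lc iso m'])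
  finally have 2: "ennreal (sqrt (?F (\<lambda>_. 0))) * ?I \<le> ennreal (sqrt q * 2 ^ n * W)"
    by (simp add: ennreal_mult' q_def)
  have e: "sqrt (exp r) = exp (r / 2)" for r :: real
    by (rule real_sqrt_unique) (simp_all add: power2_eq_square exp_add[symmetric])
  have "exp (- (nsq n (\<lambda>_. 0) + real m * real n) / real m) \<le> ?F (\<lambda>_. 0)" by (rule gauss_conv_ge[OF lc iso m'])
  then have "exp (- real n) \<le> ?F (\<lambda>_. 0)" using m by (simp add: nsq_def)
  then have "sqrt (exp (- real n)) \<le> sqrt (?F (\<lambda>_. 0))" by simp
  then have 3: "exp (- real n / 2) \<le> sqrt (?F (\<lambda>_. 0))" unfolding e .
  have "ennreal (exp (- real n / 2) * (P ^ m * W)) = ennreal (exp (- real n / 2)) * ennreal (P ^ m * W)"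
    by (simp add: ennreal_mult')
  also have "\<dots> \<le> ennreal (sqrt (?F (\<lambda>_. 0))) * (2 * ?I)"
    by (intro mult_mono 1 ennreal_leI 3) auto
  also have "\<dots> = 2 * (ennreal (sqrt (?F (\<lambda>_. 0))) * ?I)" by (simp add: mult_ac)
  also have "\<dots> \<le> 2 * ennreal (sqrt q * 2 ^ n * W)" by (intro mult_left_mono 2) auto
  also have "\<dots> = ennreal (2 * (sqrt q * 2 ^ n * W))" by (subst ennreal_mult') auto
  finally have "exp (- real n / 2) * (P ^ m * W) \<le> 2 * (sqrt q * 2 ^ n * W)"
    using W by (subst (asm) ennreal_le_iff) (auto simp: q_def)
  then have "(exp (- real n / 2) * P ^ m) * W \<le> (2 * sqrt q * 2 ^ n) * W" by (simp add: mult_ac)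
  then have "exp (- real n / 2) * P ^ m \<le> 2 * sqrt q * 2 ^ n" using W by (rule mult_right_le_imp_le)
  also have "sqrt q = exp (- 9 * real n / 2)" unfolding q_def by (rule e)
  finally have "exp (real n / 2) * (exp (- real n / 2) * P ^ m) \<le> exp (real n / 2) * (2 * exp (- 9 * real n / 2) * 2 ^ n)"
    by (intro mult_left_mono) auto
  also have "exp (real n / 2) * (exp (- real n / 2) * P ^ m) = P ^ m"
    by (simp add: mult.assoc[symmetric] exp_add[symmetric])
  also have "exp (real n / 2) * (2 * exp (- 9 * real n / 2) * 2 ^ n) = exp (- 4 * real n) * 2 ^ Suc n"
  proof -
    have "exp (real n / 2) * exp (- 9 * real n / 2) = exp (- 4 * real n)" by (simp add: exp_add[symmetric])
    then show ?thesis by (simp add: mult_ac)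
  qed
  \<comment> \<open>Here n > 0 enters, through n + 1 \<le> 3 n.\<close>
  also have "(2::real) ^ Suc n \<le> exp (3 * real n)"
  proof -
    have "(2::real) ^ Suc n \<le> 2 ^ (3 * n)" using n by (intro power_increasing) auto
    also have "\<dots> \<le> exp 1 ^ (3 * n)" using exp_ge_add_one_self[of 1] by (intro power_mono) auto
    also have "\<dots> = exp (3 * real n)" by (simp add: exp_of_nat_mult[symmetric])
    finally show ?thesis .
  qed
  then have "exp (- 4 * real n) * 2 ^ Suc n \<le> exp (- 4 * real n) * exp (3 * real n)"
    by (intro mult_left_mono) auto
  also have "\<dots> = exp (- real n)" by (simp add: exp_add[symmetric])
  also have "\<dots> = exp (- real n / real m) ^ m" using m by (simp add: exp_of_nat_mult[symmetric])
  finally have "P ^ m \<le> exp (- real n / real m) ^ m" .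
  then have "P \<le> exp (- real n / real m)" using P0 m by (subst (asm) power_mono_iff) auto
  then show ?thesis using that by (auto simp: P_def)
qed

section \<open>Support and cube masses of a log-concave measure\<close>

text \<open>Inner regularity of finite Borel measures on the Polish space of all functions on nat;
  \<nu> is pushed there by the identity map.\<close>

lemma compact_subset_pos_measure:
  assumes ps: "prob_space \<nu>" and sets: "sets \<nu> = sets (leb n)" and A: "A \<in> sets \<nu>" "0 < emeasure \<nu> A"
  obtains K where "K \<subseteq> A" "compact K" "0 < emeasure \<nu> K"
proof -
  interpret prob_space \<nu> by fact
  have id: "(\<lambda>x. x) \<in> measurable \<nu> borel"
    using measurable_id_leb[of n] sets by (simp cong: measurable_cong_sets)
  let ?M = "distr \<nu> borel (\<lambda>x. x)"
  have AR: "A \<subseteq> Rn n" "A \<in> sets borel" using A sets sets_leb_iff by auto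
  have em: "emeasure ?M B = emeasure \<nu> B" if "B \<in> sets borel" "B \<subseteq> Rn n" for B
  proof -
    have "(\<lambda>x. x) -` B \<inter> space \<nu> = B" using that sets_eq_imp_space_eq[OF sets] by auto
    then show ?thesis using that id by (simp add: emeasure_distr)
  qed
  have "emeasure ?M (space ?M) \<noteq> \<infinity>"
    using prob_space_distr[OF id] prob_space.emeasure_space_1 by (metis ennreal_one_neq_top infinity_ennreal_def)
  then have "emeasure ?M A = (SUP K\<in>{K. K \<subseteq> A \<and> compact K}. emeasure ?M K)"
    using AR by (intro inner_regular) auto
  then have "0 < (SUP K\<in>{K. K \<subseteq> A \<and> compact K}. emeasure ?M K)" using em[OF AR(2,1)] A by simp
  then obtain K where K: "K \<subseteq> A" "compact K" "0 < emeasure ?M K" by (auto simp: less_SUP_iff)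
  then have "emeasure ?M K = emeasure \<nu> K" using AR by (intro em) (auto simp: borel_compact)
  then show ?thesis using K that by simp
qed

text \<open>Otherwise every point of a compact subset of positive measure would be the centre of a
  null cube, and finitely many of these cubes would cover that subset.\<close>

lemma support_point:
  assumes ps: "prob_space \<nu>" and sets: "sets \<nu> = sets (leb n)" and A: "A \<in> sets \<nu>" "0 < emeasure \<nu> A"
  obtains z where "z \<in> A" "\<And>r. 0 < r \<Longrightarrow> 0 < measure \<nu> (cube n z r)"
proof -
  interpret prob_space \<nu> by fact
  obtain K where K: "K \<subseteq> A" "compact K" "0 < emeasure \<nu> K" using compact_subset_pos_measure[OF assms] .
  have KR: "K \<subseteq> Rn n" using K A sets.sets_into_space sets by fastforce
  have "\<exists>z\<in>K. \<forall>r>0. 0 < measure \<nu> (cube n z r)"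
  proof (rule ccontr)
    assume "\<not> ?thesis"
    then have "\<forall>z\<in>K. \<exists>r>0. measure \<nu> (cube n z r) = 0" by (metis zero_less_measure_iff)
    then obtain r where r: "\<And>z. z \<in> K \<Longrightarrow> 0 < r z" "\<And>z. z \<in> K \<Longrightarrow> measure \<nu> (cube n z (r z)) = 0" by metis
    define U where "U z = (\<Inter>i\<in>{..<n}. {x. \<bar>x i - z i\<bar> < r z})" for z
    have U: "open (U z)" for z
      unfolding U_def
      by (intro open_INT) (auto intro!: open_Collect_less continuous_on_rabs continuous_on_diff continuous_on_product_coordinates)
    have "K \<subseteq> (\<Union>z\<in>K. U z)" using r(1) by (auto simp: U_def)
    then obtain C where C: "C \<subseteq> K" "finite C" "K \<subseteq> (\<Union>z\<in>C. U z)"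
      using compactE_image[OF K(2), of K U] U by auto
    have "K \<subseteq> (\<Union>z\<in>C. cube n z (r z))"
    proof
      fix x assume "x \<in> K"
      then obtain z where "z \<in> C" "x \<in> U z" using C by auto
      then show "x \<in> (\<Union>z\<in>C. cube n z (r z))" using \<open>x \<in> K\<close> KR by (force simp: U_def cube_def)
    qed
    then have "emeasure \<nu> K \<le> emeasure \<nu> (\<Union>z\<in>C. cube n z (r z))"
      using C sets by (intro emeasure_mono) auto
    also have "\<dots> \<le> (\<Sum>z\<in>C. emeasure \<nu> (cube n z (r z)))"
      using C sets by (intro emeasure_subadditive_finite) auto
    also have "\<dots> = 0" using r(2) C(1) by (intro sum.neutral) (auto simp: emeasure_eq_measure)
    finally show False using K by simp
  qed
  then show ?thesis using that K by blast
qed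

lemma convex_combination_closed:
  fixes Z :: "nat \<Rightarrow> nat \<Rightarrow> real"
  assumes two: "\<And>x y t. x \<in> C \<Longrightarrow> y \<in> C \<Longrightarrow> 0 < t \<Longrightarrow> t < 1 \<Longrightarrow> (\<lambda>i. t * x i + (1 - t) * y i) \<in> C"
  shows "(\<And>k. k < N \<Longrightarrow> Z k \<in> C) \<Longrightarrow> (\<And>k. k < N \<Longrightarrow> 0 \<le> w k) \<Longrightarrow> (\<Sum>k<N. w k) = (1::real) \<Longrightarrow>
    (\<lambda>i. \<Sum>k<N. w k * Z k i) \<in> C"
proof (induction N arbitrary: w)
  case 0
  then show ?case by simp
next
  case (Suc N)
  define s where "s = (\<Sum>k<N. w k)"
  have s0: "0 \<le> s" unfolding s_def using Suc.prems(2) by (intro sum_nonneg) auto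
  have sw: "s + w N = 1" using Suc.prems(3) by (simp add: s_def)
  have wN: "0 \<le> w N" using Suc.prems(2) by simp
  consider "s = 0" | "s = 1" | "0 < s" "s < 1" using s0 sw wN by linarith
  then show ?case
  proof cases
    case 1
    then have "\<forall>k\<in>{..<N}. w k = 0"
      using Suc.prems(2) unfolding s_def by (subst (asm) sum_nonneg_eq_0_iff) auto
    then have "(\<lambda>i. \<Sum>k<Suc N. w k * Z k i) = Z N" using 1 sw by auto
    then show ?thesis using Suc.prems(1) by simp
  next
    case 2
    then have "w N = 0" using sw by simp
    then show ?thesis using Suc.IH[of w] Suc.prems 2 by (simp add: s_def)
  next
    case 3
    have "(\<lambda>i. \<Sum>k<N. (w k / s) * Z k i) \<in> C"
      using Suc.prems 3 by (intro Suc.IH) (auto simp: s_def sum_divide_distrib[symmetric])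
    then have "(\<lambda>i. s * (\<Sum>k<N. (w k / s) * Z k i) + (1 - s) * Z N i) \<in> C"
      using Suc.prems(1) 3 by (intro two) auto
    moreover have "s * (\<Sum>k<N. (w k / s) * Z k i) + (1 - s) * Z N i = (\<Sum>k<Suc N. w k * Z k i)" for i
      using 3 sw by (simp add: sum_distrib_left)
    ultimately show ?thesis by simp
  qed
qed

text \<open>The combination of two cubes of equal radius lies in the cube of that radius around the
  combined centre. Masses of cubes of a fixed radius are thus a log-concave function of the centre
  and stand in for a density before one is known to exist.\<close>

lemma cube_log_concave:
  assumes lc: "log_concave n \<nu>" and t: "0 < t" "t < 1"
  shows "measure \<nu> (cube n x r) powr t * measure \<nu> (cube n y r) powr (1 - t)
    \<le> measure \<nu> (cube n (\<lambda>i. t * x i + (1 - t) * y i) r)"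
proof -
  have ps: "prob_space \<nu>" and sets: "sets \<nu> = sets (leb n)" using lc by (auto simp: log_concave_def)
  interpret prob_space \<nu> by fact
  have "measure \<nu> (cube n x r) powr t * measure \<nu> (cube n y r) powr (1 - t) \<le> measure \<nu> (minkowski_comb t (cube n x r) (cube n y r))"
    by (intro log_concave_minkowski[OF lc] compact_cube cube_subset t)
  also have "\<dots> \<le> measure \<nu> (cube n (\<lambda>i. t * x i + (1 - t) * y i) r)"
  proof (rule finite_measure_mono)
    show "minkowski_comb t (cube n x r) (cube n y r) \<subseteq> cube n (\<lambda>i. t * x i + (1 - t) * y i) r"
    proof
      fix z assume "z \<in> minkowski_comb t (cube n x r) (cube n y r)"
      then obtain a b where ab: "a \<in> cube n x r" "b \<in> cube n y r" and z: "z = (\<lambda>i. t * a i + (1 - t) * b i)"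
        by (auto simp: minkowski_comb_def)
      have "\<bar>z i - (t * x i + (1 - t) * y i)\<bar> \<le> r" if "i < n" for i
      proof -
        have "z i - (t * x i + (1 - t) * y i) = t * (a i - x i) + (1 - t) * (b i - y i)"
          by (simp add: z algebra_simps)
        also have "\<bar>\<dots>\<bar> \<le> t * \<bar>a i - x i\<bar> + (1 - t) * \<bar>b i - y i\<bar>"
          using t by (intro order.trans[OF abs_triangle_ineq]) (auto simp: abs_mult)
        also have "\<dots> \<le> t * r + (1 - t) * r"
          using ab that t by (intro add_mono mult_left_mono) (auto simp: cube_def)
        finally show ?thesis by (simp add: algebra_simps)
      qed
      moreover have "z \<in> Rn n" using ab by (auto simp: z cube_def PiE_iff extensional_def algebra_simps)
      ultimately show "z \<in> cube n (\<lambda>i. t * x i + (1 - t) * y i) r" by (simp add: cube_def)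
    qed
  qed (simp add: sets)
  finally show ?thesis .
qed

section \<open>Affinely independent support points\<close>

lemma ip_diff_left: "ip n (\<lambda>i. a i - c * b i) x = ip n a x - c * ip n b x"
  by (simp add: ip_def left_diff_distrib sum_subtractf sum_distrib_left mult.assoc)

lemma ip_scale_left: "ip n (\<lambda>i. c * b i) x = c * ip n b x"
  by (simp add: ip_def sum_distrib_left mult.assoc)

text \<open>This is where the hyperplane condition on \<nu> enters: the complement of a hyperplane
  has positive mass and so contains a point of the support.\<close>

lemma support_point_off_hyperplane:
  assumes lc: "log_concave n \<nu>" and \<psi>: "i < n" "\<psi> i \<noteq> 0"
  obtains z where "\<And>r. 0 < r \<Longrightarrow> 0 < measure \<nu> (cube n z r)" "ip n \<psi> z \<noteq> b"
proof -
  have ps: "prob_space \<nu>" and sets: "sets \<nu> = sets (leb n)" using lc by (auto simp: log_concave_def)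
  interpret prob_space \<nu> by fact
  have space: "space \<nu> = Rn n" using sets_eq_imp_space_eq[OF sets] by simp
  let ?H = "{x \<in> Rn n. (\<Sum>i<n. \<psi> i * x i) = b}"
  have "closed {x. ip n \<psi> x = b}" by (intro closed_Collect_eq continuous_intros)
  then have H: "?H \<in> sets \<nu>"
    using closed_in_sets_leb[OF closed_Rn_Collect, of "\<lambda>x. ip n \<psi> x = b" n] sets by (auto simp: ip_def)
  have "hyperplane_Rn n ?H" unfolding hyperplane_Rn_def using \<psi> by blast
  then have "measure \<nu> ?H < 1" using lc unfolding log_concave_def by blast
  then have "0 < measure \<nu> (space \<nu> - ?H)" using H by (simp add: prob_compl)
  then have "0 < emeasure \<nu> (space \<nu> - ?H)" by (simp add: emeasure_eq_measure)
  then obtain z where "z \<in> space \<nu> - ?H" "\<And>r. 0 < r \<Longrightarrow> 0 < measure \<nu> (cube n z r)"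
    using support_point[OF ps sets, of "space \<nu> - ?H"] H by blast
  then show ?thesis using that by (auto simp: space ip_def)
qed

text \<open>The dual vectors \<psi> express affine independence of the support points Z 0, ..., Z n
  quantitatively, so that it survives small perturbations. They are built by Gauss-Jordan
  elimination, one support point at a time.\<close>

lemma affine_support_basis:
  assumes lc: "log_concave n \<nu>"
  obtains Z \<psi> where "\<And>k r. k \<le> n \<Longrightarrow> 0 < r \<Longrightarrow> 0 < measure \<nu> (cube n (Z k) r)"
    "\<And>i j. i < n \<Longrightarrow> j < n \<Longrightarrow> ip n (\<psi> i) (\<lambda>k. Z (Suc j) k - Z 0 k) = (if i = j then 1 else (0::real))"
proof -
  have ps: "prob_space \<nu>" and sets: "sets \<nu> = sets (leb n)" using lc by (auto simp: log_concave_def)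
  interpret prob_space \<nu> by fact
  \<comment> \<open>The last conjunct says that the vectors with index at least J are still unit
    vectors on the coordinates from J on. In particular \<psi> J is nonzero, so the hyperplane on
    which it equals its value at Z 0 is a genuine one and the next support point can be chosen off
    it.\<close>
  have "\<exists>Z \<psi>. (\<forall>k\<le>J. \<forall>r>0. 0 < measure \<nu> (cube n (Z k) r)) \<and>
      (\<forall>i<n. \<forall>l<J. ip n (\<psi> i) (\<lambda>k. Z (Suc l) k - Z 0 k) = (if i = l then 1 else (0::real))) \<and>
      (\<forall>i<n. J \<le> i \<longrightarrow> (\<forall>l<n. J \<le> l \<longrightarrow> \<psi> i l = (if l = i then 1 else 0)))" if "J \<le> n" for J
    using that
  proof (induction J)
    case 0
    have "0 < emeasure \<nu> (space \<nu>)" by (simp add: emeasure_space_1)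
    then obtain z where z: "\<And>r. 0 < r \<Longrightarrow> 0 < measure \<nu> (cube n z r)"
      using support_point[OF ps sets, of "space \<nu>"] by blast
    show ?case
      by (rule exI[of _ "\<lambda>_. z"], rule exI[of _ "\<lambda>i l. if l = i then 1 else 0"]) (use z in auto)
  next
    case (Suc J)
    from Suc.IH[OF Suc_leD[OF Suc.prems]] obtain Z \<psi>
      where Z': "\<forall>k\<le>J. \<forall>r>0. 0 < measure \<nu> (cube n (Z k) r)"
      and dual': "\<forall>i<n. \<forall>l<J. ip n (\<psi> i) (\<lambda>k. Z (Suc l) k - Z 0 k) = (if i = l then 1 else (0::real))"
      and tri': "\<forall>i<n. J \<le> i \<longrightarrow> (\<forall>l<n. J \<le> l \<longrightarrow> \<psi> i l = (if l = i then 1 else 0))"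
      by (elim exE conjE) (rule that; assumption)
    note Z = Z'[rule_format] and dual = dual'[rule_format] and tri = tri'[rule_format]
    have J: "J < n" using Suc by simp
    obtain z where z: "\<And>r. 0 < r \<Longrightarrow> 0 < measure \<nu> (cube n z r)" and zne: "ip n (\<psi> J) z \<noteq> ip n (\<psi> J) (Z 0)"
      using support_point_off_hyperplane[OF lc J, of "\<psi> J" "ip n (\<psi> J) (Z 0)"] tri[of J J] J by auto
    define v where "v = (\<lambda>k. z k - Z 0 k)"
    define d where "d = ip n (\<psi> J) v"
    have d: "d \<noteq> 0" using zne by (simp add: d_def v_def ip_diff)
    define Z' where "Z' = Z(Suc J := z)"
    \<comment> \<open>The elimination step: \<psi> J is normalised to 1 on the new difference v, and
      a multiple of it is subtracted from the others to make them vanish on v. Values on earlier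
      differences persist because \<psi> J vanishes there.\<close>
    define \<psi>' where "\<psi>' i = (if i = J then (\<lambda>l. (1 / d) * \<psi> J l) else (\<lambda>l. \<psi> i l - (ip n (\<psi> i) v / d) * \<psi> J l))" for i
    have new: "ip n (\<psi>' i) x = (if i = J then ip n (\<psi> J) x / d else ip n (\<psi> i) x - ip n (\<psi> i) v / d * ip n (\<psi> J) x)" for i x
    proof (cases "i = J")
      case True
      then have "\<psi>' i = (\<lambda>l. (1 / d) * \<psi> J l)" by (simp add: \<psi>'_def)
      then show ?thesis using True by (simp only: ip_scale_left) simp
    next
      case False
      then have "\<psi>' i = (\<lambda>l. \<psi> i l - (ip n (\<psi> i) v / d) * \<psi> J l)" by (simp add: \<psi>'_def)
      then show ?thesis using False by (simp only: ip_diff_left) simp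
    qed
    have "0 < measure \<nu> (cube n (Z' k) r)" if "k \<le> Suc J" "0 < r" for k r
      using that Z[of k r] z by (auto simp: Z'_def)
    moreover have "ip n (\<psi>' i) (\<lambda>k. Z' (Suc l) k - Z' 0 k) = (if i = l then 1 else 0)" if "i < n" "l < Suc J" for i l
    proof (cases "l = J")
      case True
      then have "(\<lambda>k. Z' (Suc l) k - Z' 0 k) = v" by (simp add: Z'_def v_def)
      then show ?thesis using d True by (simp add: new d_def[symmetric])
    next
      case False
      then have l: "l < J" using that by simp
      then have "(\<lambda>k. Z' (Suc l) k - Z' 0 k) = (\<lambda>k. Z (Suc l) k - Z 0 k)" by (simp add: Z'_def)
      then show ?thesis using dual[OF that(1) l] dual[OF J l] l by (auto simp: new)
    qed
    moreover have "\<psi>' i l = (if l = i then 1 else 0)" if "i < n" "Suc J \<le> i" "l < n" "Suc J \<le> l" for i l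
      using that tri[of i l] tri[of J l] J by (auto simp: \<psi>'_def)
    ultimately show ?case by (intro exI[of _ Z'] exI[of _ \<psi>'] conjI allI impI) auto
  qed
  from this[OF order.refl] obtain Z \<psi>
    where "\<forall>k\<le>n. \<forall>r>0. 0 < measure \<nu> (cube n (Z k) r)"
    and "\<forall>i<n. \<forall>l<n. ip n (\<psi> i) (\<lambda>k. Z (Suc l) k - Z 0 k) = (if i = l then 1 else (0::real))"
    by (elim exE conjE) (rule that; assumption)
  then show ?thesis by (intro that[of Z \<psi>]) auto
qed

text \<open>In the row k where |c k| is the maximum M, the deviation from the identity contributes
  at most n * M / (2 n) = M / 2, so M / 2 \<le> E.\<close>

lemma near_identity_bound:
  fixes a :: "nat \<Rightarrow> nat \<Rightarrow> real"
  assumes n: "0 < n"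
    and a: "\<And>i j. i < n \<Longrightarrow> j < n \<Longrightarrow> \<bar>a i j - (if i = j then 1 else 0)\<bar> \<le> 1 / (2 * real n)"
    and E: "\<And>i. i < n \<Longrightarrow> \<bar>\<Sum>j<n. c j * a i j\<bar> \<le> E" and i: "i < n"
  shows "\<bar>c i\<bar> \<le> 2 * E"
proof -
  define M where "M = Max ((\<lambda>i. \<bar>c i\<bar>) ` {..<n})"
  have ne: "(\<lambda>i. \<bar>c i\<bar>) ` {..<n} \<noteq> {}" using n by auto
  have le: "\<bar>c j\<bar> \<le> M" if "j < n" for j unfolding M_def using that by (intro Max_ge) auto
  obtain k where k: "k < n" "\<bar>c k\<bar> = M"
    using Max_in[OF _ ne] unfolding M_def[symmetric] by auto
  have "(\<Sum>j<n. c j * a k j) = (\<Sum>j<n. c j * (a k j - (if k = j then 1 else 0))) + c k"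
    using k(1) by (simp add: right_diff_distrib sum_subtractf if_distrib[where f="\<lambda>x. _ * x"] cong: if_cong)
  moreover have "\<bar>\<Sum>j<n. c j * (a k j - (if k = j then 1 else 0))\<bar> \<le> (\<Sum>j<n. M * (1 / (2 * real n)))"
  proof (intro order.trans[OF sum_abs] sum_mono)
    fix j assume "j \<in> {..<n}"
    then show "\<bar>c j * (a k j - (if k = j then 1 else 0))\<bar> \<le> M * (1 / (2 * real n))"
      unfolding abs_mult using a[OF k(1), of j] le[of j] abs_ge_zero[of "c j"] by (intro mult_mono) auto
  qed
  moreover have "(\<Sum>j<n. M * (1 / (2 * real n))) = M / 2" using n by simp
  ultimately have "M / 2 \<le> E" using E[OF k(1)] k(2) by linarith
  then show ?thesis using le[OF i] by simp
qed

section \<open>Averaging over cubes\<close>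

text \<open>Pairs (x, w) with w in the cube around x are the pairs with x in the cube around w. Each
  w in A therefore contributes the full volume (2 r)^n of a cube contained in S.\<close>

lemma cube_Fubini:
  assumes ps: "prob_space \<nu>" and sets: "sets \<nu> = sets (leb n)" and r: "0 \<le> r"
    and S: "S \<in> sets (leb n)" and A: "A \<in> sets \<nu>" and AS: "\<And>w. w \<in> A \<Longrightarrow> cube n w r \<subseteq> S"
  shows "ennreal ((2 * r) ^ n) * emeasure \<nu> A \<le> (\<integral>\<^sup>+x. emeasure \<nu> (cube n x r) * indicator S x \<partial>leb n)"
proof -
  interpret prob_space \<nu> by fact
  interpret L: sigma_finite_measure "leb n" by (rule sigma_finite_leb)
  interpret P: pair_sigma_finite "leb n" \<nu> ..
  have space: "space \<nu> = Rn n" using sets_eq_imp_space_eq[OF sets] by simp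
  have c: "(\<lambda>y. y i) \<in> borel_measurable \<nu>" for i :: nat
    using measurable_component_leb[of i n] sets by (simp cong: measurable_cong_sets)
  define T where "T = {p \<in> space (leb n \<Otimes>\<^sub>M \<nu>). \<forall>i\<in>{..<n}. \<bar>snd p i - fst p i\<bar> \<le> r}"
  have "T \<in> sets (leb n \<Otimes>\<^sub>M \<nu>)"
    unfolding T_def
    using measurable_compose[OF measurable_fst[of "leb n" \<nu>] measurable_component_leb]
      measurable_compose[OF measurable_snd[of "leb n" \<nu>] c]
    by (intro sets.sets_Collect_finite_All) (auto intro!: borel_measurable_le borel_measurable_diff borel_measurable_abs)
  then have "(indicator T :: _ \<Rightarrow> ennreal) \<in> borel_measurable (leb n \<Otimes>\<^sub>M \<nu>)"
    by (rule borel_measurable_indicator)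
  moreover have eqT: "indicator (cube n (fst p) r) (snd p) = (indicator T p :: ennreal)" if "p \<in> space (leb n \<Otimes>\<^sub>M \<nu>)" for p
  proof -
    have "snd p \<in> Rn n" using that space by (metis mem_Times_iff space_pair_measure)
    then have "snd p \<in> cube n (fst p) r \<longleftrightarrow> p \<in> T"
      unfolding cube_def T_def using that by blast
    then show ?thesis by (simp only: indicator_def)
  qed
  ultimately have "(\<lambda>p. indicator (cube n (fst p) r) (snd p) :: ennreal) \<in> borel_measurable (leb n \<Otimes>\<^sub>M \<nu>)"
    by (subst measurable_cong[OF eqT])
  moreover have "(\<lambda>p. indicator S (fst p) :: ennreal) \<in> borel_measurable (leb n \<Otimes>\<^sub>M \<nu>)"
    using S by measurable
  ultimately have m: "(\<lambda>(x, w). indicator (cube n x r) w * indicator S x :: ennreal) \<in> borel_measurable (leb n \<Otimes>\<^sub>M \<nu>)"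
    unfolding case_prod_beta' by (intro borel_measurable_times_ennreal)
  have "ennreal ((2 * r) ^ n) * emeasure \<nu> A = (\<integral>\<^sup>+w. ennreal ((2 * r) ^ n) * indicator A w \<partial>\<nu>)"
    using A by (simp add: nn_integral_cmult_indicator)
  also have "\<dots> \<le> (\<integral>\<^sup>+w. (\<integral>\<^sup>+x. indicator (cube n x r) w * indicator S x \<partial>leb n) \<partial>\<nu>)"
  proof (intro nn_integral_mono)
    fix w assume w: "w \<in> space \<nu>"
    show "ennreal ((2 * r) ^ n) * indicator A w \<le> (\<integral>\<^sup>+x. indicator (cube n x r) w * indicator S x \<partial>leb n)"
    proof (cases "w \<in> A")
      case True
      have "ennreal ((2 * r) ^ n) = (\<integral>\<^sup>+x. indicator (cube n w r) x \<partial>leb n)"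
        using r by (simp add: emeasure_cube)
      also have "\<dots> \<le> (\<integral>\<^sup>+x. indicator (cube n x r) w * indicator S x \<partial>leb n)"
        using AS[OF True] w space
        by (intro nn_integral_mono) (auto simp: indicator_def cube_def abs_minus_commute)
      finally show ?thesis using True by simp
    qed simp
  qed
  also have "\<dots> = (\<integral>\<^sup>+x. (\<integral>\<^sup>+w. indicator (cube n x r) w * indicator S x \<partial>\<nu>) \<partial>leb n)"
    by (rule P.Fubini'[OF m])
  also have "\<dots> = (\<integral>\<^sup>+x. emeasure \<nu> (cube n x r) * indicator S x \<partial>leb n)"
    using sets by (intro nn_integral_cong) (simp add: nn_integral_multc)
  finally show ?thesis .
qed

text \<open>By averaging, some cube of radius r has a mass proportional to r^n, with a factor that
  depends only on the large cube and not on r.\<close>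

lemma dense_small_cube:
  assumes ps: "prob_space \<nu>" and sets: "sets \<nu> = sets (leb n)" and r: "0 < r" "r \<le> \<rho>"
    and pos: "0 < measure \<nu> (cube n z \<rho>)"
  obtains y where "y \<in> cube n z (2 * \<rho>)" "measure \<nu> (cube n z \<rho>) / 2 / (2 * \<rho>) ^ n * r ^ n \<le> measure \<nu> (cube n y r)"
proof -
  interpret prob_space \<nu> by fact
  define g where "g = measure \<nu> (cube n z \<rho>)"
  \<comment> \<open>If all centres in the cube of volume (4 \<rho>)^n gave mass at most s, averaging
    would yield (2 r)^n * g \<le> s * (4 \<rho>)^n = (2 r)^n * g / 2, which is absurd as g >
    0.\<close>
  define s where "s = g / 2 / (2 * \<rho>) ^ n * r ^ n"
  have \<rho>: "0 < \<rho>" using r by simp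
  have s: "0 \<le> s" using pos r \<rho> by (simp add: s_def g_def)
  have "\<exists>y\<in>cube n z (2 * \<rho>). s \<le> measure \<nu> (cube n y r)"
  proof (rule ccontr)
    assume "\<not> ?thesis"
    then have small: "measure \<nu> (cube n y r) \<le> s" if "y \<in> cube n z (2 * \<rho>)" for y using that by force
    have "ennreal ((2 * r) ^ n) * emeasure \<nu> (cube n z \<rho>) \<le> (\<integral>\<^sup>+x. emeasure \<nu> (cube n x r) * indicator (cube n z (2 * \<rho>)) x \<partial>leb n)"
    proof (rule cube_Fubini[OF ps sets])
      fix w assume w: "w \<in> cube n z \<rho>"
      show "cube n w r \<subseteq> cube n z (2 * \<rho>)"
      proof
        fix y assume y: "y \<in> cube n w r"
        have "\<bar>y i - z i\<bar> \<le> 2 * \<rho>" if "i < n" for i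
        proof -
          have "\<bar>y i - w i\<bar> \<le> r" "\<bar>w i - z i\<bar> \<le> \<rho>" using y w that by (auto simp: cube_def)
          then show ?thesis using r by linarith
        qed
        then show "y \<in> cube n z (2 * \<rho>)" using y by (auto simp: cube_def)
      qed
    qed (use r sets in auto)
    also have "\<dots> \<le> (\<integral>\<^sup>+x. ennreal s * indicator (cube n z (2 * \<rho>)) x \<partial>leb n)"
      using small by (intro nn_integral_mono) (auto simp: emeasure_eq_measure indicator_def ennreal_leI)
    also have "\<dots> = ennreal s * ennreal ((2 * (2 * \<rho>)) ^ n)"
      using \<rho> by (simp add: nn_integral_cmult_indicator emeasure_cube)
    finally have "ennreal ((2 * r) ^ n * g) \<le> ennreal (s * (2 * (2 * \<rho>)) ^ n)"
      using s r by (simp add: emeasure_eq_measure g_def ennreal_mult')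
    then have "(2 * r) ^ n * g \<le> s * (2 * (2 * \<rho>)) ^ n"
      using s \<rho> by (subst (asm) ennreal_le_iff) auto
    also have "\<dots> = (2 * r) ^ n * (g / 2)"
    proof -
      have "s * (2 * (2 * \<rho>)) ^ n = (g / 2 / (2 * \<rho>) ^ n * r ^ n) * (2 ^ n * (2 * \<rho>) ^ n)"
        by (simp only: s_def power_mult_distrib)
      also have "\<dots> = (2 * r) ^ n * (g / 2)" using \<rho> by (simp add: power_mult_distrib[of 2 r])
      finally show ?thesis .
    qed
    finally show False using r pos by (simp add: g_def)
  qed
  then show ?thesis using that by (auto simp: s_def g_def)
qed

section \<open>Existence of densities\<close>

lemma cube_level_convex:
  assumes lc: "log_concave n \<nu>" and s: "0 \<le> s"
    and x: "s \<le> measure \<nu> (cube n x r)" and y: "s \<le> measure \<nu> (cube n y r)" and t: "0 < t" "t < 1"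
  shows "s \<le> measure \<nu> (cube n (\<lambda>i. t * x i + (1 - t) * y i) r)"
proof -
  have "s = s powr t * s powr (1 - t)" using s by (simp add: powr_add[symmetric])
  also have "\<dots> \<le> measure \<nu> (cube n x r) powr t * measure \<nu> (cube n y r) powr (1 - t)"
    using s x y t by (intro mult_mono powr_mono2) auto
  also have "\<dots> \<le> measure \<nu> (cube n (\<lambda>i. t * x i + (1 - t) * y i) r)"
    by (rule cube_log_concave[OF lc t])
  finally show ?thesis .
qed

lemma disjoint_cubes_count:
  assumes ps: "prob_space \<nu>" and sets: "sets \<nu> = sets (leb n)" and I: "finite I"
    and disj: "disjoint_family_on (\<lambda>k. cube n (X k) r) I"
    and b: "\<And>k. k \<in> I \<Longrightarrow> b \<le> measure \<nu> (cube n (X k) r)"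
  shows "real (card I) * b \<le> 1"
proof -
  interpret prob_space \<nu> by fact
  have "real (card I) * b \<le> (\<Sum>k\<in>I. measure \<nu> (cube n (X k) r))"
    using sum_mono[of I "\<lambda>_. b"] b by simp
  also have "\<dots> = measure \<nu> (\<Union>k\<in>I. cube n (X k) r)"
    by (rule finite_measure_finite_Union[OF I _ disj, symmetric]) (simp add: image_subset_iff sets)
  also have "\<dots> \<le> 1" by simp
  finally show ?thesis .
qed

text \<open>Applying \<psi> i to the combination of the differences of the Y j recovers c i up to a
  matrix near the identity. Moving each Z j by at most 2 \<rho> changes an entry by at most 4 K
  \<rho> = 1 / (2 n), which is the tolerance of \<open>near_identity_bound\<close>.\<close>

lemma perturbed_basis_bound:
  assumes n: "0 < n" and K: "0 < K" "\<And>i. i < n \<Longrightarrow> (\<Sum>k<n. \<bar>\<psi> i k\<bar>) \<le> K"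
    and dual: "\<And>i j. i < n \<Longrightarrow> j < n \<Longrightarrow> ip n (\<psi> i) (\<lambda>k. Z (Suc j) k - Z 0 k) = (if i = j then 1 else (0::real))"
    and Y: "\<And>j. j \<le> n \<Longrightarrow> Y j \<in> cube n (Z j) (2 * \<rho>)" and \<rho>: "\<rho> = 1 / (8 * K * real n)"
    and u: "\<And>k. k < n \<Longrightarrow> \<bar>\<Sum>j<n. c j * (Y (Suc j) k - Y 0 k)\<bar> \<le> e" and i: "i < n"
  shows "\<bar>c i\<bar> \<le> 2 * (K * e)"
proof (rule near_identity_bound[OF n _ _ i, where a="\<lambda>i j. ip n (\<psi> i) (\<lambda>k. Y (Suc j) k - Y 0 k)"])
  have ipK: "\<bar>ip n (\<psi> i) x\<bar> \<le> K * e" if i: "i < n" and x: "\<And>k. k < n \<Longrightarrow> \<bar>x k\<bar> \<le> e" for i x e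
  proof -
    have e: "0 \<le> e" using x[OF n] by linarith
    have "\<bar>ip n (\<psi> i) x\<bar> \<le> (\<Sum>k<n. \<bar>\<psi> i k\<bar> * e)"
      unfolding ip_def using x by (intro order.trans[OF sum_abs] sum_mono) (auto simp: abs_mult intro!: mult_left_mono)
    also have "\<dots> = (\<Sum>k<n. \<bar>\<psi> i k\<bar>) * e" by (rule sum_distrib_right[symmetric])
    also have "\<dots> \<le> K * e" using K(2)[OF i] e by (rule mult_right_mono)
    finally show ?thesis .
  qed
  show "\<bar>ip n (\<psi> i) (\<lambda>k. Y (Suc j) k - Y 0 k) - (if i = j then 1 else 0)\<bar> \<le> 1 / (2 * real n)"
    if ij: "i < n" "j < n" for i j
  proof -
    have "ip n (\<psi> i) (\<lambda>k. Y (Suc j) k - Y 0 k) - (if i = j then 1 else 0)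
      = ip n (\<psi> i) (\<lambda>k. Y (Suc j) k - Y 0 k) - ip n (\<psi> i) (\<lambda>k. Z (Suc j) k - Z 0 k)"
      by (simp only: dual[OF ij])
    also have "\<dots> = ip n (\<psi> i) (\<lambda>k. (Y (Suc j) k - Y 0 k) - (Z (Suc j) k - Z 0 k))"
      by (rule ip_diff[symmetric])
    also have "\<bar>\<dots>\<bar> \<le> K * (4 * \<rho>)"
    proof (rule ipK[OF ij(1)])
      fix k assume k: "k < n"
      have "\<bar>Y (Suc j) k - Z (Suc j) k\<bar> \<le> 2 * \<rho>" "\<bar>Y 0 k - Z 0 k\<bar> \<le> 2 * \<rho>"
        using Y[of "Suc j"] Y[of 0] ij k by (auto simp: cube_def)
      then show "\<bar>(Y (Suc j) k - Y 0 k) - (Z (Suc j) k - Z 0 k)\<bar> \<le> 4 * \<rho>" by linarith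
    qed
    also have "K * (4 * \<rho>) = 1 / (2 * real n)" using K n by (simp add: \<rho>)
    finally show ?thesis .
  qed
  show "\<bar>\<Sum>j<n. c j * ip n (\<psi> i) (\<lambda>k. Y (Suc j) k - Y 0 k)\<bar> \<le> K * e" if "i < n" for i
  proof -
    have "(\<Sum>j<n. c j * ip n (\<psi> i) (\<lambda>k. Y (Suc j) k - Y 0 k)) = ip n (\<psi> i) (\<lambda>k. \<Sum>j<n. c j * (Y (Suc j) k - Y 0 k))"
      unfolding ip_def sum_distrib_left by (subst sum.swap) (simp add: mult_ac)
    then show ?thesis using ipK[OF that u] by simp
  qed
qed

text \<open>Interpolating a cube of radius r with a grid in a simplex spanned by support points yields of order
  r^(-n) disjoint cubes of the same radius, whose masses are bounded below in terms of that of the given cube.\<close>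

lemma cube_measure_bound:
  assumes lc: "log_concave n \<nu>" and n: "0 < n"
  obtains c C :: real where "0 < c" "0 \<le> C" "\<And>N x. 0 < N \<Longrightarrow> measure \<nu> (cube n x (c / real N)) \<le> C * (c / real N) ^ n"
proof -
  have ps: "prob_space \<nu>" and sets: "sets \<nu> = sets (leb n)" using lc by (auto simp: log_concave_def)
  interpret prob_space \<nu> by fact
  obtain Z \<psi> where Z: "\<And>k r. k \<le> n \<Longrightarrow> 0 < r \<Longrightarrow> 0 < measure \<nu> (cube n (Z k) r)"
    and dual: "\<And>i j. i < n \<Longrightarrow> j < n \<Longrightarrow> ip n (\<psi> i) (\<lambda>k. Z (Suc j) k - Z 0 k) = (if i = j then 1 else (0::real))"
    using affine_support_basis[OF lc] by blast
  define K where "K = (\<Sum>i<n. \<Sum>k<n. \<bar>\<psi> i k\<bar>) + 1"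
  have K0: "0 < K" unfolding K_def by (intro add_nonneg_pos sum_nonneg) auto
  have K: "(\<Sum>k<n. \<bar>\<psi> i k\<bar>) \<le> K" if "i < n" for i
    using member_le_sum[of i "{..<n}" "\<lambda>i. \<Sum>k<n. \<bar>\<psi> i k\<bar>"] that by (simp add: K_def sum_nonneg)
  define \<rho> where "\<rho> = 1 / (8 * K * real n)"
  have \<rho>: "0 < \<rho>" using K0 n by (simp add: \<rho>_def)
  \<comment> \<open>A mass density, uniform in the radius: near each Z k every r \<le> \<rho> admits
    a cube of radius r and mass at least \<delta> * r^n.\<close>
  define \<delta> where "\<delta> = Min ((\<lambda>k. measure \<nu> (cube n (Z k) \<rho>) / 2 / (2 * \<rho>) ^ n) ` {..n})"
  have \<delta>: "0 < \<delta>" unfolding \<delta>_def using Z \<rho> by (subst Min_gr_iff) auto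
  have \<delta>le: "\<delta> \<le> measure \<nu> (cube n (Z k) \<rho>) / 2 / (2 * \<rho>) ^ n" if "k \<le> n" for k
    unfolding \<delta>_def using that by (intro Min_le) auto
  \<comment> \<open>Two grid points differ by at least 1 / (n N) in some coefficient, whereas
    intersecting cubes of radius c / N would force all differences below 8 K c / N. The factor 9
    makes this smaller than 1 / (n N) and also ensures c \<le> \<rho>.\<close>
  define c where "c = 1 / (9 * K * real n)"
  have c: "0 < c" using K0 n by (simp add: c_def)
  define C where "C = (1 / c ^ n)\<^sup>2 / \<delta>"
  have "measure \<nu> (cube n x0 (c / real N)) \<le> C * (c / real N) ^ n" if N: "0 < N" for N x0
  proof -
    define r where "r = c / real N"
    have r: "0 < r" using c N by (simp add: r_def)
    have "r \<le> c" using c N by (simp add: r_def divide_le_eq_1 field_simps)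
    also have "c \<le> \<rho>" using K0 n by (simp add: c_def \<rho>_def frac_le)
    finally have r\<rho>: "r \<le> \<rho>" .
    have "\<exists>y. y \<in> cube n (Z k) (2 * \<rho>) \<and> \<delta> * r ^ n \<le> measure \<nu> (cube n y r)" if k: "k \<le> n" for k
    proof -
      obtain y where y: "y \<in> cube n (Z k) (2 * \<rho>)" "measure \<nu> (cube n (Z k) \<rho>) / 2 / (2 * \<rho>) ^ n * r ^ n \<le> measure \<nu> (cube n y r)"
        using dense_small_cube[OF ps sets r r\<rho> Z[OF k \<rho>]] by blast
      have "\<delta> * r ^ n \<le> measure \<nu> (cube n (Z k) \<rho>) / 2 / (2 * \<rho>) ^ n * r ^ n"
        using \<delta>le[OF k] r by (intro mult_right_mono) auto
      then show ?thesis using y by (intro exI[of _ y]) auto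
    qed
    then obtain Y where Yc: "\<And>k. k \<le> n \<Longrightarrow> Y k \<in> cube n (Z k) (2 * \<rho>)"
      and Ym: "\<And>k. k \<le> n \<Longrightarrow> \<delta> * r ^ n \<le> measure \<nu> (cube n (Y k) r)" by metis
    define s where "s = \<delta> * r ^ n"
    have s: "0 < s" using \<delta> r by (simp add: s_def)
    define M where "M = measure \<nu> (cube n x0 r)"
    define Q where "Q = {y. s \<le> measure \<nu> (cube n y r)}"
    define I where "I = PiE {..<n} (\<lambda>_. {..<N})"
    \<comment> \<open>Barycentric coordinates with respect to Y 0, ..., Y n. As k j < N, the
      coefficients of Y 1, ..., Y n sum to at most 1, and Y 0 takes the rest. There are N^n such
      grid points.\<close>
    define w where "w k = (\<lambda>l. case l of 0 \<Rightarrow> 1 - (\<Sum>j<n. real (k j) / (real n * real N)) | Suc j \<Rightarrow> real (k j) / (real n * real N))" for k :: "nat \<Rightarrow> nat"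
    define P where "P k = (\<lambda>i. \<Sum>l<Suc n. w k l * Y l i)" for k :: "nat \<Rightarrow> nat"
    \<comment> \<open>Midpoints between the given centre and the grid points: by log-concavity the
      cubes around them have mass at least sqrt (M * s).\<close>
    define X where "X k = (\<lambda>i. 1/2 * x0 i + (1 - 1/2) * P k i)" for k
    have finI: "finite I" unfolding I_def by (intro finite_PiE) auto
    have cardI: "real (card I) = real N ^ n" unfolding I_def by (subst card_PiE) auto
    have PQ: "P k \<in> Q" if k: "k \<in> I" for k
      unfolding P_def
    proof (rule convex_combination_closed)
      show "(\<lambda>i. t * x i + (1 - t) * y i) \<in> Q" if "x \<in> Q" "y \<in> Q" "0 < t" "t < 1" for x y t
        using cube_level_convex[OF lc less_imp_le[OF s] _ _ that(3,4)] that(1,2) by (simp add: Q_def)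
      show "Y l \<in> Q" if "l < Suc n" for l using Ym[of l] that by (auto simp: Q_def s_def)
      have le1: "(\<Sum>j<n. real (k j) / (real n * real N)) \<le> 1"
      proof -
        have "real (k j) / (real n * real N) \<le> 1 / real n" if "j < n" for j
        proof -
          have "k j < N" using k that by (auto simp: I_def PiE_iff)
          then show ?thesis using n N by (simp add: field_simps)
        qed
        then have "(\<Sum>j<n. real (k j) / (real n * real N)) \<le> (\<Sum>j<n. 1 / real n)" by (intro sum_mono) auto
        then show ?thesis using n by simp
      qed
      show "0 \<le> w k l" if "l < Suc n" for l using le1 by (cases l) (auto simp: w_def)
      show "(\<Sum>l<Suc n. w k l) = 1" by (simp only: sum.lessThan_Suc_shift) (simp add: w_def)
    qed
    have Peq: "P k i = Y 0 i + (\<Sum>j<n. real (k j) / (real n * real N) * (Y (Suc j) i - Y 0 i))" for k i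
      unfolding P_def sum.lessThan_Suc_shift
      by (simp add: w_def algebra_simps sum_subtractf sum_distrib_left sum_distrib_right diff_divide_distrib)
    have XM: "sqrt M * sqrt s \<le> measure \<nu> (cube n (X k) r)" if k: "k \<in> I" for k
    proof -
      have "sqrt M * sqrt s \<le> sqrt M * sqrt (measure \<nu> (cube n (P k) r))"
        using PQ[OF k] by (intro mult_left_mono) (auto simp: Q_def M_def)
      also have "\<dots> = measure \<nu> (cube n x0 r) powr (1/2) * measure \<nu> (cube n (P k) r) powr (1 - 1/2)"
        by (simp add: M_def powr_half_sqrt)
      also have "\<dots> \<le> measure \<nu> (cube n (X k) r)"
        unfolding X_def by (rule cube_log_concave[OF lc]) auto
      finally show ?thesis .
    qed
    have disj: "disjoint_family_on (\<lambda>k. cube n (X k) r) I"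
      unfolding disjoint_family_on_def
    proof (intro ballI impI)
      fix k k' assume kk: "k \<in> I" "k' \<in> I" "k \<noteq> k'"
      obtain i where i: "i < n" "k i \<noteq> k' i"
        using kk PiE_ext[of k "{..<n}" _ k'] unfolding I_def by blast
      define a where "a = (\<lambda>j. real (k j) / (real n * real N) - real (k' j) / (real n * real N))"
      show "cube n (X k) r \<inter> cube n (X k') r = {}"
      proof (rule ccontr)
        assume "cube n (X k) r \<inter> cube n (X k') r \<noteq> {}"
        then obtain y where y: "y \<in> cube n (X k) r" "y \<in> cube n (X k') r" by blast
        have "\<bar>a i\<bar> \<le> 2 * (K * (4 * r))"
        proof (rule perturbed_basis_bound[OF n K0 K dual Yc \<rho>_def _ i(1)])
          fix l assume l: "l < n"
          have "\<bar>y l - X k l\<bar> \<le> r" "\<bar>y l - X k' l\<bar> \<le> r" using y l by (auto simp: cube_def)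
          then have "\<bar>X k l - X k' l\<bar> \<le> 2 * r" by linarith
          moreover have "X k l - X k' l = (\<Sum>j<n. a j * (Y (Suc j) l - Y 0 l)) / 2"
          proof -
            have "P k l - P k' l = (\<Sum>j<n. a j * (Y (Suc j) l - Y 0 l))"
              unfolding Peq a_def by (simp add: left_diff_distrib sum_subtractf)
            moreover have "X k l - X k' l = (P k l - P k' l) / 2" by (simp add: X_def field_simps)
            ultimately show ?thesis by simp
          qed
          ultimately show "\<bar>\<Sum>j<n. a j * (Y (Suc j) l - Y 0 l)\<bar> \<le> 4 * r" by linarith
        qed
        also have "2 * (K * (4 * r)) = 8 / (9 * (real n * real N))" using K0 by (simp add: r_def c_def)
        also have "\<dots> < 1 / (real n * real N)" using n N by (simp add: field_simps)
        also have "\<dots> \<le> \<bar>a i\<bar>"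
        proof -
          have "a i = (real (k i) - real (k' i)) / (real n * real N)" by (simp add: a_def diff_divide_distrib)
          moreover have "1 \<le> \<bar>real (k i) - real (k' i)\<bar>" using i(2) by linarith
          ultimately show ?thesis using n N by (simp add: abs_mult divide_right_mono)
        qed
        finally show False by simp
      qed
    qed
    \<comment> \<open>After squaring, N^(2n) * M * \<delta> * r^n \<le> 1. Since N r = c,
      multiplication by r^(2n) leaves exactly one power: c^(2n) * \<delta> * M \<le> r^n.\<close>
    have "real N ^ n * (sqrt M * sqrt s) \<le> 1"
      using disjoint_cubes_count[OF ps sets finI disj XM] cardI by simp
    then have "(real N ^ n * (sqrt M * sqrt s))\<^sup>2 \<le> 1"
      using s by (intro power_le_one) (auto simp: M_def)
    then have "(real N ^ n)\<^sup>2 * (M * s) \<le> 1" using s by (simp add: power_mult_distrib M_def)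
    moreover have "real N ^ n * r ^ n = c ^ n" using N by (simp add: r_def power_mult_distrib[symmetric])
    ultimately have "(c ^ n)\<^sup>2 * (M * s) \<le> (r ^ n)\<^sup>2"
    proof -
      have "(c ^ n)\<^sup>2 * (M * s) = (r ^ n)\<^sup>2 * ((real N ^ n)\<^sup>2 * (M * s))"
        unfolding \<open>real N ^ n * r ^ n = c ^ n\<close>[symmetric] by (simp add: power_mult_distrib mult_ac)
      also have "\<dots> \<le> (r ^ n)\<^sup>2 * 1"
        using \<open>(real N ^ n)\<^sup>2 * (M * s) \<le> 1\<close> by (intro mult_left_mono) auto
      finally show ?thesis by simp
    qed
    then have "((c ^ n)\<^sup>2 * \<delta> * M) * r ^ n \<le> r ^ n * r ^ n" by (simp add: s_def power2_eq_square mult_ac)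
    then have "(c ^ n)\<^sup>2 * \<delta> * M \<le> r ^ n" by (rule mult_right_le_imp_le) (simp add: r)
    then have "M \<le> r ^ n / ((c ^ n)\<^sup>2 * \<delta>)" using c \<delta> by (simp add: field_simps)
    also have "\<dots> = C * r ^ n" by (simp add: C_def power_one_over)
    finally show ?thesis by (simp add: M_def r_def)
  qed
  moreover have "0 \<le> C" using \<delta> by (simp add: C_def)
  ultimately show ?thesis by (intro that[of c C] c)
qed

section \<open>Absolute continuity and the density\<close>

lemma compact_thickening:
  assumes K: "compact K" "K \<subseteq> Rn n"
  shows "compact {x \<in> Rn n. \<exists>y\<in>K. \<forall>i<n. \<bar>x i - y i\<bar> \<le> r}"
proof -
  have "compact ((\<lambda>(y, u). \<lambda>i. if i < n then y i + u i else undefined) ` (K \<times> cube n (\<lambda>_. 0) r))"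
  proof (rule compact_continuous_image)
    show "compact (K \<times> cube n (\<lambda>_. 0) r)" by (intro compact_Times K compact_cube)
    show "continuous_on (K \<times> cube n (\<lambda>_. 0) r) (\<lambda>(y, u). \<lambda>i. if i < n then y i + u i else undefined)"
      unfolding case_prod_beta'
    proof (intro continuous_on_coordinatewise_then_product)
      fix i
      have "continuous_on UNIV (\<lambda>p :: (nat \<Rightarrow> real) \<times> (nat \<Rightarrow> real). fst p i + snd p i)"
        by (intro continuous_on_add continuous_on_compose2[OF continuous_on_product_coordinates, of _ fst]
            continuous_on_compose2[OF continuous_on_product_coordinates, of _ snd] continuous_on_fst continuous_on_snd continuous_on_id) auto
      then show "continuous_on (K \<times> cube n (\<lambda>_. 0) r) (\<lambda>p. if i < n then fst p i + snd p i else undefined)"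
        by (cases "i < n") (auto intro: continuous_on_subset)
    qed
  qed
  moreover have "(\<lambda>(y, u). \<lambda>i. if i < n then y i + u i else undefined) ` (K \<times> cube n (\<lambda>_. 0) r) = {x \<in> Rn n. \<exists>y\<in>K. \<forall>i<n. \<bar>x i - y i\<bar> \<le> r}"
  proof (intro set_eqI iffI)
    fix x assume "x \<in> (\<lambda>(y, u). \<lambda>i. if i < n then y i + u i else undefined) ` (K \<times> cube n (\<lambda>_. 0) r)"
    then obtain p where p: "p \<in> K \<times> cube n (\<lambda>_. 0) r" "x = (\<lambda>(y, u). \<lambda>i. if i < n then y i + u i else undefined) p" by (rule imageE)
    define y u where "y = fst p" and "u = snd p"
    have "y \<in> K" "u \<in> cube n (\<lambda>_. 0) r" "x = (\<lambda>i. if i < n then y i + u i else undefined)"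
      using p unfolding y_def u_def by (simp_all only: mem_Times_iff case_prod_beta)
    then have "x \<in> Rn n" "\<forall>i<n. \<bar>x i - y i\<bar> \<le> r" by (simp_all add: cube_def PiE_iff extensional_def)
    then show "x \<in> {x \<in> Rn n. \<exists>y\<in>K. \<forall>i<n. \<bar>x i - y i\<bar> \<le> r}" using \<open>y \<in> K\<close> by blast
  next
    fix x assume "x \<in> {x \<in> Rn n. \<exists>y\<in>K. \<forall>i<n. \<bar>x i - y i\<bar> \<le> r}"
    then obtain y where y: "x \<in> Rn n" "y \<in> K" "\<forall>i<n. \<bar>x i - y i\<bar> \<le> r" by blast
    define u where "u = (\<lambda>i. if i < n then x i - y i else undefined)"
    have "u \<in> cube n (\<lambda>_. 0) r" using y(3) by (auto simp: u_def cube_def PiE_iff extensional_def)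
    moreover have "x = (\<lambda>i. if i < n then y i + u i else undefined)"
      using y(1) by (auto simp: u_def PiE_iff extensional_def)
    ultimately show "x \<in> (\<lambda>(y, u). \<lambda>i. if i < n then y i + u i else undefined) ` (K \<times> cube n (\<lambda>_. 0) r)"
      using y(2) by (intro image_eqI[of _ _ "(y, u)"]) auto
  qed
  ultimately show ?thesis by simp
qed

lemma emeasure_compact_leb_finite:
  assumes "compact K" "K \<subseteq> Rn n"
  shows "emeasure (leb n) K < \<infinity>"
proof -
  have "\<exists>B. \<forall>x\<in>K. \<bar>x i\<bar> \<le> B" for i
  proof -
    have "compact ((\<lambda>x. x i) ` K)"
      by (intro compact_continuous_image assms continuous_on_subset[OF continuous_on_product_coordinates]) auto
    then have "bounded ((\<lambda>x. x i) ` K)" by (rule compact_imp_bounded)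
    then show ?thesis by (auto simp: bounded_iff)
  qed
  then obtain B where B: "\<And>i x. x \<in> K \<Longrightarrow> \<bar>x i\<bar> \<le> B i" by metis
  have "K \<subseteq> cube n (\<lambda>_. 0) (\<Sum>i<n. \<bar>B i\<bar>)"
  proof
    fix x assume x: "x \<in> K"
    have "\<bar>x i\<bar> \<le> (\<Sum>i<n. \<bar>B i\<bar>)" if "i < n" for i
      using B[OF x, of i] member_le_sum[of i "{..<n}" "\<lambda>i. \<bar>B i\<bar>"] that by force
    then show "x \<in> cube n (\<lambda>_. 0) (\<Sum>i<n. \<bar>B i\<bar>)" using x assms(2) by (auto simp: cube_def)
  qed
  then have "emeasure (leb n) K \<le> emeasure (leb n) (cube n (\<lambda>_. 0) (\<Sum>i<n. \<bar>B i\<bar>))"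
    by (intro emeasure_mono) auto
  also have "\<dots> < \<infinity>" by (subst emeasure_cube) (auto intro: sum_nonneg)
  finally show ?thesis .
qed

lemma tendsto_coordinatewise:
  fixes y :: "nat \<Rightarrow> nat \<Rightarrow> real"
  assumes "\<And>i. (\<lambda>k. y k i) \<longlonglongrightarrow> x i"
  shows "y \<longlonglongrightarrow> x"
proof -
  have "limitin (product_topology (\<lambda>_. euclidean) UNIV) y x sequentially"
    unfolding limitin_componentwise using assms by (simp add: limitin_canonical_iff)
  then show ?thesis by (simp only: euclidean_product_topology limitin_canonical_iff)
qed

text \<open>Averaging over cubes bounds \<nu> K, for compact K, by C / 2^n times the volume of a
  thickening of K. As the radius tends to 0 these volumes tend to that of K, which is 0 if K lies in
  a null set.\<close>

lemma log_concave_absolutely_continuous: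
  assumes lc: "log_concave n \<nu>" and n: "0 < n"
  shows "absolutely_continuous (leb n) \<nu>"
  unfolding absolutely_continuous_def
proof
  have ps: "prob_space \<nu>" and sets: "sets \<nu> = sets (leb n)" using lc by (auto simp: log_concave_def)
  interpret prob_space \<nu> by fact
  fix A assume A: "A \<in> null_sets (leb n)"
  then have As: "A \<in> sets \<nu>" using sets by auto
  have "emeasure \<nu> A = 0"
  proof (rule ccontr)
    assume "emeasure \<nu> A \<noteq> 0"
    then obtain K where K: "K \<subseteq> A" "compact K" "0 < emeasure \<nu> K"
      using compact_subset_pos_measure[OF ps sets As] by (auto simp: zero_less_iff_neq_zero)
    have KR: "K \<subseteq> Rn n" using K(1) sets.sets_into_space[OF As] sets_eq_imp_space_eq[OF sets] by auto
    have Ks: "K \<in> sets (leb n)" by (rule compact_in_sets_leb[OF K(2) KR])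
    have K0: "emeasure (leb n) K = 0"
      using null_sets_subset[OF A Ks K(1)] by auto
    obtain c C where c: "0 < c" "0 \<le> C" and bd: "\<And>N x. 0 < N \<Longrightarrow> measure \<nu> (cube n x (c / real N)) \<le> C * (c / real N) ^ n"
      using cube_measure_bound[OF lc n] by blast
    \<comment> \<open>The radii follow the sequence c / N with N > 0, for which the bound on cube
      masses is available.\<close>
    define T where "T k = {x \<in> Rn n. \<exists>y\<in>K. \<forall>i<n. \<bar>x i - y i\<bar> \<le> c / real (Suc k)}" for k
    have cT: "compact (T k)" for k unfolding T_def by (rule compact_thickening[OF K(2) KR])
    have TR: "T k \<subseteq> Rn n" for k by (auto simp: T_def)
    have Ts: "T k \<in> sets (leb n)" for k by (rule compact_in_sets_leb[OF cT TR])
    have le: "emeasure \<nu> K \<le> ennreal (C / 2 ^ n) * emeasure (leb n) (T k)" for k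
    proof -
      define r where "r = c / real (Suc k)"
      have r: "0 < r" using c by (simp add: r_def)
      have "ennreal ((2 * r) ^ n) * emeasure \<nu> K \<le> (\<integral>\<^sup>+x. emeasure \<nu> (cube n x r) * indicator (T k) x \<partial>leb n)"
      proof (rule cube_Fubini[OF ps sets _ Ts])
        show "cube n w r \<subseteq> T k" if "w \<in> K" for w
          using that by (auto simp: cube_def T_def r_def)
      qed (use r Ks sets in auto)
      also have "\<dots> \<le> (\<integral>\<^sup>+x. ennreal (C * r ^ n) * indicator (T k) x \<partial>leb n)"
        using bd[of "Suc k"] by (intro nn_integral_mono mult_right_mono) (auto simp: r_def emeasure_eq_measure ennreal_leI)
      also have "\<dots> = ennreal (C * r ^ n) * emeasure (leb n) (T k)"
        using Ts by (rule nn_integral_cmult_indicator)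
      finally have le: "ennreal ((2 * r) ^ n) * emeasure \<nu> K \<le> ennreal (C * r ^ n) * emeasure (leb n) (T k)" .
      have "ennreal (1 / (2 * r) ^ n) * (ennreal ((2 * r) ^ n) * emeasure \<nu> K) = emeasure \<nu> K"
        using r by (simp add: mult.assoc[symmetric] ennreal_mult'[symmetric])
      then have "emeasure \<nu> K \<le> ennreal (1 / (2 * r) ^ n) * (ennreal (C * r ^ n) * emeasure (leb n) (T k))"
        using mult_left_mono[OF le, of "ennreal (1 / (2 * r) ^ n)"] by simp
      also have "\<dots> = ennreal (1 / (2 * r) ^ n * (C * r ^ n)) * emeasure (leb n) (T k)"
      proof -
        have "ennreal (1 / (2 * r) ^ n * (C * r ^ n)) = ennreal (1 / (2 * r) ^ n) * ennreal (C * r ^ n)"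
          using r c by (intro ennreal_mult) auto
        then show ?thesis by (simp only: mult.assoc)
      qed
      also have "1 / (2 * r) ^ n * (C * r ^ n) = C / 2 ^ n" using r by (simp add: power_mult_distrib)
      finally show ?thesis .
    qed
    have "(\<lambda>k. emeasure (leb n) (T k)) \<longlonglongrightarrow> emeasure (leb n) (\<Inter>k. T k)"
    proof (rule Lim_emeasure_decseq)
      show "range T \<subseteq> sets (leb n)" using Ts by auto
      show "decseq T" unfolding decseq_def T_def
      proof (intro allI impI subsetI)
        fix k l x assume kl: "k \<le> l" and x: "x \<in> {x \<in> Rn n. \<exists>y\<in>K. \<forall>i<n. \<bar>x i - y i\<bar> \<le> c / real (Suc l)}"
        have "c / real (Suc l) \<le> c / real (Suc k)" using c kl by (intro divide_left_mono) auto
        then show "x \<in> {x \<in> Rn n. \<exists>y\<in>K. \<forall>i<n. \<bar>x i - y i\<bar> \<le> c / real (Suc k)}" using x by (blast intro: order.trans)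
      qed
      show "emeasure (leb n) (T k) \<noteq> \<infinity>" for k using emeasure_compact_leb_finite[OF cT TR, of k] by simp
    qed
    moreover have "(\<Inter>k. T k) = K"
    proof (intro set_eqI iffI)
      fix x assume x: "x \<in> (\<Inter>k. T k)"
      then have "\<forall>k. \<exists>y\<in>K. \<forall>i<n. \<bar>x i - y i\<bar> \<le> c / real (Suc k)" by (auto simp: T_def)
      then obtain y where y: "\<And>k. y k \<in> K" "\<And>k i. i < n \<Longrightarrow> \<bar>x i - y k i\<bar> \<le> c / real (Suc k)" by metis
      have lim0: "(\<lambda>k. c * inverse (real (Suc k))) \<longlonglongrightarrow> c * 0"
        by (intro tendsto_intros LIMSEQ_inverse_real_of_nat)
      have xR: "x \<in> Rn n" using x TR by blast
      have "(\<lambda>k. y k i) \<longlonglongrightarrow> x i" for i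
      proof (cases "i < n")
        case True
        have "(\<lambda>k. y k i - x i) \<longlonglongrightarrow> 0"
          by (rule Lim_null_comparison[OF _ lim0[simplified]])
             (use y(2)[OF True] in \<open>auto simp: abs_minus_commute divide_inverse\<close>)
        then show ?thesis by (simp add: LIM_zero_cancel)
      next
        case False
        then have "y k i = x i" for k using y(1)[of k] KR xR by (auto simp: PiE_iff extensional_def)
        then show ?thesis by simp
      qed
      then have "y \<longlonglongrightarrow> x" by (rule tendsto_coordinatewise)
      then show "x \<in> K" by (rule closed_sequentially[OF compact_imp_closed[OF K(2)] y(1)])
    next
      fix x assume "x \<in> K"
      then show "x \<in> (\<Inter>k. T k)" using KR c by (auto simp: T_def intro!: bexI[of _ x])
    qed
    ultimately have "(\<lambda>k. emeasure (leb n) (T k)) \<longlonglongrightarrow> 0" using K0 by simp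
    then have "(\<lambda>k. ennreal (C / 2 ^ n) * emeasure (leb n) (T k)) \<longlonglongrightarrow> ennreal (C / 2 ^ n) * 0"
      by (intro ennreal_tendsto_cmult) auto
    then have "emeasure \<nu> K \<le> 0" using le by (intro LIMSEQ_le_const) auto
    then show False using K by simp
  qed
  then show "A \<in> null_sets \<nu>" using As by auto
qed

text \<open>Radon-Nikodym. It guarantees that the choice operator in
  \<open>isotropic_constant\<close> returns an actual density of \<nu>.\<close>

lemma log_concave_has_density:
  assumes lc: "log_concave n \<nu>" and n: "0 < n"
  shows "\<exists>f. is_density n \<nu> f"
proof -
  have ps: "prob_space \<nu>" and sets: "sets \<nu> = sets (leb n)" using lc by (auto simp: log_concave_def)
  interpret prob_space \<nu> by fact
  interpret L: sigma_finite_measure "leb n" by (rule sigma_finite_leb)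
  have ac: "absolutely_continuous (leb n) \<nu>" by (rule log_concave_absolutely_continuous[OF assms])
  obtain D where D: "D \<in> borel_measurable (leb n)" "AE x in leb n. RN_deriv (leb n) \<nu> x = ennreal (D x)" "AE x in \<nu>. 0 < D x" "\<And>x. 0 \<le> D x"
    by (rule L.real_RN_deriv[OF finite_measure_axioms ac sets]) (rule that)
  have "\<nu> = density (leb n) (RN_deriv (leb n) \<nu>)" using L.density_RN_deriv[OF ac sets] by simp
  also have "\<dots> = density (leb n) (\<lambda>x. ennreal (D x))"
    using D by (intro density_cong) auto
  finally show ?thesis unfolding is_density_def using D by blast
qed

section \<open>Random polytopes\<close>

lemma conv_ptsI:
  assumes "\<And>i. i < N \<Longrightarrow> 0 \<le> w i" "(\<Sum>i<N. w i) = 1" "x = (\<lambda>k. \<Sum>i<N. w i * X i k)"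
  shows "x \<in> conv_pts N X"
  unfolding conv_pts_def using assms by (intro CollectI exI[of _ w] conjI allI impI)

lemma conv_ptsE:
  assumes "x \<in> conv_pts N X"
  obtains w where "\<And>i. i < N \<Longrightarrow> 0 \<le> w i" "(\<Sum>i<N. w i) = 1" "x = (\<lambda>k. \<Sum>i<N. w i * X i k)"
  using assms unfolding conv_pts_def by (elim CollectE exE conjE) (rule that; simp)

lemma space_PiM_component:
  "X \<in> space (PiM {..<N} (\<lambda>_. \<mu>)) \<Longrightarrow> i < N \<Longrightarrow> X i \<in> space \<mu>"
  by (rule measurable_space[OF measurable_component_singleton]) auto

text \<open>Beyond n a convex combination of the common value \<open>undefined\<close> is again
  \<open>undefined\<close>, because the weights sum to 1.\<close>

lemma conv_pts_subset_Rn: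
  assumes "\<And>i. i < N \<Longrightarrow> X i \<in> Rn n"
  shows "conv_pts N X \<subseteq> Rn n"
proof
  fix x assume "x \<in> conv_pts N X"
  then obtain w where w: "(\<Sum>i<N. w i) = (1::real)" and x: "x = (\<lambda>k. \<Sum>i<N. w i * X i k)"
    by (rule conv_ptsE)
  have "x k = undefined" if "\<not> k < n" for k
  proof -
    have "x k = (\<Sum>i<N. w i * undefined)"
      unfolding x using assms that by (intro sum.cong) (auto simp: PiE_iff extensional_def)
    also have "\<dots> = undefined" using w by (simp add: sum_distrib_right[symmetric])
    finally show ?thesis .
  qed
  then show "x \<in> Rn n" by (auto simp: PiE_iff extensional_def)
qed

lemma compact_conv_pts: "compact (conv_pts N X)"
proof -
  \<comment> \<open>The weights are functions on all of nat; fixing them to 0 from N on makes the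
    simplex compact.\<close>
  define S where "S = PiE UNIV (\<lambda>i. if i < N then {0..1::real} else {0}) \<inter> {w. (\<Sum>i<N. w i) = 1}"
  have "closed {w :: nat \<Rightarrow> real. (\<Sum>i<N. w i) = 1}"
    by (intro closed_Collect_eq continuous_on_sum continuous_on_product_coordinates continuous_on_const)
  then have S: "compact S" unfolding S_def by (intro compact_Int_closed compact_PiE_UNIV) auto
  have "conv_pts N X = (\<lambda>w k. \<Sum>i<N. w i * X i k) ` S"
  proof (intro set_eqI iffI)
    fix x assume "x \<in> conv_pts N X"
    then obtain w where w: "\<And>i. i < N \<Longrightarrow> 0 \<le> w i" "(\<Sum>i<N. w i) = (1::real)" and x: "x = (\<lambda>k. \<Sum>i<N. w i * X i k)"
      by (rule conv_ptsE) (rule that)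
    define w' where "w' i = (if i < N then w i else 0)" for i
    have "w i \<le> 1" if "i < N" for i
      using member_le_sum[of i "{..<N}" w] w that by auto
    then have "w' \<in> S" using w by (auto simp: S_def w'_def PiE_iff)
    moreover have "x = (\<lambda>k. \<Sum>i<N. w' i * X i k)" by (simp add: x w'_def)
    ultimately show "x \<in> (\<lambda>w k. \<Sum>i<N. w i * X i k) ` S" by (intro image_eqI[of x _ w'])
  next
    fix x assume "x \<in> (\<lambda>w k. \<Sum>i<N. w i * X i k) ` S"
    then obtain w where w: "w \<in> S" and x: "x = (\<lambda>k. \<Sum>i<N. w i * X i k)" by (rule imageE)
    have "w i \<in> (if i < N then {0..1} else {0})" for i using w by (auto simp: S_def PiE_iff)
    then have "0 \<le> w i" for i by (metis atLeastAtMost_iff order.refl singletonD)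
    moreover have "(\<Sum>i<N. w i) = 1" using w by (simp add: S_def)
    ultimately show "x \<in> conv_pts N X" using x by (rule conv_ptsI)
  qed
  moreover have "continuous_on S (\<lambda>w k. \<Sum>i<N. w i * X i k)"
    by (intro continuous_on_coordinatewise_then_product continuous_on_sum continuous_on_mult continuous_on_const
        continuous_on_subset[OF continuous_on_product_coordinates subset_UNIV])
  ultimately show ?thesis using compact_continuous_image[OF _ S] by simp
qed

lemma conv_pts_midpoint:
  assumes "x \<in> conv_pts N X" "y \<in> conv_pts N X"
  shows "(\<lambda>k. (x k + y k) / 2) \<in> conv_pts N X"
proof -
  obtain v where v: "\<And>i. i < N \<Longrightarrow> 0 \<le> v i" "(\<Sum>i<N. v i) = (1::real)" "x = (\<lambda>k. \<Sum>i<N. v i * X i k)"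
    using assms(1) by (rule conv_ptsE) (rule that)
  obtain w where w: "\<And>i. i < N \<Longrightarrow> 0 \<le> w i" "(\<Sum>i<N. w i) = (1::real)" "y = (\<lambda>k. \<Sum>i<N. w i * X i k)"
    using assms(2) by (rule conv_ptsE) (rule that)
  have "(\<lambda>k. (x k + y k) / 2) = (\<lambda>k. \<Sum>i<N. ((v i + w i) / 2) * X i k)"
    unfolding v(3) w(3) sum.distrib[symmetric] sum_divide_distrib by (simp add: distrib_right)
  moreover have "0 \<le> (v i + w i) / 2" if "i < N" for i using v(1)[OF that] w(1)[OF that] by simp
  moreover have "(\<Sum>i<N. (v i + w i) / 2) = 1"
    using v(2) w(2) by (simp add: sum.distrib sum_divide_distrib[symmetric])
  ultimately show ?thesis by (intro conv_ptsI)
qed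

lemma conv_pts_in_halfspace:
  assumes "x \<in> conv_pts N X"
  shows "\<exists>i<N. ip n \<xi> x \<le> ip n \<xi> (X i)"
proof (rule ccontr)
  assume "\<not> ?thesis"
  then have lt: "ip n \<xi> (X i) < ip n \<xi> x" if "i < N" for i using that by force
  obtain w where w: "\<And>i. i < N \<Longrightarrow> 0 \<le> w i" "(\<Sum>i<N. w i) = (1::real)" "x = (\<lambda>k. \<Sum>i<N. w i * X i k)"
    using assms by (rule conv_ptsE) (rule that)
  have "ip n \<xi> x = (\<Sum>i<N. w i * ip n \<xi> (X i))"
    unfolding ip_def w(3) sum_distrib_left by (subst sum.swap) (simp add: mult_ac)
  moreover have "ip n \<xi> x = (\<Sum>i<N. w i * ip n \<xi> x)" using w(2) by (simp add: sum_distrib_right[symmetric])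
  ultimately have "(\<Sum>i<N. w i * (ip n \<xi> x - ip n \<xi> (X i))) = 0"
    by (simp add: right_diff_distrib sum_subtractf)
  then have "\<forall>i\<in>{..<N}. w i * (ip n \<xi> x - ip n \<xi> (X i)) = 0"
    using w(1) lt by (subst (asm) sum_nonneg_eq_0_iff) (auto intro!: mult_nonneg_nonneg intro: less_imp_le)
  then have "\<forall>i\<in>{..<N}. w i = 0" using lt by fastforce
  then show False using w(2) by simp
qed

section \<open>Measurability of the polytope and its expected measure\<close>

text \<open>Separation from a polytope amounts to finitely many strict inequalities, which survive a
  small change of the direction. Rational directions form a countable set, as the measurability of
  the polytope requires.\<close>

lemma rational_separation:
  assumes X: "\<And>i. i < N \<Longrightarrow> X i \<in> Rn n" and x: "x \<in> Rn n" "x \<notin> conv_pts N X"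
  shows "\<exists>q\<in>PiE {..<n} (\<lambda>_. \<rat>). \<forall>i<N. ip n q (X i) < ip n q x"
proof -
  obtain \<xi> where \<xi>: "\<And>z. z \<in> conv_pts N X \<Longrightarrow> ip n \<xi> z < ip n \<xi> x"
    using separate_point_compact[OF compact_conv_pts conv_pts_subset_Rn[OF X] conv_pts_midpoint x] by blast
  have XC: "X i \<in> conv_pts N X" if i: "i < N" for i
  proof -
    have "X i = (\<lambda>k. \<Sum>j<N. (if j = i then 1 else 0) * X j k)"
      using i by (simp add: if_distrib[where f="\<lambda>a. a * _"] cong: if_cong)
    moreover have "(\<Sum>j<N. (if j = i then 1 else 0)) = (1::real)" using i by simp
    ultimately show ?thesis by (intro conv_ptsI[of N "\<lambda>j. if j = i then 1 else 0"]) auto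
  qed
  \<comment> \<open>The smallest gap in the separating inequalities; the extra 1 keeps the set
    nonempty when N = 0.\<close>
  define \<eta> where "\<eta> = Min (insert 1 ((\<lambda>i. ip n \<xi> (\<lambda>k. x k - X i k)) ` {..<N}))"
  have \<eta>: "0 < \<eta>" unfolding \<eta>_def using \<xi>[OF XC] by (subst Min_gr_iff) (auto simp: ip_diff)
  have \<eta>le: "\<eta> \<le> ip n \<xi> (\<lambda>k. x k - X i k)" if "i < N" for i
    unfolding \<eta>_def using that by (intro Min_le) auto
  define B where "B = (\<Sum>i<N. \<Sum>k<n. \<bar>x k - X i k\<bar>) + 1"
  have B: "0 < B" unfolding B_def by (intro add_nonneg_pos sum_nonneg) auto
  have Ble: "(\<Sum>k<n. \<bar>x k - X i k\<bar>) < B" if "i < N" for i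
    using member_le_sum[of i "{..<N}" "\<lambda>i. \<Sum>k<n. \<bar>x k - X i k\<bar>"] that by (simp add: B_def sum_nonneg)
  \<comment> \<open>Changing each coordinate of the direction by less than this alters every gap by
    less than \<eta>.\<close>
  define \<delta> where "\<delta> = \<eta> / B"
  have \<delta>: "0 < \<delta>" using \<eta> B by (simp add: \<delta>_def)
  have "\<exists>q\<in>\<rat>. \<bar>q - \<xi> k\<bar> < \<delta>" for k
    using Rats_dense_in_real[of "\<xi> k" "\<xi> k + \<delta>"] \<delta> by force
  then obtain p where p: "\<And>k. p k \<in> \<rat>" "\<And>k. \<bar>p k - \<xi> k\<bar> < \<delta>" by metis
  define q where "q = restrict p {..<n}"
  have "ip n q (X i) < ip n q x" if i: "i < N" for i
  proof -
    have "ip n q (\<lambda>k. x k - X i k) = ip n \<xi> (\<lambda>k. x k - X i k) + (\<Sum>k<n. (p k - \<xi> k) * (x k - X i k))"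
      unfolding ip_def sum.distrib[symmetric] by (intro sum.cong) (auto simp: q_def algebra_simps)
    moreover have "\<bar>\<Sum>k<n. (p k - \<xi> k) * (x k - X i k)\<bar> < \<eta>"
    proof -
      have "\<bar>\<Sum>k<n. (p k - \<xi> k) * (x k - X i k)\<bar> \<le> (\<Sum>k<n. \<delta> * \<bar>x k - X i k\<bar>)"
        using less_imp_le[OF p(2)] by (intro order.trans[OF sum_abs] sum_mono) (auto simp: abs_mult intro!: mult_right_mono)
      also have "\<dots> = \<delta> * (\<Sum>k<n. \<bar>x k - X i k\<bar>)" by (rule sum_distrib_left[symmetric])
      also have "\<dots> < \<delta> * B" using Ble[OF i] \<delta> by (rule mult_strict_left_mono)
      also have "\<dots> = \<eta>" using B by (simp add: \<delta>_def)
      finally show ?thesis .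
    qed
    ultimately have "0 < ip n q (\<lambda>k. x k - X i k)" using \<eta>le[OF i] by linarith
    then show ?thesis by (simp add: ip_diff)
  qed
  moreover have "q \<in> PiE {..<n} (\<lambda>_. \<rat>)" using p(1) by (auto simp: q_def)
  ultimately show ?thesis by blast
qed

text \<open>Membership in the polytope is a countable intersection, over rational directions, of
  finite unions of closed conditions saying that some vertex lies at least as far in that
  direction.\<close>

lemma conv_pts_graph_measurable:
  assumes \<mu>: "sets \<mu> = sets (leb n)" and \<nu>: "sets \<nu> = sets (leb n)"
  shows "{p \<in> space (PiM {..<N} (\<lambda>_. \<mu>) \<Otimes>\<^sub>M \<nu>). snd p \<in> conv_pts N (fst p)} \<in> sets (PiM {..<N} (\<lambda>_. \<mu>) \<Otimes>\<^sub>M \<nu>)"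
proof -
  let ?M = "PiM {..<N} (\<lambda>_. \<mu>) \<Otimes>\<^sub>M \<nu>"
  let ?Q = "PiE {..<n} (\<lambda>_. \<rat>) :: (nat \<Rightarrow> real) set"
  have s\<mu>: "space \<mu> = Rn n" and s\<nu>: "space \<nu> = Rn n"
    using sets_eq_imp_space_eq[OF \<mu>] sets_eq_imp_space_eq[OF \<nu>] by auto
  have c\<mu>: "ip n q \<in> borel_measurable \<mu>" and c\<nu>: "ip n q \<in> borel_measurable \<nu>" for q
  proof -
    have "continuous_on UNIV (ip n q)"
      using continuous_on_ip[OF continuous_on_const[of UNIV q] continuous_on_id] by simp
    from borel_measurable_leb_continuous[OF this, of n]
    show "ip n q \<in> borel_measurable \<mu>" "ip n q \<in> borel_measurable \<nu>"
      using \<mu> \<nu> by (simp_all cong: measurable_cong_sets)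
  qed
  have Q: "countable ?Q" by (intro countable_PiE) (auto simp: countable_rat)
  have "snd p \<in> conv_pts N (fst p) \<longleftrightarrow> (\<forall>q\<in>?Q. \<exists>i\<in>{..<N}. ip n q (snd p) \<le> ip n q (fst p i))" if p: "p \<in> space ?M" for p
  proof
    assume "snd p \<in> conv_pts N (fst p)"
    then show "\<forall>q\<in>?Q. \<exists>i\<in>{..<N}. ip n q (snd p) \<le> ip n q (fst p i)"
      using conv_pts_in_halfspace[of "snd p" N "fst p" n] by blast
  next
    assume *: "\<forall>q\<in>?Q. \<exists>i\<in>{..<N}. ip n q (snd p) \<le> ip n q (fst p i)"
    have 1: "fst p i \<in> Rn n" if "i < N" for i
    proof -
      have "fst p i \<in> space \<mu>"
        using measurable_space[OF measurable_fst p] that by (rule space_PiM_component)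
      then show ?thesis using s\<mu> by simp
    qed
    have 2: "snd p \<in> Rn n" using p s\<nu> by (metis mem_Times_iff space_pair_measure)
    show "snd p \<in> conv_pts N (fst p)"
    proof (rule ccontr)
      assume "snd p \<notin> conv_pts N (fst p)"
      from rational_separation[of N "fst p", OF 1 2 this]
      obtain q where "q \<in> ?Q" "\<forall>i<N. ip n q (fst p i) < ip n q (snd p)" by blast
      then show False using * by (metis lessThan_iff not_le)
    qed
  qed
  then have eq: "{p \<in> space ?M. snd p \<in> conv_pts N (fst p)}
     = {p \<in> space ?M. \<forall>q\<in>?Q. \<exists>i\<in>{..<N}. ip n q (snd p) \<le> ip n q (fst p i)}"
    by (intro Collect_cong conj_cong refl)
  have "{p \<in> space ?M. \<exists>i\<in>{..<N}. ip n q (snd p) \<le> ip n q (fst p i)} \<in> sets ?M" for q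
  proof (intro sets.sets_Collect_finite_Ex)
    fix i assume i: "i \<in> {..<N}"
    have "(\<lambda>p. fst p i) \<in> measurable ?M \<mu>"
      by (rule measurable_compose[OF measurable_fst measurable_component_singleton[OF i]])
    from measurable_compose[OF this c\<mu>] measurable_compose[OF measurable_snd c\<nu>]
    show "{p \<in> space ?M. ip n q (snd p) \<le> ip n q (fst p i)} \<in> sets ?M"
      by (rule borel_measurable_le[rotated])
  qed simp
  then show ?thesis unfolding eq using Q by (rule sets.sets_Collect_countable_All')
qed

lemma prob_in_conv_pts_le:
  assumes ps: "prob_space \<mu>" and sets: "sets \<mu> = sets (leb n)"
  shows "emeasure (PiM {..<N} (\<lambda>_. \<mu>)) {X \<in> space (PiM {..<N} (\<lambda>_. \<mu>)). x \<in> conv_pts N X}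
    \<le> ennreal (real N * measure \<mu> {y \<in> Rn n. ip n \<xi> x \<le> ip n \<xi> y})"
proof -
  interpret prob_space \<mu> by fact
  interpret P: product_prob_space "\<lambda>_. \<mu>" "{..<N}" by standard
  let ?M = "PiM {..<N} (\<lambda>_. \<mu>)"
  let ?H = "{y \<in> Rn n. ip n \<xi> x \<le> ip n \<xi> y}"
  have H: "?H \<in> sets \<mu>" using halfspace_sets sets by simp
  have space: "space \<mu> = Rn n" using sets_eq_imp_space_eq[OF sets] by simp
  define E where "E i = (\<lambda>X. X i) -` ?H \<inter> space ?M" for i
  have Es: "E i \<in> sets ?M" if "i < N" for i
    unfolding E_def using that H by (intro measurable_sets[of "\<lambda>X. X i" ?M \<mu>] measurable_component_singleton) auto
  have Em: "emeasure ?M (E i) = ennreal (measure \<mu> ?H)" if "i < N" for i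
  proof -
    have "emeasure \<mu> ?H = emeasure (distr ?M \<mu> (\<lambda>X. X i)) ?H"
      using P.PiM_component[of i] that by simp
    also have "\<dots> = emeasure ?M (E i)"
      unfolding E_def using that by (intro emeasure_distr measurable_component_singleton H) auto
    finally show ?thesis by (simp add: emeasure_eq_measure)
  qed
  have "{X \<in> space ?M. x \<in> conv_pts N X} \<subseteq> (\<Union>i\<in>{..<N}. E i)"
  proof
    fix X assume X: "X \<in> {X \<in> space ?M. x \<in> conv_pts N X}"
    then obtain i where i: "i < N" "ip n \<xi> x \<le> ip n \<xi> (X i)" using conv_pts_in_halfspace by blast
    have "X i \<in> space \<mu>" using X i by (intro space_PiM_component[of X N]) auto
    then have "X \<in> E i" using X i(2) space unfolding E_def by simp
    then show "X \<in> (\<Union>i\<in>{..<N}. E i)" using i(1) by blast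
  qed
  then have "emeasure ?M {X \<in> space ?M. x \<in> conv_pts N X} \<le> emeasure ?M (\<Union>i\<in>{..<N}. E i)"
    using Es by (intro emeasure_mono) auto
  also have "\<dots> \<le> (\<Sum>i<N. emeasure ?M (E i))"
    using Es by (intro emeasure_subadditive_finite) auto
  also have "\<dots> = ennreal (real N * measure \<mu> ?H)"
    using Em by (simp add: ennreal_mult' ennreal_of_nat_eq_real_of_nat)
  finally show ?thesis .
qed

text \<open>By Fubini the expectation is the \<nu>-integral of the probability that x lies in the
  polytope. This probability is at most 1 on the core, and outside it a union bound over the N
  vertices applies with the halfspace of small \<mu>-mass.\<close>

lemma expected_measure_bound:
  assumes \<mu>: "log_concave n \<mu>" "isotropic n \<mu>" and \<nu>: "prob_space \<nu>" "sets \<nu> = sets (leb n)"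
    and m: "0 < m" and n: "0 < n"
  shows "(\<lambda>X. measure \<nu> (conv_pts N X)) \<in> borel_measurable (PiM {..<N} (\<lambda>_. \<mu>))"
    and "(\<integral>X. measure \<nu> (conv_pts N X) \<partial>(PiM {..<N} (\<lambda>_. \<mu>)))
      \<le> measure \<nu> (core n \<mu> m) + real N * exp (- real n / real m)"
proof -
  have ps: "prob_space \<mu>" and sets: "sets \<mu> = sets (leb n)" using \<mu> by (auto simp: log_concave_def)
  interpret V: prob_space \<nu> by fact
  let ?M = "PiM {..<N} (\<lambda>_. \<mu>)"
  interpret M: prob_space ?M by (intro prob_space_PiM ps)
  interpret P: pair_sigma_finite ?M \<nu> ..
  define G where "G = {p \<in> space (?M \<Otimes>\<^sub>M \<nu>). snd p \<in> conv_pts N (fst p)}"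
  have G: "G \<in> sets (?M \<Otimes>\<^sub>M \<nu>)" unfolding G_def by (rule conv_pts_graph_measurable[OF sets \<nu>(2)])
  have s\<mu>: "space \<mu> = Rn n" and s\<nu>: "space \<nu> = Rn n"
    using sets_eq_imp_space_eq[OF sets] sets_eq_imp_space_eq[OF \<nu>(2)] by auto
  have sec: "Pair X -` G = conv_pts N X" if X: "X \<in> space ?M" for X
  proof -
    have "X i \<in> Rn n" if "i < N" for i
    proof -
      have "X i \<in> space \<mu>" using X that by (rule space_PiM_component)
      then show ?thesis using s\<mu> by simp
    qed
    then have "conv_pts N X \<subseteq> space \<nu>" using conv_pts_subset_Rn s\<nu> by metis
    then show ?thesis using X unfolding G_def by (auto simp: space_pair_measure)
  qed
  have "(\<lambda>X. emeasure \<nu> (Pair X -` G)) \<in> borel_measurable ?M" by (rule V.measurable_emeasure_Pair[OF G])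
  then have me: "(\<lambda>X. emeasure \<nu> (conv_pts N X)) \<in> borel_measurable ?M"
    by (rule measurable_cong[THEN iffD1, rotated]) (simp add: sec)
  then show mm: "(\<lambda>X. measure \<nu> (conv_pts N X)) \<in> borel_measurable ?M"
    unfolding measure_def by measurable
  have core: "core n \<mu> m \<in> sets \<nu>" using core_sets[OF \<mu> m] \<nu>(2) by simp
  have "(\<integral>\<^sup>+X. ennreal (measure \<nu> (conv_pts N X)) \<partial>?M) = (\<integral>\<^sup>+X. emeasure \<nu> (Pair X -` G) \<partial>?M)"
    by (intro nn_integral_cong) (simp add: sec V.emeasure_eq_measure)
  also have "\<dots> = emeasure (?M \<Otimes>\<^sub>M \<nu>) G" by (rule V.emeasure_pair_measure_alt[OF G, symmetric])
  also have "\<dots> = (\<integral>\<^sup>+x. emeasure ?M ((\<lambda>X. (X, x)) -` G) \<partial>\<nu>)" by (rule P.emeasure_pair_measure_alt2[OF G])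
  also have "\<dots> \<le> (\<integral>\<^sup>+x. indicator (core n \<mu> m) x + ennreal (real N * exp (- real n / real m)) \<partial>\<nu>)"
  proof (intro nn_integral_mono)
    fix x assume x: "x \<in> space \<nu>"
    show "emeasure ?M ((\<lambda>X. (X, x)) -` G) \<le> indicator (core n \<mu> m) x + ennreal (real N * exp (- real n / real m))"
    proof (cases "x \<in> core n \<mu> m")
      case True
      have "emeasure ?M ((\<lambda>X. (X, x)) -` G) \<le> 1" by (rule M.emeasure_le_1)
      then show ?thesis using True by (simp add: add_increasing2)
    next
      case False
      obtain \<xi> where \<xi>: "measure \<mu> {y \<in> Rn n. ip n \<xi> x \<le> ip n \<xi> y} \<le> exp (- real n / real m)"
        using halfspace_outside_core[OF \<mu> m n _ False] x s\<nu> by blast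
      have "(\<lambda>X. (X, x)) -` G = {X \<in> space ?M. x \<in> conv_pts N X}"
        using x unfolding G_def by (auto simp: space_pair_measure)
      then have "emeasure ?M ((\<lambda>X. (X, x)) -` G) \<le> ennreal (real N * measure \<mu> {y \<in> Rn n. ip n \<xi> x \<le> ip n \<xi> y})"
        using prob_in_conv_pts_le[OF ps sets] by simp
      also have "\<dots> \<le> ennreal (real N * exp (- real n / real m))"
        using \<xi> by (intro ennreal_leI mult_left_mono) auto
      finally show ?thesis using False by simp
    qed
  qed
  also have "\<dots> = emeasure \<nu> (core n \<mu> m) + ennreal (real N * exp (- real n / real m))"
    using core by (subst nn_integral_add) (auto simp: V.emeasure_space_1)
  also have "\<dots> = ennreal (measure \<nu> (core n \<mu> m) + real N * exp (- real n / real m))"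
    by (simp add: V.emeasure_eq_measure)
  finally have le: "(\<integral>\<^sup>+X. ennreal (measure \<nu> (conv_pts N X)) \<partial>?M) \<le> ennreal (measure \<nu> (core n \<mu> m) + real N * exp (- real n / real m))" .
  have int: "integrable ?M (\<lambda>X. measure \<nu> (conv_pts N X))"
    by (rule M.integrable_const_bound[where B=1]) (use mm in auto)
  have "ennreal (\<integral>X. measure \<nu> (conv_pts N X) \<partial>?M) = (\<integral>\<^sup>+X. ennreal (measure \<nu> (conv_pts N X)) \<partial>?M)"
    by (rule nn_integral_eq_integral[OF int, symmetric]) auto
  then show "(\<integral>X. measure \<nu> (conv_pts N X) \<partial>?M) \<le> measure \<nu> (core n \<mu> m) + real N * exp (- real n / real m)"
    using le by (subst ennreal_le_iff[symmetric]) (simp_all only: add_nonneg_nonneg measure_nonneg mult_nonneg_nonneg of_nat_0_le_iff exp_ge_zero)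
qed

section \<open>The isotropic constant and the choice of parameters\<close>

text \<open>Since \<open>real_of_ereal\<close> maps infinity to 0, a nonzero constant means that the
  essential supremum of the density is finite. It is then L^n and dominates the density almost
  everywhere.\<close>

lemma isotropic_constant_bound:
  assumes lc: "log_concave n \<nu>" and n: "0 < n" and L: "isotropic_constant n \<nu> \<noteq> 0"
  shows "0 < isotropic_constant n \<nu>"
    and "\<And>g. g \<in> borel_measurable (leb n) \<Longrightarrow>
      (\<integral>\<^sup>+x. g x \<partial>\<nu>) \<le> ennreal (isotropic_constant n \<nu> ^ n) * (\<integral>\<^sup>+x. g x \<partial>leb n)"
proof -
  define f where "f = (SOME f. is_density n \<nu> f)"
  have f: "is_density n \<nu> f" unfolding f_def using log_concave_has_density[OF lc n] by (rule someI_ex)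
  then have fm: "f \<in> borel_measurable (leb n)" and f0: "\<And>x. 0 \<le> f x" and dens: "\<nu> = density (leb n) (\<lambda>x. ennreal (f x))"
    by (auto simp: is_density_def)
  define S where "S = real_of_ereal (esssup (leb n) (\<lambda>x. ereal (f x)))"
  have Ldef: "isotropic_constant n \<nu> = S powr (1 / real n)" by (simp add: isotropic_constant_def S_def f_def)
  then have S0: "S \<noteq> 0" using L by auto
  then have "esssup (leb n) (\<lambda>x. ereal (f x)) = ereal S"
    unfolding S_def by (cases "esssup (leb n) (\<lambda>x. ereal (f x))") auto
  then have AE: "AE x in leb n. f x \<le> S" using esssup_AE[of "\<lambda>x. ereal (f x)" "leb n"] by simp
  have "0 \<le> S"
  proof (rule ccontr)
    assume neg: "\<not> 0 \<le> S"
    have "False" if "f x \<le> S" for x using that neg f0[of x] by linarith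
    then have "AE x in leb n. False" using AE by (rule eventually_mono[rotated])
    then have "emeasure (leb n) (space (leb n)) = 0" by (simp add: AE_iff_measurable[OF _ refl])
    moreover have "emeasure (leb n) (cube n (\<lambda>_. 0) 1) \<le> emeasure (leb n) (space (leb n))"
      by (rule emeasure_space)
    ultimately show False by (simp add: emeasure_cube)
  qed
  then have S: "0 < S" using S0 by simp
  then show "0 < isotropic_constant n \<nu>" by (simp add: Ldef)
  have Ln: "isotropic_constant n \<nu> ^ n = S"
    using S n by (simp add: Ldef powr_realpow[symmetric] powr_powr)
  fix g :: "(nat \<Rightarrow> real) \<Rightarrow> ennreal" assume g: "g \<in> borel_measurable (leb n)"
  have "(\<integral>\<^sup>+x. g x \<partial>\<nu>) = (\<integral>\<^sup>+x. ennreal (f x) * g x \<partial>leb n)"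
    using fm g by (subst dens) (simp add: nn_integral_density)
  also have "\<dots> \<le> (\<integral>\<^sup>+x. ennreal S * g x \<partial>leb n)"
    using AE by (intro nn_integral_mono_AE) (auto elim!: eventually_mono intro!: mult_right_mono ennreal_leI)
  also have "\<dots> = ennreal S * (\<integral>\<^sup>+x. g x \<partial>leb n)" using g by (rule nn_integral_cmult)
  finally show "(\<integral>\<^sup>+x. g x \<partial>\<nu>) \<le> ennreal (isotropic_constant n \<nu> ^ n) * (\<integral>\<^sup>+x. g x \<partial>leb n)" unfolding Ln .
qed

text \<open>The Gaussian integral of \<nu> is at least exp (- n) by Jensen's inequality, as the
  second moment is n, and at most L^n * \<pi>^(n/2) by the bound on the density. The resulting lower
  bound for L makes it possible to round m to an integer.\<close>

lemma isotropic_constant_ge: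
  assumes lc: "log_concave n \<nu>" and iso: "isotropic n \<nu>" and n: "0 < n" and L: "isotropic_constant n \<nu> \<noteq> 0"
  shows "exp (- 1) \<le> isotropic_constant n \<nu> * sqrt pi"
proof -
  have ps: "prob_space \<nu>" and sets: "sets \<nu> = sets (leb n)" using lc by (auto simp: log_concave_def)
  interpret prob_space \<nu> by fact
  note bd = isotropic_constant_bound[OF lc n L]
  let ?L = "isotropic_constant n \<nu>"
  let ?Z = "\<lambda>y. nsq n (\<lambda>i. 0 - y i)"
  have Z: "integrable \<nu> ?Z" "expectation ?Z = real n"
    using isotropic_integral_nsq[OF ps iso, of "\<lambda>_. 0"] by (auto simp: nsq_def)
  have E: "integrable \<nu> (\<lambda>y. exp (- ?Z y))"
    using Z(1) nsq_nonneg by (intro integrable_const_bound[where B=1]) auto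
  have "ennreal (exp (- real n)) \<le> ennreal (expectation (\<lambda>y. exp (- ?Z y)))"
    using exp_neg_expectation_le[OF Z(1) E] Z(2) by (intro ennreal_leI) simp
  also have "\<dots> = (\<integral>\<^sup>+y. ennreal (exp (- ?Z y)) \<partial>\<nu>)"
    by (rule nn_integral_eq_integral[OF E, symmetric]) auto
  also have "\<dots> = (\<integral>\<^sup>+y. ennreal (exp (- nsq n y / 1)) \<partial>\<nu>)" by (simp add: nsq_def)
  also have "\<dots> \<le> ennreal (?L ^ n) * (\<integral>\<^sup>+y. ennreal (exp (- nsq n y / 1)) \<partial>leb n)"
    by (rule bd(2)[OF profile_measurable[OF profile_gaussian]]) simp
  also have "(\<integral>\<^sup>+y. ennreal (exp (- nsq n y / 1)) \<partial>leb n) = ennreal (sqrt (pi * 1) ^ n)"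
    by (rule nn_integral_gaussian_leb) simp
  also have "ennreal (?L ^ n) * ennreal (sqrt (pi * 1) ^ n) = ennreal ((?L * sqrt pi) ^ n)"
    using bd(1) by (simp add: ennreal_mult'[symmetric] power_mult_distrib)
  finally have "exp (- real n) \<le> (?L * sqrt pi) ^ n"
    using bd(1) by (subst (asm) ennreal_le_iff) auto
  then have "exp (- 1) ^ n \<le> (?L * sqrt pi) ^ n" by (simp add: exp_of_nat_mult[symmetric])
  then show ?thesis using bd(1) n by (subst (asm) power_mono_iff) auto
qed

theorem theorem5p1:
  shows "\<exists>c1 c2 :: real. \<exists>n0 :: nat. c1 > 0 \<and> c2 > 0 \<and>
    (\<forall>n \<mu> \<nu> N. n \<ge> n0 \<longrightarrow>
       log_concave n \<mu> \<longrightarrow> isotropic n \<mu> \<longrightarrow>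
       log_concave n \<nu> \<longrightarrow> isotropic n \<nu> \<longrightarrow>
       N > n \<longrightarrow> real N \<le> exp (c1 * real n / (isotropic_constant n \<nu>)\<^sup>2) \<longrightarrow>
         (\<lambda>X. measure \<nu> (conv_pts N X)) \<in> borel_measurable (PiM {..<N} (\<lambda>_. \<mu>)) \<and>
         (\<integral>X. measure \<nu> (conv_pts N X) \<partial>(PiM {..<N} (\<lambda>_. \<mu>)))
           \<le> 2 * exp (- c2 * real n / (isotropic_constant n \<nu>)\<^sup>2))"
proof -
  \<comment> \<open>With a = exp 22 * L^2 this gives c / L^2 = 1 / (4 a): rounding m up costs one
    factor 2, and cancelling the factor N costs another.\<close>
  define c :: real where "c = exp (- 22) / 4"
  have c: "0 < c" by (simp add: c_def)
  have main: "(\<lambda>X. measure \<nu> (conv_pts N X)) \<in> borel_measurable (PiM {..<N} (\<lambda>_. \<mu>)) \<and>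
         (\<integral>X. measure \<nu> (conv_pts N X) \<partial>(PiM {..<N} (\<lambda>_. \<mu>))) \<le> 2 * exp (- c * real n / (isotropic_constant n \<nu>)\<^sup>2)"
    if n: "1 \<le> n" and \<mu>: "log_concave n \<mu>" "isotropic n \<mu>" and \<nu>: "log_concave n \<nu>" "isotropic n \<nu>"
      and N: "n < N" "real N \<le> exp (c * real n / (isotropic_constant n \<nu>)\<^sup>2)" for n \<mu> \<nu> N
  proof -
    define L where "L = isotropic_constant n \<nu>"
    have n0: "0 < n" using n by simp
    have ps: "prob_space \<nu>" and sets: "sets \<nu> = sets (leb n)" using \<nu> by (auto simp: log_concave_def)
    interpret prob_space \<nu> by fact
    \<comment> \<open>If the constant were 0, division by zero would make the bound on N equal to
      exp 0 = 1, contradicting N > n \<ge> 1. This disposes of unbounded densities.\<close>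
    have Lne: "isotropic_constant n \<nu> \<noteq> 0"
    proof
      assume "isotropic_constant n \<nu> = 0"
      then show False using N n by simp
    qed
    have L0: "0 < L" unfolding L_def by (rule isotropic_constant_bound(1)[OF \<nu>(1) n0 Lne])
    \<comment> \<open>The exponent is 18 + 2 + 2: the core contributes exp 18 to the square of L *
      exp 9 * sqrt (\<pi> / m), \<pi> is estimated by exp 2, and exp (- 2) is to remain, so that the
      n-th power is at most exp (- n).\<close>
    define a where "a = exp 22 * L\<^sup>2"
    have "(exp (- 1))\<^sup>2 \<le> (L * sqrt pi)\<^sup>2"
      using isotropic_constant_ge[OF \<nu> n0 Lne] unfolding L_def by (intro power_mono) auto
    then have Lpi: "exp (- 2) \<le> L\<^sup>2 * pi" by (simp add: power_mult_distrib exp_double[symmetric])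
    have e2: "4 \<le> exp (2::real)"
    proof -
      have "(2::real)\<^sup>2 \<le> (exp 1)\<^sup>2" using exp_ge_add_one_self[of 1] by (intro power_mono) auto
      then show ?thesis by (simp add: exp_double[symmetric])
    qed
    have "L\<^sup>2 * pi \<le> L\<^sup>2 * 4" using pi_less_4 by (intro mult_left_mono) auto
    then have "exp (- 2) \<le> L\<^sup>2 * 4" using Lpi by linarith
    also have "\<dots> \<le> L\<^sup>2 * exp 2" using e2 by (intro mult_left_mono) auto
    finally have "exp 20 * exp (- 2) \<le> exp 20 * (L\<^sup>2 * exp 2)" by (intro mult_left_mono) auto
    then have a18: "exp 18 \<le> a" by (simp add: a_def exp_add[symmetric] mult_ac) (simp add: mult.assoc[symmetric] exp_add[symmetric] mult.commute)
    have "(1::real) \<le> exp 18" by simp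
    then have a1: "1 \<le> a" using a18 by linarith
    \<comment> \<open>Because a \<ge> 1, rounding up at most doubles it.\<close>
    define m where "m = nat \<lceil>a\<rceil>"
    have ma: "a \<le> real m" "real m \<le> 2 * a" using a1 unfolding m_def by linarith+
    have m: "0 < m" using ma(1) a1 by (cases m) auto
    note bound = expected_measure_bound[OF \<mu> ps sets m n0, of N]
    have core: "measure \<nu> (core n \<mu> m) \<le> exp (- c * real n / L\<^sup>2)"
    proof -
      have "ennreal (measure \<nu> (core n \<mu> m)) = (\<integral>\<^sup>+x. indicator (core n \<mu> m) x \<partial>\<nu>)"
        using core_sets[OF \<mu> m] sets by (simp add: emeasure_eq_measure)
      also have "\<dots> \<le> ennreal (L ^ n) * (\<integral>\<^sup>+x. indicator (core n \<mu> m) x \<partial>leb n)"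
        unfolding L_def using core_sets[OF \<mu> m] by (intro isotropic_constant_bound(2)[OF \<nu>(1) n0 Lne]) auto
      also have "\<dots> \<le> ennreal (L ^ n) * ennreal ((exp 9 * sqrt (pi / real m)) ^ n)"
        using core_sets[OF \<mu> m] emeasure_core[OF \<mu> m] by (intro mult_left_mono) auto
      also have "\<dots> = ennreal ((L * (exp 9 * sqrt (pi / real m))) ^ n)"
        using L0 by (simp add: ennreal_mult'[symmetric] power_mult_distrib)
      finally have "measure \<nu> (core n \<mu> m) \<le> (L * (exp 9 * sqrt (pi / real m))) ^ n"
        using L0 by (subst (asm) ennreal_le_iff) auto
      also have "\<dots> \<le> exp (- 1) ^ n"
      proof (rule power_mono)
        have "(L * (exp 9 * sqrt (pi / real m)))\<^sup>2 = L\<^sup>2 * exp 18 * (pi / real m)"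
          using m by (simp add: power_mult_distrib exp_double[symmetric])
        also have "\<dots> \<le> L\<^sup>2 * exp 18 * (exp 2 / a)"
          using pi_less_4 e2 ma(1) a1 by (intro mult_left_mono frac_le) auto
        also have "\<dots> = (exp (- 1))\<^sup>2"
        proof -
          have "exp (22::real) = exp 18 * exp 2 * (exp 1)\<^sup>2" by (simp add: exp_double[symmetric] exp_add[symmetric])
          then show ?thesis using L0 by (simp add: a_def exp_minus field_simps)
        qed
        finally show "L * (exp 9 * sqrt (pi / real m)) \<le> exp (- 1)" by (rule power2_le_imp_le) simp
      qed (use L0 in auto)
      also have "\<dots> = exp (- real n)" by (simp add: exp_of_nat_mult[symmetric])
      also have "\<dots> \<le> exp (- c * real n / L\<^sup>2)"
      proof -
        have "c / L\<^sup>2 = 1 / (4 * a)" using L0 by (simp add: c_def a_def exp_minus field_simps)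
        also have "\<dots> \<le> 1" using a1 by simp
        finally have "c / L\<^sup>2 * real n \<le> 1 * real n" by (intro mult_right_mono) auto
        then show ?thesis by simp
      qed
      finally show ?thesis .
    qed
    have tail: "real N * exp (- real n / real m) \<le> exp (- c * real n / L\<^sup>2)"
    proof -
      have "2 * (c / L\<^sup>2) = 1 / (2 * a)" using L0 by (simp add: c_def a_def exp_minus field_simps)
      also have "\<dots> \<le> 1 / real m" using ma m by (intro divide_left_mono) auto
      finally have "2 * (c / L\<^sup>2) * real n \<le> 1 / real m * real n" by (intro mult_right_mono) auto
      \<comment> \<open>The decay rate 1 / m is at least twice the rate c / L^2 at which N may grow,
        so half of it is left.\<close>
      then have t: "- real n / real m \<le> - 2 * (c * real n / L\<^sup>2)" by simp
      have "real N * exp (- real n / real m) \<le> exp (c * real n / L\<^sup>2) * exp (- 2 * (c * real n / L\<^sup>2))"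
        using N(2) t unfolding L_def by (intro mult_mono) auto
      also have "\<dots> = exp (- c * real n / L\<^sup>2)" by (simp add: exp_add[symmetric])
      finally show ?thesis .
    qed
    show ?thesis using bound core tail unfolding L_def by (intro conjI) linarith+
  qed
  show ?thesis
    by (rule exI[of _ c], rule exI[of _ c], rule exI[of _ 1]) (use c main in blast)
qed

end
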